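(* Let $d\in\mathbb{N}$, let $f\in\mathcal{R}$, and let $(\sigma_n)_{n\ge1}$ be a sequence of positive integers. Let $(U_n)_{n\ge0}$ be the time-dependent P\'olya urn process with $d$ colors, reinforcement function $f$, addition sequence $(\sigma_n)_{n\ge 1}$ and non-trivial initial composition $U_0$, with total number of balls $\tau_n$ and proportion vector $\theta_n=U_n/\tau_n$ at time $n$. Assume that $$\sum_{n\ge1}\frac{\sigma_n}{\tau_n}=\infty\qquad\text{and}\qquad \sum_{n\ge1}\left(\frac{\sigma_n}{\tau_n}\right)^2<\infty .$$ Then $\mathbb{P}(\mathscr{D})=1$, where $\mathscr{D}$ is the event of dominance $$\mathscr{D}=\Big\{\exists\, i\in\{1,\dots,d\}\ \text{such that}\ \lim_{n\to\infty}(\theta_{n,1},\dots,\theta_{n,d})=e_i\Big\},$$ and $e_i$ denotes the $i$-th coordinate unit vector of $\mathbb{R}^d$.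
   Context: Class $\mathcal{R}$: the set of all functions $f:[0,1]\to\mathbb{R}_+$ such that (A) $f$ is strictly increasing and continuous with $f(0)=0$, $f(1)=1$; (B) $f\in C^1((0,1))$ and the limits $\lim_{x\to0^+}f'(x)$ and $\lim_{x\to1^-}f'(x)$ exist (finitely); (C) $\alpha:=\inf_{x\in(0,1)}\frac{x f'(x)}{f(x)}>1$. Urn process: all random variables live on one probability space $(\Omega,\mathcal{F},\mathbb{P})$. $U_n=(U_{n,1},\dots,U_{n,d})$ is the composition at time $n$, $U_{n,j}$ being the number of balls of color $j$. The initial composition $U_0$ is given and non-trivial (a nonzero vector of nonnegative integers). Put $\tau_n=\|U_n\|_1=\tau_0+\sum_{j=1}^n\sigma_j$ with $\tau_0=\sum_{j=1}^d U_{0,j}$, and $\theta_{n,k}=U_{n,k}/\tau_n$, $\theta_n=(\theta_{n,1},\dots,\theta_{n,d})$. For each $n\ge0$, given $U_0,\dots,U_n$, the vectors $X^{(n+1)}_1,\dots,X^{(n+1)}_{\sigma_{n+1}}$ are i.i.d. with $$\mathbb{P}\big(X^{(n+1)}_i=e_j\mid U_0,\dots,U_n\big)=\frac{f(\theta_{n,j})}{\sum_{k=1}^d f(\theta_{n,k})},\qquad 1\le j\le d,$$ and $U_{n+1}=U_n+\sum_{i=1}^{\sigma_{n+1}}X^{(n+1)}_i$. *)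

theory Defs
  imports "HOL-Probability.Probability"
begin

text \<open>
  The reinforcement functions. Only the values of the function on \<open>{0..1}\<close> matter.
\<close>

definition reinforcement_class :: "(real \<Rightarrow> real) set" where
  "reinforcement_class = {f.
     (\<forall>x\<in>{0..1}. 0 \<le> f x) \<and>
     strict_mono_on {0..1} f \<and> continuous_on {0..1} f \<and> f 0 = 0 \<and> f 1 = 1 \<and>
     f differentiable_on {0<..<1} \<and> continuous_on {0<..<1} (deriv f) \<and>
     (\<exists>l. (deriv f \<longlongrightarrow> l) (at_right 0)) \<and> (\<exists>l. (deriv f \<longlongrightarrow> l) (at_left 1)) \<and>
     (INF x\<in>{0<..<1}. x * deriv f x / f x) > 1}"


definition cond_prob :: "'w measure \<Rightarrow> 'w measure \<Rightarrow> 'w set \<Rightarrow> 'w \<Rightarrow> real" where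
  "cond_prob M F A = real_cond_exp M F (indicator A)"

definition cond_indep_vars ::
  "'w measure \<Rightarrow> 'w measure \<Rightarrow> ('i \<Rightarrow> 'b measure) \<Rightarrow> ('i \<Rightarrow> 'w \<Rightarrow> 'b) \<Rightarrow> 'i set \<Rightarrow> bool" where
  "cond_indep_vars M F N Y I \<longleftrightarrow>
     (\<forall>i\<in>I. Y i \<in> measurable M (N i)) \<and>
     (\<forall>J A. J \<subseteq> I \<and> finite J \<and> (\<forall>i\<in>J. A i \<in> sets (N i)) \<longrightarrow>
        (AE w in M. cond_prob M F {w \<in> space M. \<forall>i\<in>J. Y i w \<in> A i} w =
                    (\<Prod>i\<in>J. cond_prob M F {w \<in> space M. Y i w \<in> A i} w)))"

text \<open>The \<open>\<sigma>\<close>-algebra generated by \<open>U 0, \<dots>, U n\<close>, whose values are taken in a discrete space.\<close>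

definition history :: "'w measure \<Rightarrow> (nat \<Rightarrow> 'w \<Rightarrow> 'b) \<Rightarrow> nat \<Rightarrow> 'w measure" where
  "history M U n = sigma (space M) {U k -` B \<inter> space M | k B. k \<le> n}"


text \<open>
  The colours are the elements of the finite type \<open>'d\<close>; \<open>\<sigma> n\<close> is the number of balls added at
  time \<open>n \<ge> 1\<close> (the value \<open>\<sigma> 0\<close> is never used), and \<open>u0\<close> is the initial composition.
\<close>

definition urn_total :: "nat ^ 'd \<Rightarrow> (nat \<Rightarrow> nat) \<Rightarrow> nat \<Rightarrow> nat" where
  "urn_total u0 \<sigma> n = (\<Sum>j\<in>UNIV. u0 $ j) + (\<Sum>k=1..n. \<sigma> k)"

definition urn_prop ::
  "nat ^ 'd \<Rightarrow> (nat \<Rightarrow> nat) \<Rightarrow> (nat \<Rightarrow> 'w \<Rightarrow> nat ^ 'd) \<Rightarrow> nat \<Rightarrow> 'w \<Rightarrow> real ^ 'd" where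
  "urn_prop u0 \<sigma> U n w = (\<chi> j. real (U n w $ j) / real (urn_total u0 \<sigma> n))"

text \<open>
  \<open>X n i\<close> is the unit vector of the colour of the \<open>i\<close>-th ball added at time \<open>n\<close>. That it is a unit
  vector is not required pointwise: it holds almost surely by \<open>X_distr\<close>, so \<open>urn_total\<close> is almost
  surely the sum of the entries of \<open>U n\<close>.
\<close>

locale polya_urn = prob_space M for M :: "'w measure" +
  fixes f :: "real \<Rightarrow> real"
    and \<sigma> :: "nat \<Rightarrow> nat"
    and u0 :: "nat ^ 'd"
    and U :: "nat \<Rightarrow> 'w \<Rightarrow> nat ^ 'd"
    and X :: "nat \<Rightarrow> nat \<Rightarrow> 'w \<Rightarrow> nat ^ 'd"
  assumes U_0: "w \<in> space M \<Longrightarrow> U 0 w = u0"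
    and U_Suc: "w \<in> space M \<Longrightarrow> U (Suc n) w = U n w + (\<Sum>i=1..\<sigma> (Suc n). X (Suc n) i w)"
    and X_cond_indep:
      "cond_indep_vars M (history M U n) (\<lambda>_. count_space UNIV) (X (Suc n)) {1..\<sigma> (Suc n)}"
    and X_distr:
      "i \<in> {1..\<sigma> (Suc n)} \<Longrightarrow>
       AE w in M. cond_prob M (history M U n) {w \<in> space M. X (Suc n) i w = axis j 1} w =
         f (urn_prop u0 \<sigma> U n w $ j) / (\<Sum>k\<in>UNIV. f (urn_prop u0 \<sigma> U n w $ k))"

definition dominance ::
  "'w measure \<Rightarrow> nat ^ 'd \<Rightarrow> (nat \<Rightarrow> nat) \<Rightarrow> (nat \<Rightarrow> 'w \<Rightarrow> nat ^ 'd) \<Rightarrow> 'w set" where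
  "dominance M u0 \<sigma> U =
     {w \<in> space M. \<exists>i. (\<lambda>n. urn_prop u0 \<sigma> U n w) \<longlonglongrightarrow> axis i 1}"

end

theory Submission imports Defs begin

text \<open>
  Write \<open>\<gamma>\<^sub>n\<close> for the step \<open>\<sigma>\<^sub>n\<^sub>+\<^sub>1 / \<tau>\<^sub>n\<^sub>+\<^sub>1\<close> and \<open>p(x)\<^sub>j = f(x\<^sub>j) / (\<Sum>\<^sub>k f(x\<^sub>k))\<close>. Then
  \<open>\<theta>\<^sub>n\<^sub>+\<^sub>1 - \<theta>\<^sub>n = \<gamma>\<^sub>n (p(\<theta>\<^sub>n) - \<theta>\<^sub>n)\<close> plus a martingale increment whose variance is at most
  \<open>1 / \<tau>\<^sub>n - 1 / \<tau>\<^sub>n\<^sub>+\<^sub>1\<close>. Condition (C) makes \<open>f(x) / x\<close> strictly increasing; hence both the sum of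
  squares and the maximum of \<open>\<theta>\<^sub>n\<close> are, up to convergent martingales, nondecreasing. They converge,
  and since \<open>\<Sum>\<gamma>\<^sub>n = \<infinity>\<close> the drift of the first one gets arbitrarily small, which happens only
  near points whose nonzero coordinates all agree. So both have the same limit \<open>m\<close>, and comparing
  them shows that every coordinate tends to \<open>0\<close> or to \<open>m\<close>.

  It remains to exclude two coordinates \<open>i\<close>, \<open>j\<close> that both tend to \<open>m > 0\<close>. Let \<open>W\<^sub>n\<close> be their
  difference, whose drift eventually points away from \<open>0\<close>. As \<open>\<tau>\<^sub>n W\<^sub>n\<^sup>2\<close> grows in mean by at least
  a multiple of \<open>\<gamma>\<^sub>n\<close>, it exceeds \<open>8\<close> at some time after any given one; from then on, by the maximal
  inequality, \<open>W\<close> stays away from \<open>0\<close> with probability at least \<open>1/2\<close>. A zero-one argument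
  concludes.
\<close>

section \<open>Real sequences\<close>

text \<open>Almost surely only finitely many compositions are possible at each time, so conditioning
  on the past reduces to conditioning on finitely many atoms; under each conditional law the draws
  of one step are i.i.d., and all moments are computed there. The variance bound telescopes: the
  noise after time m has total variance at most 1/\<tau>(m). So one maximal inequality serves both
  for the convergence of the martingales and for the escape from a tie, and a gap becomes decisive
  on the scale \<tau>(m)^(-1/2); the number 8 is the price of a failure probability of 1/2 there.
  The obstacle is that the drift is known to point outward only near a tie, hence only from a random
  time on. Outward drift is therefore made part of the event to be excluded, with a fixed constant
  and a fixed starting time, and countably many such events cover all ties. While waiting for the
  gap to reach the critical scale, the overshoot has to be controlled as well: the normalised
  squared jumps have means of order \<gamma>, which are not summable, but second moments of order
  \<gamma>^2, which are.\<close>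

lemma LIMSEQ_iff_Suc:
  fixes X :: "nat \<Rightarrow> 'a::metric_space"
  shows "X \<longlonglongrightarrow> L \<longleftrightarrow> (\<forall>k. \<exists>N. \<forall>n\<ge>N. dist (X n) L < inverse (real (Suc k)))"
  unfolding lim_sequentially
proof safe
  fix k assume "\<forall>r>0. \<exists>no. \<forall>n\<ge>no. dist (X n) L < r"
  then show "\<exists>N. \<forall>n\<ge>N. dist (X n) L < inverse (real (Suc k))"
    by (auto dest: spec[of _ "inverse (real (Suc k))"])
next
  fix r :: real assume *: "\<forall>k. \<exists>N. \<forall>n\<ge>N. dist (X n) L < inverse (real (Suc k))" and "0 < r"
  then obtain k where "inverse (real (Suc k)) < r"
    using reals_Archimedean by blast
  with * show "\<exists>no. \<forall>n\<ge>no. dist (X n) L < r" by (meson less_trans)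
qed

text \<open>The product forces each late term to be close to \<open>0\<close> or to
  \<open>m\<close>, and vanishing increments rule out switching between the two
  neighbourhoods.\<close>

lemma slow_sequence_limit_zero_or_m:
  fixes x :: "nat \<Rightarrow> real"
  assumes m: "m > 0" and prod: "(\<lambda>n. x n * (m - x n)) \<longlonglongrightarrow> 0"
    and step: "(\<lambda>n. x (Suc n) - x n) \<longlonglongrightarrow> 0"
  shows "x \<longlonglongrightarrow> 0 \<or> x \<longlonglongrightarrow> m"
proof -
  \<comment> \<open>The factors sum to \<open>m\<close>, so one of them has absolute value at least
    \<open>m / 2\<close>; if both were also at least \<open>e\<close>, the product would be too
    large.\<close>
  have near: "\<bar>y\<bar> < e \<or> \<bar>y - m\<bar> < e" if "\<bar>y * (m - y)\<bar> < e * m / 2" "0 < e" "e \<le> m / 4" for y e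
  proof (rule ccontr)
    assume "\<not> ?thesis"
    then have a: "e \<le> \<bar>y\<bar>" "e \<le> \<bar>m - y\<bar>" by auto
    have "m / 2 \<le> \<bar>y\<bar> \<or> m / 2 \<le> \<bar>m - y\<bar>" by linarith
    then have "e * (m / 2) \<le> \<bar>y\<bar> * \<bar>m - y\<bar>"
    proof
      assume "m / 2 \<le> \<bar>y\<bar>"
      then have "(m / 2) * e \<le> \<bar>y\<bar> * \<bar>m - y\<bar>" using a that m by (intro mult_mono) auto
      then show ?thesis by (simp add: mult.commute)
    next
      assume "m / 2 \<le> \<bar>m - y\<bar>"
      then show ?thesis using a that m by (intro mult_mono) auto
    qed
    with that show False by (simp add: abs_mult)
  qed
  have ev: "\<forall>\<^sub>F n in sequentially. (\<bar>x n\<bar> < e \<or> \<bar>x n - m\<bar> < e) \<and> \<bar>x (Suc n) - x n\<bar> < e"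
    if "0 < e" "e \<le> m / 4" for e
  proof -
    have "e * m / 2 > 0" using that m by simp
    then have "\<forall>\<^sub>F n in sequentially. \<bar>x n * (m - x n)\<bar> < e * m / 2"
      using tendstoD[OF prod, of "e * m / 2"] by (simp add: dist_real_def)
    moreover have "\<forall>\<^sub>F n in sequentially. \<bar>x (Suc n) - x n\<bar> < e"
      using tendstoD[OF step, of e] that by (simp add: dist_real_def)
    ultimately show ?thesis by eventually_elim (use near that in blast)
  qed
  \<comment> \<open>The intervals of radius \<open>m / 4\<close> around \<open>0\<close> and
    \<open>m\<close> are \<open>m / 2\<close> apart, and a step shorter than \<open>m / 4\<close>
    cannot cross that distance.\<close>
  obtain N where N: "\<And>n. n \<ge> N \<Longrightarrow> (\<bar>x n\<bar> < m/4 \<or> \<bar>x n - m\<bar> < m/4) \<and> \<bar>x (Suc n) - x n\<bar> < m/4"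
    using ev[of "m/4"] m by (auto simp: eventually_sequentially)
  show ?thesis
  proof (cases "\<bar>x N\<bar> < m / 4")
    case True
    have stay: "\<bar>x n\<bar> < m / 4" if "n \<ge> N" for n
      using that
    proof (induction n rule: dec_induct)
      case (step n)
      then show ?case using N[of n] N[of "Suc n"] m by linarith
    qed (rule True)
    have "x \<longlonglongrightarrow> 0"
    proof (rule tendstoI)
      fix e :: real assume "e > 0"
      then have "\<forall>\<^sub>F n in sequentially. \<bar>x n\<bar> < min e (m/4) \<or> \<bar>x n - m\<bar> < min e (m/4)"
        using eventually_mono[OF ev[of "min e (m/4)"]] m by auto
      with eventually_ge_at_top[of N] show "\<forall>\<^sub>F n in sequentially. dist (x n) 0 < e"
        by eventually_elim (use stay m in \<open>fastforce simp: dist_real_def\<close>)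
    qed
    then show ?thesis by simp
  next
    case False
    have stay: "\<bar>x n - m\<bar> < m / 4" if "n \<ge> N" for n
      using that
    proof (induction n rule: dec_induct)
      case (step n)
      then show ?case using N[of n] N[of "Suc n"] m by linarith
    qed (use False N[of N] in auto)
    have "x \<longlonglongrightarrow> m"
    proof (rule tendstoI)
      fix e :: real assume "e > 0"
      then have "\<forall>\<^sub>F n in sequentially. \<bar>x n\<bar> < min e (m/4) \<or> \<bar>x n - m\<bar> < min e (m/4)"
        using eventually_mono[OF ev[of "min e (m/4)"]] m by auto
      with eventually_ge_at_top[of N] show "\<forall>\<^sub>F n in sequentially. dist (x n) m < e"
        by eventually_elim (use stay m in \<open>fastforce simp: dist_real_def\<close>)
    qed
    then show ?thesis by simp
  qed
qed

text \<open>Subtracting the convergent series of perturbations leaves a nondecreasing bounded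
  sequence, whose total increase also dominates the sum of \<open>h\<close>. Applied path by path
  this is the submartingale argument: \<mu> will be a martingale increment and \<open>h\<close> the
  drift.\<close>

lemma bounded_perturbed_increase:
  fixes \<Phi> h \<mu> :: "nat \<Rightarrow> real"
  assumes bnd: "\<And>n. \<Phi> n \<le> B"
    and inc: "\<And>n. \<Phi> (Suc n) \<ge> \<Phi> n + h n + \<mu> n" and h: "\<And>n. h n \<ge> 0" and \<mu>: "summable \<mu>"
  shows "convergent \<Phi>" "summable h"
proof -
  define Y where "Y n = \<Phi> n - (\<Sum>k<n. \<mu> k)" for n
  have Yinc: "Y (Suc n) \<ge> Y n + h n" for n using inc[of n] by (simp add: Y_def)
  obtain C where C: "\<And>n. \<bar>\<Sum>k<n. \<mu> k\<bar> \<le> C"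
    using summable_imp_sums_bounded[OF \<mu>] by (auto simp: Bseq_def bounded_iff)
  have Y_le: "Y n \<le> B + C" for n using bnd[of n] C[of n] by (auto simp: Y_def abs_le_iff)
  have "Y n \<le> Y (Suc n)" for n using Yinc[of n] h[of n] by linarith
  then have "incseq Y" by (rule incseq_SucI)
  then have "convergent Y"
    using Y_le by (auto elim!: incseq_convergent[of Y "B + C"] simp: convergent_def)
  then have "convergent (\<lambda>n. Y n + (\<Sum>k<n. \<mu> k))"
    using \<mu> by (intro convergent_add) (auto simp: summable_iff_convergent)
  then show "convergent \<Phi>" by (simp add: Y_def)
  have "(\<Sum>k<n. h k) \<le> Y n - Y 0" for n
  proof (induction n)
    case (Suc n)
    then show ?case using Yinc[of n] by simp
  qed simp
  then have "(\<Sum>k<n. h k) \<le> B + C - Y 0" for n using Y_le[of n] by (smt (verit))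
  then have "(\<Sum>k\<le>n. h k) \<le> B + C - Y 0" for n by (metis lessThan_Suc_atMost)
  with h show "summable h" by (rule bounded_imp_summable)
qed

text \<open>As long as \<open>g\<close> keeps its initial sign \<open>s\<close>, the drift only
  helps, so \<open>s * g\<close> is at least its initial size plus the signed accumulated noise. A
  start of \<open>2 * a\<close> minus noise below \<open>a\<close> leaves more than
  \<open>a\<close>, so the sign is never lost and the induction continues.\<close>

lemma outward_drift_persists:
  fixes g d \<nu> :: "nat \<Rightarrow> real"
  assumes step: "\<And>l. l \<ge> m \<Longrightarrow> g (Suc l) = g l + d l + \<nu> l"
    and out: "\<And>l. l \<ge> m \<Longrightarrow> d l * g l \<ge> 0"
    and small: "\<And>l. l \<ge> m \<Longrightarrow> \<bar>\<Sum>r\<in>{m..<l}. \<nu> r\<bar> < a" and start: "\<bar>g m\<bar> \<ge> 2 * a" and "l \<ge> m"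
  shows "\<bar>g l\<bar> \<ge> a"
proof -
  define s where "s = sgn (g m)"
  \<comment> \<open>The empty sum at \<open>l = m\<close> is already below \<open>a\<close>.\<close>
  have a: "a > 0" using small[of m] by simp
  have s: "s = 1 \<or> s = -1" using start a by (auto simp: s_def sgn_if)
  have main: "s * g l \<ge> \<bar>g m\<bar> + s * (\<Sum>r\<in>{m..<l}. \<nu> r)" using \<open>l \<ge> m\<close>
  proof (induction l rule: dec_induct)
    case base
    then show ?case by (simp add: s_def abs_sgn mult.commute)
  next
    case (step l)
    have "s * g l > 0" using step.IH small[of l] start s step(1) a by (auto simp: abs_if split: if_splits)
    then have "s * d l \<ge> 0" using out[of l] s step(1) by (auto simp: zero_le_mult_iff)
    then show ?case using step.IH assms(1)[of l] step(1) by (simp add: algebra_simps)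
  qed
  have "\<bar>s * (\<Sum>r\<in>{m..<l}. \<nu> r)\<bar> < a" using small[OF \<open>l \<ge> m\<close>] s by auto
  then show ?thesis using main start s by (auto simp: abs_if split: if_splits)
qed

text \<open>While \<xi> is 1 the sum telescopes, and it stops at the first index that is not live;
  its value is then \<open>q\<close> just after the last live index minus \<open>q m\<close>. That
  last jump may leave the controlled range, hence the term \<open>x\<close>. All the overshoots are
  summed on the right, instead of naming the last one, so that expectations can be taken term by
  term without a random index.\<close>

lemma stopped_telescope_bound:
  fixes q x :: "nat \<Rightarrow> real" and live :: "nat \<Rightarrow> bool" and A :: bool and m :: nat
  defines "\<xi> \<equiv> \<lambda>r. if A \<and> (\<forall>k. m \<le> k \<and> k \<le> r \<longrightarrow> live k) then 1 else 0 :: real"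
  assumes q: "\<And>r. q r \<ge> 0" and x: "\<And>r. x r \<ge> 0" and K: "K \<ge> 0"
    and exit_le: "\<And>r. r \<ge> m \<Longrightarrow> live r \<Longrightarrow> q (Suc r) \<le> K + x r" and "m \<le> N"
  shows "(\<Sum>r\<in>{m..<N}. \<xi> r * (q (Suc r) - q r)) \<le> K + (\<Sum>r\<in>{m..<N}. \<xi> r * x r)"
  using \<open>m \<le> N\<close>
proof (induction N rule: dec_induct)
  case (step N)
  have \<xi>_nn: "\<xi> r \<ge> 0" for r by (simp add: \<xi>_def)
  show ?case
  proof (cases "\<xi> N = 0")
    case True
    then show ?thesis using step by simp
  next
    case False
    then have AN: "A \<and> (\<forall>k. m \<le> k \<and> k \<le> N \<longrightarrow> live k)" by (auto simp: \<xi>_def split: if_splits)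
    then have \<xi>1: "\<xi> r = 1" if "r \<le> N" for r using that by (auto simp: \<xi>_def)
    have "(\<Sum>r\<in>{m..<Suc N}. \<xi> r * (q (Suc r) - q r)) = (\<Sum>r\<in>{m..<Suc N}. q (Suc r) - q r)"
      by (rule sum.cong) (use \<xi>1 in auto)
    also have "\<dots> = q (Suc N) - q m" using step(1) by (subst sum_Suc_diff') auto
    also have "\<dots> \<le> K + x N" using exit_le[of N] AN step(1) q[of m] by force
    also have "\<dots> \<le> K + (\<Sum>r\<in>{m..<Suc N}. \<xi> r * x r)"
      using step(1) \<xi>1[of N] \<xi>_nn x by (simp add: sum_nonneg)
    finally show ?thesis .
  qed
qed (use K in simp)

section \<open>Reinforcement functions\<close>

lemma reinforcement_deriv_pos:
  assumes "f \<in> reinforcement_class"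
  obtains \<alpha> where "\<alpha> > 1" "\<And>x. x \<in> {0<..<1} \<Longrightarrow> \<alpha> * f x \<le> x * deriv f x"
proof -
  have sm: "strict_mono_on {0..1} f" and f0: "f 0 = 0" and diff: "f differentiable_on {0<..<1}"
    and \<alpha>: "(INF x\<in>{0<..<1}. x * deriv f x / f x) > 1"
    using assms by (auto simp: reinforcement_class_def)
  have fpos: "f x > 0" if "x \<in> {0<..<1}" for x
    using strict_mono_onD[OF sm, of 0 x] that f0 by auto
  \<comment> \<open>A real \<open>INF\<close> is a lower bound only for a set that is bounded below;
    monotonicity of \<open>f\<close> makes \<open>deriv f\<close> nonnegative, so \<open>0\<close>
    bounds the quotients.\<close>
  have d: "deriv f x \<ge> 0" if "x \<in> {0<..<1}" for x
  proof (rule mono_on_imp_deriv_nonneg)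
    show "mono_on {0<..<1} f"
      using strict_mono_on_leD[OF sm] by (intro mono_onI) auto
    show "(f has_real_derivative deriv f x) (at x)"
      using diff that by (metis DERIV_deriv_iff_real_differentiable at_within_open differentiable_on_def open_greaterThanLessThan)
    show "x \<in> interior {0<..<1}" using that by simp
  qed
  have "(INF x\<in>{0<..<1}. x * deriv f x / f x) \<le> x * deriv f x / f x" if "x \<in> {0<..<1}" for x
  proof (rule cINF_lower[OF _ that])
    show "bdd_below ((\<lambda>x. x * deriv f x / f x) ` {0<..<1})"
      using d fpos by (intro bdd_belowI[of _ 0]) (force intro!: divide_nonneg_nonneg simp: less_imp_le)
  qed
  then have "(INF x\<in>{0<..<1}. x * deriv f x / f x) * f x \<le> x * deriv f x" if "x \<in> {0<..<1}" for x
    using fpos[OF that] that by (metis pos_le_divide_eq)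
  with \<alpha> show thesis by (rule that)
qed

lemma reinforcement_has_deriv:
  assumes "f \<in> reinforcement_class" "x \<in> {0<..<1}"
  shows "(f has_real_derivative deriv f x) (at x)"
proof -
  have "f differentiable_on {0<..<1}" using assms by (simp add: reinforcement_class_def)
  then show ?thesis using assms(2)
    by (metis DERIV_deriv_iff_real_differentiable at_within_open differentiable_on_def open_greaterThanLessThan)
qed

lemma reinforcement_pos:
  assumes "f \<in> reinforcement_class" "0 < x" "x \<le> 1"
  shows "f x > 0"
  using assms strict_mono_onD[of "{0..1}" f 0 x] by (auto simp: reinforcement_class_def)

lemma reinforcement_nonneg:
  assumes "f \<in> reinforcement_class" "0 \<le> x" "x \<le> 1"
  shows "f x \<ge> 0"
  using assms by (auto simp: reinforcement_class_def)

text \<open>The derivative of f(x)/x is (x f'(x) - f(x)) / x^2, which is positive because x f'(x)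
  \<ge> \<alpha> f(x) > f(x). The cross-multiplied form is the one that is later summed over
  colours.\<close>

lemma reinforcement_ratio_strict:
  assumes f: "f \<in> reinforcement_class" and "0 < y" "y < x" "x \<le> 1"
  shows "f y * x < f x * y"
proof -
  obtain \<alpha> where \<alpha>: "\<alpha> > 1" "\<And>x. x \<in> {0<..<1} \<Longrightarrow> \<alpha> * f x \<le> x * deriv f x"
    using reinforcement_deriv_pos[OF f] by blast
  have "f y / y < f x / x"
  proof (rule DERIV_pos_imp_increasing_open[OF \<open>y < x\<close>])
    fix t assume t: "y < t" "t < x"
    then have t01: "t \<in> {0<..<1}" using assms by auto
    have "f t < \<alpha> * f t" using \<alpha>(1) reinforcement_pos[OF f, of t] t01 by auto
    then have "f t < t * deriv f t" using \<alpha>(2)[OF t01] by simp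
    then have "(deriv f t * t - f t * 1) / (t * t) > 0" using t01 by (simp add: mult.commute)
    moreover have "((\<lambda>x. f x / x) has_real_derivative (deriv f t * t - f t * 1) / (t * t)) (at t)"
      using t01 by (intro DERIV_divide reinforcement_has_deriv[OF f]) auto
    ultimately show "\<exists>z. ((\<lambda>x. f x / x) has_real_derivative z) (at t) \<and> z > 0" by blast
  next
    have "continuous_on {y..x} f"
      using f assms by (auto simp: reinforcement_class_def elim: continuous_on_subset)
    then show "continuous_on {y..x} (\<lambda>x. f x / x)"
      using assms by (intro continuous_on_divide) auto
  qed
  then show ?thesis using assms by (simp add: divide_simps)
qed

text \<open>Both factors carry the sign of \<open>x - y\<close>, the second because f(x)/x
  increases. These are the summands of \<open>covar_eq\<close>, and the equality case identifies the
  points without drift.\<close>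

lemma reinforcement_pair_nonneg:
  assumes f: "f \<in> reinforcement_class" and "0 \<le> x" "x \<le> 1" "0 \<le> y" "y \<le> 1"
  shows "(x - y) * (f x * y - f y * x) \<ge> 0"
    and "(x - y) * (f x * y - f y * x) = 0 \<Longrightarrow> x = 0 \<or> y = 0 \<or> x = y"
proof -
  have f0: "f 0 = 0" using f by (auto simp: reinforcement_class_def)
  consider "x = 0 \<or> y = 0 \<or> x = y" | "0 < x" "x < y" | "0 < y" "y < x" using assms by fastforce
  then have "(x - y) * (f x * y - f y * x) \<ge> 0 \<and>
    ((x - y) * (f x * y - f y * x) = 0 \<longrightarrow> x = 0 \<or> y = 0 \<or> x = y)"
  proof cases
    case 1 then show ?thesis using f0 by auto
  next
    case 2
    then have "f x * y < f y * x" using reinforcement_ratio_strict[OF f, of x y] assms by simp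
    with 2 have "(x - y) * (f x * y - f y * x) > 0" by (intro mult_neg_neg) auto
    then show ?thesis by linarith
  next
    case 3
    then have "f y * x < f x * y" using reinforcement_ratio_strict[OF f, of y x] assms by simp
    with 3 have "(x - y) * (f x * y - f y * x) > 0" by (intro mult_pos_pos) auto
    then show ?thesis by linarith
  qed
  then show "(x - y) * (f x * y - f y * x) \<ge> 0"
    and "(x - y) * (f x * y - f y * x) = 0 \<Longrightarrow> x = 0 \<or> y = 0 \<or> x = y" by auto
qed

text \<open>Condition (C) at \<open>m\<close> gives f'(m) > f(m)/m, and continuity of f' spreads
  this over a neighbourhood. The value f(m)/m is the total weight at a tie of height
  \<open>m\<close> (see \<open>repelling_near_tie\<close>), so a slope \<beta> above it makes gaps
  expand; \<open>C\<close> bounds how fast.\<close>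

lemma reinforcement_local_slopes:
  assumes f: "f \<in> reinforcement_class" and m: "0 < m" "m < 1"
  obtains \<epsilon> \<beta> C where "\<epsilon> > 0" "\<beta> > f m / m" "C > 0"
    "\<And>x y. \<bar>x - m\<bar> < \<epsilon> \<Longrightarrow> \<bar>y - m\<bar> < \<epsilon> \<Longrightarrow> y \<le> x \<Longrightarrow> \<beta> * (x - y) \<le> f x - f y \<and> f x - f y \<le> C * (x - y)"
proof -
  obtain \<alpha> where \<alpha>: "\<alpha> > 1" "\<And>x. x \<in> {0<..<1} \<Longrightarrow> \<alpha> * f x \<le> x * deriv f x"
    using reinforcement_deriv_pos[OF f] by blast
  have fm: "f m > 0" using reinforcement_pos[OF f] m by simp
  then have "f m < \<alpha> * f m" using \<alpha>(1) by simp
  then have "f m < m * deriv f m" using \<alpha>(2)[of m] m by simp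
  then have dm: "f m / m < deriv f m" using m by (simp add: pos_divide_less_eq mult.commute)
  define \<beta> where "\<beta> = (f m / m + deriv f m) / 2"
  have "isCont (deriv f) m"
    using f m by (auto simp: reinforcement_class_def continuous_on_eq_continuous_at)
  moreover have "\<beta> < deriv f m" "deriv f m < deriv f m + 1" using dm by (auto simp: \<beta>_def field_simps)
  ultimately have "\<forall>\<^sub>F x in at m. \<beta> < deriv f x" "\<forall>\<^sub>F x in at m. deriv f x < deriv f m + 1"
    unfolding isCont_def by (blast dest: order_tendstoD)+
  moreover have "\<forall>\<^sub>F x in at m. x \<in> {0<..<1}"
    using m by (intro eventually_at_in_open') auto
  ultimately have "\<forall>\<^sub>F x in at m. \<beta> < deriv f x \<and> deriv f x < deriv f m + 1 \<and> x \<in> {0<..<1}"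
    by eventually_elim auto
  then obtain \<epsilon> where \<epsilon>: "\<epsilon> > 0" "\<And>x. x \<noteq> m \<Longrightarrow> \<bar>x - m\<bar> < \<epsilon> \<Longrightarrow> \<beta> < deriv f x \<and> deriv f x < deriv f m + 1 \<and> x \<in> {0<..<1}"
    by (auto simp: eventually_at dist_real_def)
  have near: "\<beta> < deriv f x \<and> deriv f x < deriv f m + 1 \<and> x \<in> {0<..<1}" if "\<bar>x - m\<bar> < \<epsilon>" for x
    using \<epsilon>(2)[of x] that m \<open>\<beta> < deriv f m\<close> by (cases "x = m") auto
  show thesis
  proof (rule that[of \<epsilon> \<beta> "deriv f m + 1"])
    show "\<beta> > f m / m" using dm unfolding \<beta>_def by (rule field_less_half_sum)
    have "f m / m > 0" using fm m by simp
    then show "deriv f m + 1 > 0" using dm by linarith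
    fix x y :: real assume xy: "\<bar>x - m\<bar> < \<epsilon>" "\<bar>y - m\<bar> < \<epsilon>" "y \<le> x"
    show "\<beta> * (x - y) \<le> f x - f y \<and> f x - f y \<le> (deriv f m + 1) * (x - y)"
    proof (cases "x = y")
      case False
      with xy have "y < x" by simp
      have "\<exists>z>y. z < x \<and> f x - f y = (x - y) * deriv f z"
      proof (rule MVT2[OF \<open>y < x\<close>])
        fix z assume "y \<le> z" "z \<le> x"
        then have "\<bar>z - m\<bar> < \<epsilon>" using xy by auto
        then show "(f has_real_derivative deriv f z) (at z)"
          using near reinforcement_has_deriv[OF f] by blast
      qed
      then obtain z where z: "y < z" "z < x" "f x - f y = (x - y) * deriv f z" by blast
      have "\<bar>z - m\<bar> < \<epsilon>" using xy z by auto
      from near[OF this] z show ?thesis using \<open>y < x\<close> by (auto simp: mult.commute)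
    qed auto
  qed (use \<epsilon> in auto)
qed

section \<open>General probability\<close>

text \<open>Induction over the index set. The almost sure bound belongs to the claim because it
  makes all mixed powers integrable; independence factorises them, and the terms with a first power
  vanish.\<close>

lemma (in prob_space) indep_centered_sum_moments:
  fixes Z :: "'i \<Rightarrow> 'a \<Rightarrow> real"
  assumes "finite I" "indep_vars (\<lambda>_. borel) Z I"
    and "\<And>i. i \<in> I \<Longrightarrow> expectation (Z i) = 0" "\<And>i. i \<in> I \<Longrightarrow> AE w in M. \<bar>Z i w\<bar> \<le> 2"
    and "\<And>i. i \<in> I \<Longrightarrow> expectation (\<lambda>w. (Z i w)^2) = v"
  shows "(AE w in M. \<bar>\<Sum>i\<in>I. Z i w\<bar> \<le> 2 * real (card I)) \<and>
    expectation (\<lambda>w. \<Sum>i\<in>I. Z i w) = 0 \<and>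
    expectation (\<lambda>w. (\<Sum>i\<in>I. Z i w)^2) = real (card I) * v \<and>
    expectation (\<lambda>w. (\<Sum>i\<in>I. Z i w)^4) \<le> 48 * (real (card I))^2"
  using assms
proof (induction I rule: finite_induct)
  case (insert i I)
  let ?S = "\<lambda>w. \<Sum>i\<in>I. Z i w"
  have iv: "indep_vars (\<lambda>_. borel) Z I" using insert.prems(1) by (rule indep_vars_subset) auto
  have rv[measurable]: "random_variable borel (Z j)" if "j \<in> insert i I" for j
    using insert.prems(1) that by (auto simp: indep_vars_def)
  have [measurable]: "random_variable borel (Z i)" "random_variable borel ?S"
    by (auto intro!: borel_measurable_sum rv)
  note IH = insert.IH[OF iv insert.prems(2) insert.prems(3) insert.prems(4)]
  have bS: "AE w in M. \<bar>?S w\<bar> \<le> 2 * real (card I)" and ES: "expectation ?S = 0"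
    and ES2: "expectation (\<lambda>w. (?S w)^2) = real (card I) * v"
    and ES4: "expectation (\<lambda>w. (?S w)^4) \<le> 48 * (real (card I))^2"
    using IH by auto
  have bZ: "AE w in M. \<bar>Z i w\<bar> \<le> 2" using insert.prems by simp
  have ind: "indep_var borel (Z i) borel ?S"
    by (rule indep_vars_sum) (use insert in auto)
  have int: "integrable M (\<lambda>w. (Z i w)^a * (?S w)^b)" for a b
  proof (rule integrable_const_bound[where B="2^a * (2 * real (card I))^b"])
    show "AE w in M. norm ((Z i w)^a * (?S w)^b) \<le> 2^a * (2 * real (card I))^b"
      using bZ bS
    proof eventually_elim
      case (elim w)
      have "\<bar>Z i w\<bar> ^ a * \<bar>?S w\<bar> ^ b \<le> 2 ^ a * (2 * real (card I)) ^ b"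
        using elim by (intro mult_mono power_mono) auto
      then show ?case by (simp only: real_norm_def abs_mult power_abs)
    qed
  qed simp
  have intZ: "integrable M (\<lambda>w. (Z i w)^a)" and intS: "integrable M (\<lambda>w. (?S w)^a)" for a
    using int[of a 0] int[of 0 a] by auto
  have prod: "expectation (\<lambda>w. (Z i w)^a * (?S w)^b) = expectation (\<lambda>w. (Z i w)^a) * expectation (\<lambda>w. (?S w)^b)" for a b
  proof (rule indep_var_lebesgue_integral)
    have "indep_var borel ((\<lambda>x. x^a) \<circ> Z i) borel ((\<lambda>x. x^b) \<circ> ?S)"
      by (rule indep_var_compose[OF ind]) auto
    then show "indep_var borel (\<lambda>w. (Z i w)^a) borel (\<lambda>w. (?S w)^b)" by (simp add: comp_def)
  qed (rule intZ intS)+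
  have EZ: "expectation (Z i) = 0" and EZ2: "expectation (\<lambda>w. (Z i w)^2) = v" using insert.prems by auto
  have EZ2': "expectation (\<lambda>w. (Z i w)^2) \<le> 4"
  proof -
    have "expectation (\<lambda>w. (Z i w)^2) \<le> expectation (\<lambda>w. 4)"
      using bZ by (intro integral_mono_AE intZ) (auto elim!: eventually_mono dest: power_mono[where n=2] simp: power_abs)
    then show ?thesis by (simp add: prob_space)
  qed
  have EZ4: "expectation (\<lambda>w. (Z i w)^4) \<le> 16"
  proof -
    have "(Z i w)^4 \<le> 16" if "\<bar>Z i w\<bar> \<le> 2" for w
      using power_mono[OF that, of 4] by (simp add: power_abs)
    with bZ have "expectation (\<lambda>w. (Z i w)^4) \<le> expectation (\<lambda>w. 16)"
      by (intro integral_mono_AE intZ) (auto elim!: eventually_mono)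
    then show ?thesis by (simp add: prob_space)
  qed
  have v0: "v \<ge> 0" unfolding EZ2[symmetric] by simp
  have b: "AE w in M. \<bar>\<Sum>i\<in>insert i I. Z i w\<bar> \<le> 2 * real (card (insert i I))"
    using bZ bS by eventually_elim (use insert in \<open>auto simp: algebra_simps\<close>)
  have e1: "expectation (\<lambda>w. \<Sum>i\<in>insert i I. Z i w) = 0"
    using insert.hyps EZ ES intZ[of 1] intS[of 1] by simp
  have "expectation (\<lambda>w. (\<Sum>i\<in>insert i I. Z i w)^2)
     = expectation (\<lambda>w. (?S w)^2 + 2 * ((Z i w)^1 * (?S w)^1) + (Z i w)^2)"
    using insert.hyps by (simp add: power2_eq_square algebra_simps)
  also have "\<dots> = expectation (\<lambda>w. (?S w)^2) + 2 * expectation (\<lambda>w. (Z i w)^1 * (?S w)^1) + expectation (\<lambda>w. (Z i w)^2)"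
    using int[of 1 1] intZ[of 2] intS[of 2] by (simp del: power_one_right)
  also have "\<dots> = real (card (insert i I)) * v"
    unfolding prod using EZ ES2 EZ2 insert.hyps by (simp add: algebra_simps)
  finally have e2: "expectation (\<lambda>w. (\<Sum>i\<in>insert i I. Z i w)^2) = real (card (insert i I)) * v" .
  have "expectation (\<lambda>w. (\<Sum>i\<in>insert i I. Z i w)^4)
     = expectation (\<lambda>w. (?S w)^4 + 4 * ((Z i w)^1 * (?S w)^3) + 6 * ((Z i w)^2 * (?S w)^2)
         + 4 * ((Z i w)^3 * (?S w)^1) + (Z i w)^4)"
    using insert.hyps by (simp add: power2_eq_square power3_eq_cube power4_eq_xxxx algebra_simps)
  also have "\<dots> = expectation (\<lambda>w. (?S w)^4) + 4 * expectation (\<lambda>w. (Z i w)^1 * (?S w)^3)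
         + 6 * expectation (\<lambda>w. (Z i w)^2 * (?S w)^2)
         + 4 * expectation (\<lambda>w. (Z i w)^3 * (?S w)^1) + expectation (\<lambda>w. (Z i w)^4)"
    using int[of 1 3] int[of 2 2] int[of 3 1] intZ[of 4] intS[of 4] by (simp del: power_one_right)
  also have "\<dots> = expectation (\<lambda>w. (?S w)^4) + 6 * (v * (real (card I) * v)) + expectation (\<lambda>w. (Z i w)^4)"
    unfolding prod using EZ ES ES2 EZ2 by simp
  \<comment> \<open>As \<open>v\<close> is at most 4, the mixed term is at most 96 k with k =
    \<open>card I\<close>. The constant 48 is such that 48 (k + 1)^2 - 48 k^2 = 96 k + 48 absorbs
    this and the remaining 16.\<close>
  also have "\<dots> \<le> 48 * (real (card I))^2 + 6 * (4 * (real (card I) * 4)) + 16"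
    using ES4 EZ4 EZ2 EZ2' v0 by (intro add_mono mult_left_mono mult_mono) auto
  also have "\<dots> \<le> 48 * (real (card (insert i I)))^2"
    using insert.hyps by (simp add: power2_eq_square algebra_simps)
  finally have "expectation (\<lambda>w. (\<Sum>i\<in>insert i I. Z i w)^4) \<le> 48 * (real (card (insert i I)))^2" .
  with b e1 e2 show ?case by blast
qed simp

text \<open>The sets that members of the increasing algebras approximate in measure form a
  \<sigma>-algebra: a countable union is cut to a finite one, and the finitely many approximations
  are taken in a common algebra.\<close>

lemma (in finite_measure) sigma_sets_approx:
  fixes F :: "nat \<Rightarrow> 'a set set"
  assumes sub: "\<And>n. F n \<subseteq> sets M" and mono: "\<And>m n. m \<le> n \<Longrightarrow> F m \<subseteq> F n"
    and alg: "\<And>n. algebra (space M) (F n)" and B: "B \<in> sigma_sets (space M) (\<Union>n. F n)"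
  shows "e > 0 \<Longrightarrow> \<exists>n. \<exists>A\<in>F n. measure M ((A - B) \<union> (B - A)) < e"
  using B
proof (induction arbitrary: e)
  case (Basic a)
  then obtain n where "a \<in> F n" by blast
  then show ?case using Basic by (intro exI[of _ n] bexI[of _ a]) auto
next
  case Empty
  interpret algebra "space M" "F 0" by (rule alg)
  show ?case using Empty by (intro exI[of _ 0] bexI[of _ "{}"]) auto
next
  case (Compl a)
  then obtain n A where A: "A \<in> F n" "measure M ((A - a) \<union> (a - A)) < e" by blast
  interpret algebra "space M" "F n" by (rule alg)
  have "sigma_sets (space M) (\<Union>n. F n) \<subseteq> sets M"
    using sub by (intro sets.sigma_sets_subset) auto
  then have "a \<subseteq> space M" using Compl(1) sets.sets_into_space by blast
  then have "((space M - A) - (space M - a)) \<union> ((space M - a) - (space M - A)) = (A - a) \<union> (a - A)"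
    using sets_into_space[OF A(1)] by blast
  then show ?case using A by (intro exI[of _ n] bexI[of _ "space M - A"]) auto
next
  case (Union a)
  have "sigma_sets (space M) (\<Union>n. F n) \<subseteq> sets M"
    using sub by (intro sets.sigma_sets_subset) auto
  then have a[measurable]: "a i \<in> sets M" for i using Union(1) by blast
  define u where "u k = (\<Union>i<k. a i)" for k
  have u_ev[measurable]: "u k \<in> sets M" for k unfolding u_def by auto
  have "incseq u" by (force simp: incseq_def u_def)
  then have "(\<lambda>k. measure M (u k)) \<longlonglongrightarrow> measure M (\<Union>k. u k)"
    using u_ev by (intro finite_Lim_measure_incseq) auto
  moreover have uU: "(\<Union>k. u k) = (\<Union>i. a i)" by (auto simp: u_def)
  ultimately have "(\<lambda>k. measure M (u k)) \<longlonglongrightarrow> measure M (\<Union>i. a i)" by simp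
  then have "\<forall>\<^sub>F k in sequentially. measure M (u k) > measure M (\<Union>i. a i) - e / 2"
    using Union.prems by (intro order_tendstoD) auto
  then obtain k where k: "measure M (u k) > measure M (\<Union>i. a i) - e / 2"
    by (auto simp: eventually_sequentially)
  \<comment> \<open>Half of \<open>e\<close> is spent on cutting the union, and \<open>k\<close>
    errors of size \<delta> cost less than the other half. \<open>Suc k\<close> keeps the
    denominator nonzero when \<open>k = 0\<close>.\<close>
  define \<delta> where "\<delta> = e / (2 * real (Suc k))"
  have \<delta>: "\<delta> > 0" using Union.prems by (simp add: \<delta>_def)
  have "\<forall>i. \<exists>n A. A \<in> F n \<and> measure M ((A - a i) \<union> (a i - A)) < \<delta>"
    using Union.IH[OF \<delta>] by blast
  then obtain n A where A: "\<And>i. A i \<in> F (n i)" "\<And>i. measure M ((A i - a i) \<union> (a i - A i)) < \<delta>" by metis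
  define n' where "n' = Max (n ` {..k})"
  interpret algebra "space M" "F n'" by (rule alg)
  have "n i \<le> n'" if "i < k" for i using that by (auto simp: n'_def intro!: Max_ge)
  then have A': "A i \<in> F n'" if "i < k" for i using A(1)[of i] mono that by blast
  have [measurable]: "A i \<in> sets M" for i using A(1) sub by blast
  define A0 where "A0 = (\<Union>i<k. A i)"
  have A0: "A0 \<in> F n'" unfolding A0_def using A' by (intro finite_UN) auto
  have "measure M ((A0 - (\<Union>i. a i)) \<union> ((\<Union>i. a i) - A0))
     \<le> measure M (((\<Union>i. a i) - u k) \<union> (\<Union>i<k. (A i - a i) \<union> (a i - A i)))"
    by (rule finite_measure_mono) (auto simp: A0_def u_def)
  also have "\<dots> \<le> measure M ((\<Union>i. a i) - u k) + measure M (\<Union>i<k. (A i - a i) \<union> (a i - A i))"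
    by (rule measure_Un_le) auto
  also have "measure M ((\<Union>i. a i) - u k) = measure M (\<Union>i. a i) - measure M (u k)"
    by (rule finite_measure_Diff) (auto simp: u_def)
  also have "measure M (\<Union>i<k. (A i - a i) \<union> (a i - A i)) \<le> (\<Sum>i<k. measure M ((A i - a i) \<union> (a i - A i)))"
    by (rule finite_measure_subadditive_finite) auto
  also have "\<dots> \<le> (\<Sum>i<k. \<delta>)" using A(2) by (intro sum_mono) (simp add: less_imp_le)
  also have "\<dots> \<le> e / 2" using Union.prems by (simp add: \<delta>_def field_simps)
  finally have "measure M ((A0 - (\<Union>i. a i)) \<union> ((\<Union>i. a i) - A0)) < e" using k by simp
  with A0 show ?case by blast
qed

section \<open>Conditioning on the finite histories of the urn\<close>

locale reinforced_urn = polya_urn M f \<sigma> u0 U X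
  for M :: "'w measure" and f :: "real \<Rightarrow> real" and \<sigma> :: "nat \<Rightarrow> nat" and u0 :: "nat ^ 'd"
    and U :: "nat \<Rightarrow> 'w \<Rightarrow> nat ^ 'd" and X :: "nat \<Rightarrow> nat \<Rightarrow> 'w \<Rightarrow> nat ^ 'd" +
  assumes f_class: "f \<in> reinforcement_class"
    and sigma_pos: "n \<ge> 1 \<Longrightarrow> \<sigma> n > 0"
    and u0_nonzero: "u0 \<noteq> 0"
begin

abbreviation \<tau> :: "nat \<Rightarrow> real" where
  "\<tau> n \<equiv> real (urn_total u0 \<sigma> n)"

abbreviation \<theta> :: "nat \<Rightarrow> 'w \<Rightarrow> real ^ 'd" where
  "\<theta> \<equiv> urn_prop u0 \<sigma> U"

definition draw :: "real ^ 'd \<Rightarrow> 'd \<Rightarrow> real" where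
  "draw x j = f (x $ j) / (\<Sum>k\<in>UNIV. f (x $ k))"

text \<open>There are only countably many histories, so dependence on the history alone is
  equivalent to measurability for events (\<open>sets_history\<close>) and implies it for functions
  (\<open>adapted_measurable_history\<close>). In this form it needs no structure on the codomain
  and survives arbitrary compositions.\<close>

definition adapted :: "nat \<Rightarrow> ('w \<Rightarrow> 'b) \<Rightarrow> bool" where
  "adapted n G \<longleftrightarrow> (\<forall>w\<in>space M. \<forall>w'\<in>space M. (\<forall>k\<le>n. U k w = U k w') \<longrightarrow> G w = G w')"

definition atom :: "nat \<Rightarrow> 'w \<Rightarrow> 'w set" where
  "atom n w0 = {w \<in> space M. \<forall>k\<le>n. U k w = U k w0}"

lemma tau_Suc: "\<tau> (Suc n) = \<tau> n + real (\<sigma> (Suc n))"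
  by (simp add: urn_total_def)

lemma tau_ge_1: "\<tau> n \<ge> 1"
proof -
  obtain j where "u0 $ j \<noteq> 0" using u0_nonzero by (auto simp: vec_eq_iff)
  then have "1 \<le> u0 $ j" by simp
  also have "\<dots> \<le> (\<Sum>j\<in>UNIV. u0 $ j)" by (rule member_le_sum) auto
  finally have "1 \<le> urn_total u0 \<sigma> n" by (simp add: urn_total_def)
  then show ?thesis by simp
qed

lemma tau_pos: "\<tau> n > 0"
  using tau_ge_1[of n] by linarith

section \<open>Functions determined by a finite history\<close>

lemma adaptedI:
  assumes "\<And>w w'. w \<in> space M \<Longrightarrow> w' \<in> space M \<Longrightarrow> (\<And>k. k \<le> n \<Longrightarrow> U k w = U k w') \<Longrightarrow> G w = G w'"
  shows "adapted n G"
  unfolding adapted_def using assms by blast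

lemma adaptedD:
  "adapted n G \<Longrightarrow> w \<in> space M \<Longrightarrow> w' \<in> space M \<Longrightarrow> (\<And>k. k \<le> n \<Longrightarrow> U k w = U k w') \<Longrightarrow> G w = G w'"
  unfolding adapted_def by blast

lemma adapted_mono: "adapted m G \<Longrightarrow> m \<le> n \<Longrightarrow> adapted n G"
  unfolding adapted_def by (meson order_trans)

lemma adapted_const [intro, simp]: "adapted n (\<lambda>w. c)"
  by (simp add: adapted_def)

lemma adapted_prop: "k \<le> n \<Longrightarrow> adapted n (\<theta> k)"
  by (simp add: adapted_def urn_prop_def)

lemma adapted_comp:
  assumes "adapted n G" shows "adapted n (\<lambda>w. F (G w))"
  by (intro adaptedI arg_cong[where f=F] adaptedD[OF assms])

lemma adapted_comp2:
  assumes "adapted n G" "adapted n H" shows "adapted n (\<lambda>w. F (G w) (H w))"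
  by (intro adaptedI arg_cong2[where f=F] adaptedD[OF assms(1)] adaptedD[OF assms(2)])

lemma adapted_All:
  assumes "\<And>k. adapted n (\<lambda>w. P k w)" shows "adapted n (\<lambda>w. \<forall>k. P k w)"
  by (intro adaptedI arg_cong[where f=All] ext adaptedD[OF assms])

lemma adapted_Ex:
  assumes "\<And>k. adapted n (\<lambda>w. P k w)" shows "adapted n (\<lambda>w. \<exists>k. P k w)"
  by (intro adaptedI arg_cong[where f=Ex] ext adaptedD[OF assms])

lemma adapted_sum:
  assumes "\<And>k. k \<in> I \<Longrightarrow> adapted n (G k)" shows "adapted n (\<lambda>w. \<Sum>k\<in>I. G k w)"
  by (intro adaptedI sum.cong refl adaptedD[OF assms])

lemma X_measurable: "i \<in> {1..\<sigma> (Suc n)} \<Longrightarrow> X (Suc n) i \<in> measurable M (count_space UNIV)"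
  using X_cond_indep[of n] by (auto simp: cond_indep_vars_def)

lemma measurable_vec_add:
  fixes G H :: "'w \<Rightarrow> nat ^ 'd"
  assumes "G \<in> measurable M (count_space UNIV)" "H \<in> measurable M (count_space UNIV)"
  shows "(\<lambda>w. G w + H w) \<in> measurable M (count_space UNIV)"
  by (rule measurable_compose_countable[OF _ assms(1)]) (rule measurable_compose[OF assms(2)], simp)

lemma U_measurable: "U n \<in> measurable M (count_space UNIV)"
proof (induction n)
  case 0
  have "(\<lambda>w. u0) \<in> measurable M (count_space UNIV)" by simp
  then show ?case by (subst measurable_cong[where g="\<lambda>w. u0"]) (auto simp: U_0)
next
  case (Suc n)
  have S: "(\<lambda>w. \<Sum>i\<in>I. X (Suc n) i w) \<in> measurable M (count_space UNIV)"
    if "finite I" "I \<subseteq> {1..\<sigma> (Suc n)}" for I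
    using that by (induction I rule: finite_induct) (auto intro!: measurable_vec_add X_measurable)
  have "(\<lambda>w. U n w + (\<Sum>i=1..\<sigma> (Suc n). X (Suc n) i w)) \<in> measurable M (count_space UNIV)"
    by (intro measurable_vec_add Suc S) auto
  then show ?case by (subst measurable_cong[OF U_Suc])
qed

lemma space_history [simp]: "space (history M U n) = space M"
  by (simp add: history_def space_measure_of_conv)

lemma sets_history_sigma:
  "sets (history M U n) = sigma_sets (space M) {U k -` B \<inter> space M | k B. k \<le> n}"
  unfolding history_def by (subst sets_measure_of) auto

text \<open>An adapted set is the union of the cylinders of the histories of its points. Histories
  are finite lists over a countable type, so the union is countable, and each cylinder is a finite
  intersection of generators.\<close>

lemma sets_history: "sets (history M U n) = {A. A \<subseteq> space M \<and> adapted n (\<lambda>w. w \<in> A)}"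
proof (intro equalityI subsetI)
  fix A assume "A \<in> sets (history M U n)"
  then have "A \<in> sigma_sets (space M) {U k -` B \<inter> space M | k B. k \<le> n}"
    by (simp only: sets_history_sigma)
  then show "A \<in> {A. A \<subseteq> space M \<and> adapted n (\<lambda>w. w \<in> A)}"
  proof induction
    case (Union a)
    then have "adapted n (\<lambda>w. \<exists>i. w \<in> a i)" by (intro adapted_Ex) simp
    with Union show ?case by (simp add: UN_subset_iff)
  next
    case (Basic a)
    then obtain k B where a: "a = U k -` B \<inter> space M" "k \<le> n" by blast
    have "adapted n (\<lambda>w. w \<in> a)"
      by (rule adaptedI) (use a in simp)
    with a show ?case by simp
  next
    case (Compl a)
    have "adapted n (\<lambda>w. w \<in> space M - a)"
    proof (rule adaptedI)
      fix w w' assume "w \<in> space M" "w' \<in> space M" "\<And>k. k \<le> n \<Longrightarrow> U k w = U k w'"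
      then show "(w \<in> space M - a) = (w' \<in> space M - a)"
        using Compl.IH adaptedD[of n "\<lambda>w. w \<in> a" w w'] by simp
    qed
    then show ?case by simp
  qed simp
next
  fix A assume "A \<in> {A. A \<subseteq> space M \<and> adapted n (\<lambda>w. w \<in> A)}"
  then have A: "A \<subseteq> space M" "adapted n (\<lambda>w. w \<in> A)" by auto
  define hist where "hist w = map (\<lambda>k. U k w) [0..<Suc n]" for w
  have hist_eq: "hist w = hist w' \<longleftrightarrow> (\<forall>k\<le>n. U k w = U k w')" for w w'
    by (auto simp: hist_def simp del: upt_Suc)
  have A_eq: "A = (\<Union>h\<in>hist ` A. {w \<in> space M. hist w = h})"
  proof (intro equalityI subsetI)
    fix w assume "w \<in> (\<Union>h\<in>hist ` A. {w \<in> space M. hist w = h})"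
    then obtain w' where "w' \<in> A" "w \<in> space M" "hist w = hist w'" by blast
    with A(1) adaptedD[OF A(2), of w w'] show "w \<in> A" by (auto simp: hist_eq)
  qed (use A(1) in blast)
  have "(\<Union>h\<in>hist ` A. {w \<in> space M. hist w = h}) \<in> sets (history M U n)"
  proof (rule sets.countable_UN'')
    fix h assume "h \<in> hist ` A"
    then obtain w0 where "h = hist w0" by auto
    then have "{w \<in> space M. hist w = h} = (\<Inter>k\<in>{..n}. U k -` {U k w0} \<inter> space M)"
      by (auto simp: hist_eq)
    also have "\<dots> \<in> sets (history M U n)"
    proof (rule sets.finite_INT)
      fix k assume "k \<in> {..n}"
      then show "U k -` {U k w0} \<inter> space M \<in> sets (history M U n)"
        unfolding sets_history_sigma by (intro sigma_sets.Basic) blast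
    qed auto
    finally show "{w \<in> space M. hist w = h} \<in> sets (history M U n)" .
  qed auto
  then show "A \<in> sets (history M U n)" using A_eq by simp
qed

lemma subalgebra_history: "subalgebra M (history M U n)"
proof -
  have "sets (history M U n) \<subseteq> sets M"
    unfolding sets_history_sigma
    by (intro sets.sigma_sets_subset) (auto intro: measurable_sets[OF U_measurable])
  then show ?thesis by (simp add: subalgebra_def)
qed

lemma adapted_event:
  assumes "adapted n P" shows "{w \<in> space M. P w} \<in> sets (history M U n)"
proof -
  have "adapted n (\<lambda>w. w \<in> {w \<in> space M. P w})"
  proof (rule adaptedI)
    fix w w' assume "w \<in> space M" "w' \<in> space M" "\<And>k. k \<le> n \<Longrightarrow> U k w = U k w'"
    then show "(w \<in> {w \<in> space M. P w}) = (w' \<in> {w \<in> space M. P w})"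
      using adaptedD[OF assms, of w w'] by simp
  qed
  then show ?thesis by (auto simp: sets_history)
qed

lemma history_event: "A \<in> sets (history M U n) \<Longrightarrow> A \<in> events"
  using subalgebra_history[of n] by (auto simp: subalgebra_def)

lemma adapted_measurable_history:
  assumes "adapted n G" "\<And>w. w \<in> space M \<Longrightarrow> G w \<in> space N"
  shows "G \<in> measurable (history M U n) N"
proof (rule measurableI)
  fix B assume "B \<in> sets N"
  have "G -` B \<inter> space M = {w \<in> space M. G w \<in> B}" by auto
  with adapted_event[OF adapted_comp[OF assms(1)], of "\<lambda>x. x \<in> B"]
  show "G -` B \<inter> space (history M U n) \<in> sets (history M U n)" by simp
qed (use assms in auto)

lemma adapted_measurable:
  assumes "adapted n G" "\<And>w. w \<in> space M \<Longrightarrow> G w \<in> space N"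
  shows "G \<in> measurable M N"
  using measurable_from_subalg[OF subalgebra_history adapted_measurable_history[OF assms]] .

lemma history_measurable_adapted:
  fixes G :: "'w \<Rightarrow> real"
  assumes "G \<in> borel_measurable (history M U n)"
  shows "adapted n G"
proof (rule adaptedI)
  fix w w' assume w: "w \<in> space M" "w' \<in> space M" "\<And>k. k \<le> n \<Longrightarrow> U k w = U k w'"
  have "{v \<in> space (history M U n). G v = G w} \<in> sets (history M U n)" using assms by measurable
  then have "{v \<in> space M. G v = G w} \<in> sets (history M U n)" by simp
  then have "adapted n (\<lambda>v. v \<in> {v \<in> space M. G v = G w})" unfolding sets_history by simp
  from adaptedD[OF this, of w w'] w show "G w = G w'" by auto
qed

lemma atom_history: "atom n w0 \<in> sets (history M U n)"
  unfolding atom_def by (rule adapted_event) (auto simp: adapted_def)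

lemma atom_event [measurable]: "atom n w0 \<in> events"
  using atom_history by (rule history_event)

lemma adapted_on_atom:
  "adapted n G \<Longrightarrow> w0 \<in> space M \<Longrightarrow> w \<in> atom n w0 \<Longrightarrow> G w = G w0"
  using adaptedD[of n G w w0] by (simp add: atom_def)

lemma cond_prob_measurable: "cond_prob M (history M U n) B \<in> borel_measurable (history M U n)"
  by (simp add: cond_prob_def)

lemma integrable_event_indicator: "B \<in> events \<Longrightarrow> integrable M (indicator B :: 'w \<Rightarrow> real)"
  by (intro integrable_real_indicator) (auto simp: less_top[symmetric])

text \<open>The chosen version of the conditional probability is measurable for the history, hence
  constant on atoms, and its integral over the atom is the probability of the intersection. The
  equation therefore holds at every point; on a null atom it reads 0 = 0.\<close>

lemma cond_prob_atom:
  assumes B: "B \<in> events" and w0: "w0 \<in> space M"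
  shows "cond_prob M (history M U n) B w0 * prob (atom n w0) = prob (atom n w0 \<inter> B)"
proof -
  interpret F: finite_measure_subalgebra M "history M U n"
    by unfold_locales (rule subalgebra_history)
  have "prob (atom n w0 \<inter> B) = (\<integral>w\<in>atom n w0. indicator B w \<partial>M)"
    using B by (simp add: set_lebesgue_integral_def indicator_inter_arith[symmetric] Int_absorb2 Int_absorb1 sets.sets_into_space)
  also have "\<dots> = (\<integral>w\<in>atom n w0. cond_prob M (history M U n) B w \<partial>M)"
    unfolding cond_prob_def by (rule F.real_cond_exp_intA[OF integrable_event_indicator[OF B] atom_history])
  also have "\<dots> = (\<integral>w\<in>atom n w0. cond_prob M (history M U n) B w0 \<partial>M)"
    by (rule set_lebesgue_integral_cong)
      (use adapted_on_atom[OF history_measurable_adapted[OF cond_prob_measurable] w0] in auto)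
  also have "\<dots> = cond_prob M (history M U n) B w0 * prob (atom n w0)"
    by (simp add: set_lebesgue_integral_def)
  finally show ?thesis by simp
qed

section \<open>Proportions in the simplex, almost surely\<close>

lemma draw_sum:
  assumes "\<And>j. x $ j \<ge> 0" "(\<Sum>j\<in>UNIV. x $ j) = (1::real)"
  shows "(\<Sum>j\<in>UNIV. f (x $ j)) > 0" "(\<Sum>j\<in>UNIV. draw x j) = 1" "draw x j \<ge> 0" "x $ j \<le> 1"
proof -
  have le1: "x $ j \<le> 1" for j
    using member_le_sum[of j UNIV "\<lambda>j. x $ j"] assms by auto
  then show "x $ j \<le> 1" .
  have nn: "f (x $ j) \<ge> 0" for j using reinforcement_nonneg[OF f_class assms(1) le1] .
  obtain i where "x $ i \<noteq> 0" using assms(2) by (metis sum.neutral zero_neq_one)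
  then have "f (x $ i) > 0" using reinforcement_pos[OF f_class _ le1, of i] assms(1)[of i] by simp
  then show pos: "(\<Sum>j\<in>UNIV. f (x $ j)) > 0" using nn by (intro sum_pos2[of _ i]) auto
  then show "(\<Sum>j\<in>UNIV. draw x j) = 1" by (simp add: draw_def sum_divide_distrib[symmetric])
  show "draw x j \<ge> 0" using nn pos by (simp add: draw_def)
qed

lemma prop_sum:
  assumes "(\<Sum>j\<in>UNIV. U n w $ j) = urn_total u0 \<sigma> n"
  shows "\<theta> n w $ j \<ge> 0" "(\<Sum>j\<in>UNIV. \<theta> n w $ j) = 1"
proof -
  show "\<theta> n w $ j \<ge> 0" by (simp add: urn_prop_def)
  have "(\<Sum>j\<in>UNIV. \<theta> n w $ j) = real (\<Sum>j\<in>UNIV. U n w $ j) / \<tau> n"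
    by (simp add: urn_prop_def sum_divide_distrib)
  then show "(\<Sum>j\<in>UNIV. \<theta> n w $ j) = 1" using tau_pos[of n] assms by simp
qed

text \<open>\<open>X_distr\<close> prescribes the probabilities of the unit vectors. If the total at
  time \<open>n\<close> is right, the proportions lie in the simplex, these probabilities add up to
  1, and nothing is left for other values. The induction in \<open>AE_total\<close> then discharges
  the hypothesis on the total.\<close>

lemma AE_unit_step:
  assumes tot: "AE w in M. (\<Sum>j\<in>UNIV. U n w $ j) = urn_total u0 \<sigma> n" and i: "i \<in> {1..\<sigma> (Suc n)}"
  shows "AE w in M. X (Suc n) i w \<in> range (\<lambda>j. axis j 1)"
proof -
  interpret F: finite_measure_subalgebra M "history M U n"
    by unfold_locales (rule subalgebra_history)
  define E where "E j = {w \<in> space M. X (Suc n) i w = axis j 1}" for j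
  have E[measurable]: "E j \<in> events" for j
  proof -
    have "E j = X (Suc n) i -` {axis j 1} \<inter> space M" by (auto simp: E_def)
    also have "\<dots> \<in> events" by (rule measurable_sets[OF X_measurable[OF i]]) simp
    finally show ?thesis .
  qed
  have int: "integrable M (cond_prob M (history M U n) (E j))" for j
    unfolding cond_prob_def by (rule F.real_cond_exp_int(1)[OF integrable_event_indicator[OF E]])
  have pE: "prob (E j) = expectation (cond_prob M (history M U n) (E j))" for j
    unfolding cond_prob_def by (subst F.real_cond_exp_int(2)[OF integrable_event_indicator[OF E]]) (auto simp: sets.sets_into_space Int_absorb2)
  have "AE w in M. \<forall>j\<in>UNIV. cond_prob M (history M U n) (E j) w = draw (\<theta> n w) j"
    using X_distr[OF i] unfolding E_def draw_def by (intro AE_finite_allI) auto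
  with tot have sum1: "AE w in M. (\<Sum>j\<in>UNIV. cond_prob M (history M U n) (E j) w) = 1"
    by eventually_elim (use draw_sum(2) prop_sum in auto)
  have "prob (\<Union>j. E j) = (\<Sum>j\<in>UNIV. prob (E j))"
  proof (intro finite_measure_finite_Union)
    show "disjoint_family_on E UNIV" by (auto simp: disjoint_family_on_def E_def axis_eq_axis)
  qed auto
  also have "\<dots> = expectation (\<lambda>w. \<Sum>j\<in>UNIV. cond_prob M (history M U n) (E j) w)"
    unfolding pE by (rule Bochner_Integration.integral_sum[symmetric]) (rule int)
  also have "\<dots> = expectation (\<lambda>w. 1)"
    by (intro integral_cong_AE sum1) (auto intro!: borel_measurable_sum borel_measurable_integrable[OF int])
  finally have "prob (\<Union>j. E j) = 1" by (simp add: prob_space)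
  moreover have "(\<Union>j. E j) \<in> events" by auto
  ultimately have "AE w in M. w \<in> (\<Union>j. E j)" using prob_eq_1 by blast
  then show ?thesis by eventually_elim (auto simp: E_def)
qed

lemma AE_total_step:
  assumes "AE w in M. (\<Sum>j\<in>UNIV. U n w $ j) = urn_total u0 \<sigma> n"
  shows "AE w in M. (\<Sum>j\<in>UNIV. U (Suc n) w $ j) = urn_total u0 \<sigma> (Suc n)"
proof -
  have "AE w in M. \<forall>i\<in>{1..\<sigma> (Suc n)}. X (Suc n) i w \<in> range (\<lambda>j. axis j 1)"
    by (intro AE_finite_allI AE_unit_step assms) auto
  with assms AE_space show ?thesis
  proof eventually_elim
    case (elim w)
    have "(\<Sum>j\<in>UNIV. X (Suc n) i w $ j) = 1" if i: "i \<in> {1..\<sigma> (Suc n)}" for i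
    proof -
      obtain k where "X (Suc n) i w = axis k 1" using elim i by blast
      then show ?thesis by (simp add: axis_def if_distrib cong: if_cong)
    qed
    then have "(\<Sum>j\<in>UNIV. \<Sum>i=1..\<sigma> (Suc n). X (Suc n) i w $ j) = \<sigma> (Suc n)"
      by (subst sum.swap) simp
    with elim show ?case by (simp add: U_Suc sum.distrib urn_total_def)
  qed
qed

lemma AE_total: "AE w in M. (\<Sum>j\<in>UNIV. U n w $ j) = urn_total u0 \<sigma> n"
proof (induction n)
  case 0
  show ?case using AE_space by eventually_elim (simp add: U_0 urn_total_def)
qed (rule AE_total_step)

lemma AE_unit:
  assumes "i \<in> {1..\<sigma> (Suc n)}" shows "AE w in M. X (Suc n) i w \<in> range (\<lambda>j. axis j 1)"
  using AE_unit_step[OF AE_total assms] .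

lemma AE_simplex: "AE w in M. \<forall>n. (\<forall>j. \<theta> n w $ j \<ge> 0) \<and> (\<Sum>j\<in>UNIV. \<theta> n w $ j) = 1"
proof (subst AE_all_countable, rule allI)
  fix n show "AE w in M. (\<forall>j. \<theta> n w $ j \<ge> 0) \<and> (\<Sum>j\<in>UNIV. \<theta> n w $ j) = 1"
    using AE_total[of n] by eventually_elim (use prop_sum in blast)
qed

section \<open>Integration over finitely many histories\<close>

lemma finite_compositions: "finite {u :: nat ^ 'd. (\<Sum>j\<in>UNIV. u $ j) = t}"
proof -
  have "{u :: nat ^ 'd. (\<Sum>j\<in>UNIV. u $ j) = t} \<subseteq> vec_lambda ` (UNIV \<rightarrow>\<^sub>E {..t})"
  proof
    fix u :: "nat ^ 'd" assume u: "u \<in> {u. (\<Sum>j\<in>UNIV. u $ j) = t}"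
    then have "u $ j \<le> t" for j using member_le_sum[of j UNIV "\<lambda>j. u $ j"] by auto
    then have "vec_nth u \<in> UNIV \<rightarrow>\<^sub>E {..t}" by auto
    moreover have "u = vec_lambda (vec_nth u)" by simp
    ultimately show "u \<in> vec_lambda ` (UNIV \<rightarrow>\<^sub>E {..t})" by blast
  qed
  then show ?thesis by (rule finite_subset) (intro finite_imageI finite_PiE, auto)
qed

text \<open>The totals are deterministic, so up to a null set only finitely many compositions occur
  up to time \<open>n\<close>. \<open>W\<close> holds one representative per history, and its atoms
  partition almost all of the space.\<close>

lemma finite_histories:
  obtains W where "finite W" "W \<subseteq> space M" "AE w in M. \<exists>!w0. w0 \<in> W \<and> w \<in> atom n w0"
proof -
  define hist where "hist w = map (\<lambda>k. U k w) [0..<Suc n]" for w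
  have hist_eq: "hist w = hist w' \<longleftrightarrow> (\<forall>k\<le>n. U k w = U k w')" for w w'
    by (auto simp: hist_def simp del: upt_Suc)
  define S where "S = (\<Union>k\<in>{..n}. {u :: nat ^ 'd. (\<Sum>j\<in>UNIV. u $ j) = urn_total u0 \<sigma> k})"
  define G where "G = {w \<in> space M. \<forall>k\<le>n. U k w \<in> S}"
  have "finite S" unfolding S_def by (intro finite_UN_I finite_compositions) auto
  then have "finite {xs. set xs \<subseteq> S \<and> length xs = Suc n}" by (rule finite_lists_length_eq)
  moreover have "hist ` G \<subseteq> {xs. set xs \<subseteq> S \<and> length xs = Suc n}"
    by (auto simp: hist_def G_def)
  ultimately have fin: "finite (hist ` G)" by (rule finite_subset[rotated])
  define rep where "rep h = (SOME w. w \<in> G \<and> hist w = h)" for h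
  define W where "W = rep ` hist ` G"
  have rep: "rep h \<in> G \<and> hist (rep h) = h" if "h \<in> hist ` G" for h
  proof -
    from that have "\<exists>w. w \<in> G \<and> hist w = h" by blast
    then show ?thesis unfolding rep_def by (rule someI_ex)
  qed
  have uniq: "\<exists>!w0. w0 \<in> W \<and> w \<in> atom n w0" if w: "w \<in> G" for w
  proof (rule ex1I)
    have "hist (rep (hist w)) = hist w" using rep w by blast
    moreover have "rep (hist w) \<in> W" using w by (simp add: W_def)
    moreover have "w \<in> space M" using w by (simp add: G_def)
    ultimately show "rep (hist w) \<in> W \<and> w \<in> atom n (rep (hist w))"
      by (simp add: atom_def hist_eq)
    fix v assume v: "v \<in> W \<and> w \<in> atom n v"
    then obtain h where h: "h \<in> hist ` G" "v = rep h" by (auto simp: W_def)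
    have "hist w = hist v" using v by (simp add: atom_def hist_eq)
    with rep[OF h(1)] h(2) show "v = rep (hist w)" by simp
  qed
  show thesis
  proof (rule that[of W])
    show "finite W" using fin by (simp add: W_def)
    show "W \<subseteq> space M" using rep by (auto simp: W_def G_def)
    have "AE w in M. \<forall>k. (\<Sum>j\<in>UNIV. U k w $ j) = urn_total u0 \<sigma> k"
      using AE_total by (simp add: AE_all_countable)
    with AE_space show "AE w in M. \<exists>!w0. w0 \<in> W \<and> w \<in> atom n w0"
      by eventually_elim (rule uniq, auto simp: G_def S_def)
  qed
qed

lemma AE_sum_atoms:
  obtains W where "finite W" "W \<subseteq> space M" "\<forall>G :: 'w \<Rightarrow> real. AE w in M. G w = (\<Sum>w0\<in>W. indicator (atom n w0) w * G w)"
proof -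
  obtain W where W: "finite W" "W \<subseteq> space M" "AE w in M. \<exists>!w0. w0 \<in> W \<and> w \<in> atom n w0"
    using finite_histories .
  have "AE w in M. G w = (\<Sum>w0\<in>W. indicator (atom n w0) w * G w)" for G :: "'w \<Rightarrow> real"
    using W(3)
  proof eventually_elim
    case (elim w)
    then obtain w0 where w0: "w0 \<in> W" "w \<in> atom n w0" and u: "\<And>v. v \<in> W \<Longrightarrow> w \<in> atom n v \<Longrightarrow> v = w0" by blast
    have "(\<Sum>v\<in>W. indicator (atom n v) w * G w) = (\<Sum>v\<in>W. if v = w0 then G w else 0)"
    proof (rule sum.cong)
      fix v assume "v \<in> W"
      with u[of v] w0 show "indicator (atom n v) w * G w = (if v = w0 then G w else 0)"
        by (cases "v = w0") (auto simp: indicator_def)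
    qed simp
    then show ?case using W(1) w0 by simp
  qed
  then show thesis by (intro that[OF W(1,2)] allI)
qed

lemma adapted_borel: "adapted n G \<Longrightarrow> G \<in> borel_measurable M"
  by (rule adapted_measurable) auto

text \<open>Almost surely an adapted function is a finite combination of indicators of atoms. Later
  quantities are integrable for this reason, without size estimates.\<close>

lemma adapted_integrable:
  fixes G :: "'w \<Rightarrow> real"
  assumes "adapted n G" shows "integrable M G"
proof -
  obtain W where W: "finite W" "W \<subseteq> space M" "\<forall>G :: 'w \<Rightarrow> real. AE w in M. G w = (\<Sum>w0\<in>W. indicator (atom n w0) w * G w)"
    using AE_sum_atoms by blast
  have "integrable M (\<lambda>w. \<Sum>w0\<in>W. indicator (atom n w0) w * G w0)"
    by (intro Bochner_Integration.integrable_sum integrable_mult_left integrable_event_indicator atom_event)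
  moreover have "AE w in M. (\<Sum>w0\<in>W. indicator (atom n w0) w * G w0) = G w"
    using W(3)[rule_format, of G]
  proof eventually_elim
    case (elim w)
    show ?case by (subst elim, rule sum.cong)
      (use W(2) adapted_on_atom[OF assms] in \<open>auto simp: indicator_def\<close>)
  qed
  ultimately show ?thesis
    using integrable_cong_AE[of "\<lambda>w. \<Sum>w0\<in>W. indicator (atom n w0) w * G w0" M G] adapted_borel[OF assms]
    by (metis (no_types, lifting) borel_measurable_integrable)
qed

text \<open>Comparison on atoms takes the place of comparison of conditional expectations; null
  atoms contribute nothing to either integral.\<close>

lemma integral_le_by_atoms:
  fixes G H :: "'w \<Rightarrow> real"
  assumes int: "integrable M G" "integrable M H"
    and le: "\<And>w0. w0 \<in> space M \<Longrightarrow> prob (atom n w0) > 0 \<Longrightarrow>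
      (\<integral>w. indicator (atom n w0) w * G w \<partial>M) \<le> (\<integral>w. indicator (atom n w0) w * H w \<partial>M)"
  shows "integral\<^sup>L M G \<le> integral\<^sup>L M H"
proof -
  obtain W where W: "finite W" "W \<subseteq> space M" "\<forall>G :: 'w \<Rightarrow> real. AE w in M. G w = (\<Sum>w0\<in>W. indicator (atom n w0) w * G w)"
    using AE_sum_atoms by blast
  have eq: "integral\<^sup>L M G = (\<Sum>w0\<in>W. \<integral>w. indicator (atom n w0) w * G w \<partial>M)"
    if "integrable M G" for G :: "'w \<Rightarrow> real"
  proof -
    have i: "integrable M (\<lambda>w. indicator (atom n w0) w * G w)" for w0
      using integrable_mult_indicator[OF atom_event that] by simp
    have "integral\<^sup>L M G = (\<integral>w. (\<Sum>w0\<in>W. indicator (atom n w0) w * G w) \<partial>M)"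
      using W(3)[rule_format, of G] by (intro integral_cong_AE) (use i that in auto)
    also have "\<dots> = (\<Sum>w0\<in>W. \<integral>w. indicator (atom n w0) w * G w \<partial>M)"
      by (rule Bochner_Integration.integral_sum) (rule i)
    finally show ?thesis .
  qed
  show ?thesis unfolding eq[OF int(1)] eq[OF int(2)]
  proof (rule sum_mono)
    fix w0 assume w0: "w0 \<in> W"
    show "(\<integral>w. indicator (atom n w0) w * G w \<partial>M) \<le> (\<integral>w. indicator (atom n w0) w * H w \<partial>M)"
    proof (cases "prob (atom n w0) > 0")
      case True
      then show ?thesis using le w0 W(2) by blast
    next
      case False
      then have "prob (atom n w0) = 0" by (simp add: zero_less_measure_iff)
      then have "AE w in M. w \<notin> atom n w0" using prob_eq_0[OF atom_event] by blast
      then have "(\<integral>w. indicator (atom n w0) w * G w \<partial>M) = 0" for G :: "'w \<Rightarrow> real"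
        by (intro integral_eq_zero_AE) (auto elim!: eventually_mono)
      then show ?thesis by simp
    qed
  qed
qed

text \<open>Serves to transfer almost sure statements to the point \<open>w0\<close>: a quantity
  determined by the history has the same value at the witness as at \<open>w0\<close>.\<close>

lemma AE_atom_witness:
  assumes "AE w in M. P w" "prob (atom n w0) > 0"
  obtains w where "w \<in> atom n w0" "P w"
proof (rule ccontr)
  assume "\<not> thesis"
  with that have "\<And>w. w \<in> atom n w0 \<Longrightarrow> \<not> P w" by blast
  with assms(1) have "AE w in M. w \<notin> atom n w0" by (auto elim: eventually_mono)
  then have "prob (atom n w0) = 0" using prob_eq_0[OF atom_event] by blast
  with assms(2) show False by simp
qed

lemma X_event: "i \<in> {1..\<sigma> (Suc n)} \<Longrightarrow> {w \<in> space M. X (Suc n) i w \<in> B} \<in> events"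
proof -
  assume i: "i \<in> {1..\<sigma> (Suc n)}"
  have "X (Suc n) i -` B \<inter> space M \<in> events" by (rule measurable_sets[OF X_measurable[OF i]]) simp
  also have "X (Suc n) i -` B \<inter> space M = {w \<in> space M. X (Suc n) i w \<in> B}" by auto
  finally show ?thesis .
qed

section \<open>The law of the draws given one history\<close>

context
  fixes n :: nat and w0 :: 'w
  assumes w0: "w0 \<in> space M" and pos: "prob (atom n w0) > 0"
begin

abbreviation Q where "Q \<equiv> uniform_measure M (atom n w0)"

lemma prob_space_Q: "prob_space Q"
  using pos by (intro prob_space_uniform_measure) (auto simp: emeasure_eq_measure)

lemma measure_Q:
  assumes "B \<in> events"
  shows "measure Q B = cond_prob M (history M U n) B w0"
proof -
  have "measure Q B = prob (atom n w0 \<inter> B) / prob (atom n w0)"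
    using pos assms by (intro measure_uniform_measure) (auto simp: emeasure_eq_measure)
  then show ?thesis unfolding cond_prob_atom[OF assms w0, of n, symmetric] using pos by simp
qed

lemma integral_Q:
  fixes G :: "'w \<Rightarrow> real"
  assumes [measurable]: "G \<in> borel_measurable M"
  shows "(\<integral>w. G w \<partial>Q) = (\<integral>w. indicator (atom n w0) w * G w \<partial>M) / prob (atom n w0)"
proof -
  have eq: "Q = density M (\<lambda>w. ennreal (indicator (atom n w0) w / prob (atom n w0)))"
    unfolding uniform_measure_def using pos
    by (intro arg_cong[where f="density M"] ext)
      (auto simp: emeasure_eq_measure indicator_def divide_ennreal[symmetric])
  have "(\<integral>w. G w \<partial>Q) = (\<integral>w. indicator (atom n w0) w / prob (atom n w0) * G w \<partial>M)"
    unfolding eq by (rule integral_real_density) auto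
  then show ?thesis by simp
qed

lemma AE_Q: "AE w in M. P w \<Longrightarrow> AE w in Q. P w"
  using pos by (intro AE_uniform_measureI) auto

lemma cond_prob_const:
  assumes "w \<in> atom n w0" shows "cond_prob M (history M U n) B w = cond_prob M (history M U n) B w0"
  by (rule adapted_on_atom[OF history_measurable_adapted[OF cond_prob_measurable] w0 assms])

lemma draw_Q:
  assumes i: "i \<in> {1..\<sigma> (Suc n)}"
  shows "measure Q {w \<in> space M. X (Suc n) i w = axis j 1} = draw (\<theta> n w0) j"
proof -
  obtain w where w: "w \<in> atom n w0"
    "cond_prob M (history M U n) {w \<in> space M. X (Suc n) i w = axis j 1} w = draw (\<theta> n w) j"
    using AE_atom_witness[OF X_distr[OF i, of j] pos] unfolding draw_def by blast
  have "\<theta> n w = \<theta> n w0" using adapted_on_atom[OF adapted_prop w0 w(1)] by simp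
  with w cond_prob_const[OF w(1)] measure_Q X_event[OF i, of "{axis j 1}"] show ?thesis by simp
qed

text \<open>On the atom, conditional probabilities are ordinary probabilities under
  \<open>Q\<close>. The conditional product formula holds almost surely, thus at some point of the
  atom, and there it is the product formula that defines independence.\<close>

lemma indep_Q: "prob_space.indep_vars Q (\<lambda>_. count_space UNIV) (X (Suc n)) {1..\<sigma> (Suc n)}"
proof -
  interpret Q: prob_space Q by (rule prob_space_Q)
  show ?thesis unfolding Q.indep_vars_def2 Q.indep_sets_def
  proof (intro conjI ballI allI impI)
    fix i assume "i \<in> {1..\<sigma> (Suc n)}"
    then show "Q.random_variable (count_space UNIV) (X (Suc n) i)"
      using X_measurable[of i n] by simp
    then show "{X (Suc n) i -` A \<inter> space Q |A. A \<in> sets (count_space UNIV)} \<subseteq> Q.events"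
      by (auto intro: measurable_sets)
  next
    fix J A assume J: "J \<subseteq> {1..\<sigma> (Suc n)}" "J \<noteq> {}" "finite J"
      and A: "A \<in> Pi J (\<lambda>i. {X (Suc n) i -` A \<inter> space Q |A. A \<in> sets (count_space UNIV)})"
    then have "\<forall>i\<in>J. \<exists>B. A i = {w \<in> space M. X (Suc n) i w \<in> B}" by (fastforce simp: Pi_iff)
    then obtain B where B: "\<And>i. i \<in> J \<Longrightarrow> A i = {w \<in> space M. X (Suc n) i w \<in> B i}" by metis
    have INT: "(\<Inter>i\<in>J. A i) = {w \<in> space M. \<forall>i\<in>J. X (Suc n) i w \<in> B i}" using B J by auto
    have ev: "A i \<in> events" if "i \<in> J" for i using X_event[of i n "B i"] B[OF that] that J by auto
    have evI: "(\<Inter>i\<in>J. A i) \<in> events" using J ev by (intro sets.finite_INT) auto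
    have "AE w in M. cond_prob M (history M U n) {w \<in> space M. \<forall>i\<in>J. X (Suc n) i w \<in> B i} w =
                    (\<Prod>i\<in>J. cond_prob M (history M U n) {w \<in> space M. X (Suc n) i w \<in> B i} w)"
      using X_cond_indep[of n] J unfolding cond_indep_vars_def by simp
    then obtain w where w: "w \<in> atom n w0" "cond_prob M (history M U n) (\<Inter>i\<in>J. A i) w =
                    (\<Prod>i\<in>J. cond_prob M (history M U n) {w \<in> space M. X (Suc n) i w \<in> B i} w)"
      unfolding INT[symmetric] by (rule AE_atom_witness[OF _ pos])
    have "measure Q (\<Inter>i\<in>J. A i) = (\<Prod>i\<in>J. cond_prob M (history M U n) {w \<in> space M. X (Suc n) i w \<in> B i} w)"
      using w(2) cond_prob_const[OF w(1)] measure_Q[OF evI] by simp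
    also have "\<dots> = (\<Prod>i\<in>J. measure Q (A i))"
      by (rule prod.cong) (use measure_Q[OF ev] cond_prob_const[OF w(1)] B in auto)
    finally show "Q.prob (\<Inter>i\<in>J. A i) = (\<Prod>i\<in>J. Q.prob (A i))" .
  qed
qed

lemma expectation_draw_Q:
  fixes \<Phi> :: "nat ^ 'd \<Rightarrow> real"
  assumes i: "i \<in> {1..\<sigma> (Suc n)}"
  shows "(\<integral>w. \<Phi> (X (Suc n) i w) \<partial>Q) = (\<Sum>j\<in>UNIV. draw (\<theta> n w0) j * \<Phi> (axis j 1))"
proof -
  interpret Q: prob_space Q by (rule prob_space_Q)
  define E where "E j = {w \<in> space M. X (Suc n) i w = axis j 1}" for j
  have E[measurable]: "E j \<in> events" for j using X_event[OF i, of "{axis j 1}"] by (simp add: E_def)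
  have Xi[measurable]: "X (Suc n) i \<in> measurable M (count_space UNIV)" by (rule X_measurable[OF i])
  have "AE w in Q. \<Phi> (X (Suc n) i w) = (\<Sum>j\<in>UNIV. indicator (E j) w * \<Phi> (axis j 1))"
  proof (rule AE_Q)
    show "AE w in M. \<Phi> (X (Suc n) i w) = (\<Sum>j\<in>UNIV. indicator (E j) w * \<Phi> (axis j 1))"
      using AE_unit[OF i] AE_space
    proof eventually_elim
      case (elim w)
      then obtain k where k: "X (Suc n) i w = axis k 1" by auto
      have "(\<Sum>j\<in>UNIV. indicator (E j) w * \<Phi> (axis j 1)) = (\<Sum>j\<in>UNIV. if j = k then \<Phi> (axis k 1) else 0)"
        by (rule sum.cong) (use k elim in \<open>auto simp: E_def axis_eq_axis indicator_def\<close>)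
      then show ?case using k by simp
    qed
  qed
  moreover have "(\<lambda>w. \<Phi> (X (Suc n) i w)) \<in> borel_measurable Q"
    using measurable_compose[OF Xi, of \<Phi> borel] by simp
  moreover have "(\<lambda>w. \<Sum>j\<in>UNIV. indicator (E j) w * \<Phi> (axis j 1)) \<in> borel_measurable Q"
    by measurable
  ultimately have "(\<integral>w. \<Phi> (X (Suc n) i w) \<partial>Q) = (\<integral>w. (\<Sum>j\<in>UNIV. indicator (E j) w * \<Phi> (axis j 1)) \<partial>Q)"
    by (intro integral_cong_AE)
  also have "\<dots> = (\<Sum>j\<in>UNIV. \<integral>w. indicator (E j) w * \<Phi> (axis j 1) \<partial>Q)"
    by (intro Bochner_Integration.integral_sum integrable_mult_left Q.integrable_const_bound[where B=1]) auto
  also have "\<dots> = (\<Sum>j\<in>UNIV. measure Q (E j) * \<Phi> (axis j 1))"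
    by (simp add: Int_absorb2 Int_absorb1 sets.sets_into_space)
  finally show ?thesis unfolding E_def draw_Q[OF i] .
qed

end

text \<open>The conditionally centred number of added balls, tested against weights
  \<open>b\<close>. These weights will be the difference of two coordinates, the indicator of the
  leading colour, or the vector of proportions itself.\<close>

definition noise :: "('d \<Rightarrow> real) \<Rightarrow> nat \<Rightarrow> 'w \<Rightarrow> real" where
  "noise b n w = (\<Sum>j\<in>UNIV. b j * (real (U (Suc n) w $ j) - real (U n w $ j) - real (\<sigma> (Suc n)) * draw (\<theta> n w) j))"

text \<open>On the simplex, the variance of \<open>b\<close> when the colour has the law
  \<open>draw x\<close>.\<close>

definition spread :: "('d \<Rightarrow> real) \<Rightarrow> real ^ 'd \<Rightarrow> real" where
  "spread b x = (\<Sum>j\<in>UNIV. draw x j * (b j)\<^sup>2) - (\<Sum>j\<in>UNIV. draw x j * b j)\<^sup>2"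

text \<open>On one atom the proportions are frozen, and the noise is a sum of
  \<open>\<sigma> (Suc n)\<close> variables that are i.i.d. and centred under the conditional law.
  They are bounded by 2, since \<open>b\<close> and its mean are bounded by 1.\<close>

lemma noise_moments_atom:
  assumes w0: "w0 \<in> space M" and pos: "prob (atom n w0) > 0" and b: "\<And>j. \<bar>b j\<bar> \<le> 1"
  shows "(\<integral>w. indicator (atom n w0) w * noise b n w \<partial>M) = 0"
    and "(\<integral>w. indicator (atom n w0) w * (noise b n w)\<^sup>2 \<partial>M) =
      prob (atom n w0) * (real (\<sigma> (Suc n)) * spread b (\<theta> n w0))"
    and "(\<integral>w. indicator (atom n w0) w * (noise b n w)^4 \<partial>M) \<le> prob (atom n w0) * (48 * (real (\<sigma> (Suc n)))\<^sup>2)"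
proof -
  let ?Q = "uniform_measure M (atom n w0)"
  interpret Q: prob_space ?Q using prob_space_Q[OF w0 pos] .
  define p where "p j = draw (\<theta> n w0) j" for j
  define \<mu> where "\<mu> = (\<Sum>j\<in>UNIV. p j * b j)"
  define \<Phi> :: "nat ^ 'd \<Rightarrow> real" where "\<Phi> x = (\<Sum>j\<in>UNIV. b j * (real (x $ j) - p j))" for x
  define Z where "Z i w = \<Phi> (X (Suc n) i w)" for i w
  have AE_th: "AE w in M. (\<forall>j. \<theta> n w $ j \<ge> 0) \<and> (\<Sum>j\<in>UNIV. \<theta> n w $ j) = 1"
    using AE_simplex by (auto elim: eventually_mono)
  obtain w1 where w1: "w1 \<in> atom n w0" "(\<forall>j. \<theta> n w1 $ j \<ge> 0) \<and> (\<Sum>j\<in>UNIV. \<theta> n w1 $ j) = 1"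
    using AE_atom_witness[OF AE_th pos] by blast
  moreover have "\<theta> n w1 = \<theta> n w0" using adapted_on_atom[OF adapted_prop w0 w1(1)] by simp
  ultimately have p_sum: "(\<Sum>j\<in>UNIV. p j) = 1" and p_nn: "\<And>j. p j \<ge> 0"
    unfolding p_def using draw_sum(2,3)[of "\<theta> n w0"] by auto
  have \<Phi>_axis: "\<Phi> (axis k 1) = b k - \<mu>" for k
  proof -
    have "\<Phi> (axis k 1) = (\<Sum>j\<in>UNIV. (if j = k then b j else 0) - p j * b j)"
      unfolding \<Phi>_def by (rule sum.cong) (auto simp: axis_def algebra_simps)
    then show ?thesis by (simp add: sum_subtractf \<mu>_def)
  qed
  have \<mu>_le: "\<bar>\<mu>\<bar> \<le> 1"
  proof -
    have "\<bar>\<mu>\<bar> \<le> (\<Sum>j\<in>UNIV. \<bar>p j * b j\<bar>)" unfolding \<mu>_def by (rule sum_abs)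
    also have "\<dots> \<le> (\<Sum>j\<in>UNIV. p j)"
      using p_nn b by (intro sum_mono) (auto simp: abs_mult intro: mult_left_le)
    finally show ?thesis using p_sum by simp
  qed
  define v where "v = spread b (\<theta> n w0)"
  have v: "v = (\<Sum>j\<in>UNIV. p j * (b j)\<^sup>2) - \<mu>\<^sup>2" by (simp add: v_def spread_def p_def \<mu>_def)
  have EZ: "Q.expectation (Z i) = 0" if "i \<in> {1..\<sigma> (Suc n)}" for i
  proof -
    have "Q.expectation (Z i) = (\<Sum>j\<in>UNIV. p j * (b j - \<mu>))"
      unfolding Z_def expectation_draw_Q[OF w0 pos that] \<Phi>_axis p_def ..
    also have "\<dots> = (\<Sum>j\<in>UNIV. p j * b j - \<mu> * p j)" by (simp add: algebra_simps)
    also have "\<dots> = \<mu> - \<mu> * (\<Sum>j\<in>UNIV. p j)"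
      unfolding sum_subtractf sum_distrib_left[symmetric] \<mu>_def[symmetric] ..
    finally show ?thesis using p_sum by simp
  qed
  have EZ2: "Q.expectation (\<lambda>w. (Z i w)\<^sup>2) = v" if "i \<in> {1..\<sigma> (Suc n)}" for i
  proof -
    have "Q.expectation (\<lambda>w. (Z i w)\<^sup>2) = (\<Sum>j\<in>UNIV. p j * (b j - \<mu>)\<^sup>2)"
      unfolding Z_def expectation_draw_Q[OF w0 pos that, of "\<lambda>x. (\<Phi> x)\<^sup>2"] \<Phi>_axis p_def ..
    also have "\<dots> = (\<Sum>j\<in>UNIV. p j * (b j)\<^sup>2 - (2 * \<mu>) * (p j * b j) + \<mu>\<^sup>2 * p j)"
      by (rule sum.cong) (auto simp: power2_eq_square algebra_simps)
    also have "\<dots> = (\<Sum>j\<in>UNIV. p j * (b j)\<^sup>2) - (2 * \<mu>) * \<mu> + \<mu>\<^sup>2 * (\<Sum>j\<in>UNIV. p j)"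
      unfolding sum.distrib sum_subtractf sum_distrib_left[symmetric] \<mu>_def[symmetric] ..
    also have "\<dots> = v" using p_sum by (simp add: v power2_eq_square)
    finally show ?thesis .
  qed
  have bZ: "AE w in ?Q. \<bar>Z i w\<bar> \<le> 2" if "i \<in> {1..\<sigma> (Suc n)}" for i
  proof (rule AE_Q[OF w0 pos])
    show "AE w in M. \<bar>Z i w\<bar> \<le> 2" using AE_unit[OF that]
    proof eventually_elim
      case (elim w)
      then obtain k where "X (Suc n) i w = axis k 1" by auto
      then have "Z i w = b k - \<mu>" unfolding Z_def by (simp only: \<Phi>_axis)
      then show ?case using b[of k] \<mu>_le by linarith
    qed
  qed
  have ind: "Q.indep_vars (\<lambda>_. borel) Z {1..\<sigma> (Suc n)}"
    unfolding Z_def by (rule Q.indep_vars_compose2[OF indep_Q[OF w0 pos]]) simp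
  note mom = Q.indep_centered_sum_moments[OF _ ind EZ bZ EZ2]
  have noise_eq: "noise b n w = (\<Sum>i=1..\<sigma> (Suc n). Z i w)" if "w \<in> atom n w0" for w
  proof -
    have w: "w \<in> space M" and th: "\<theta> n w = \<theta> n w0"
      using that adapted_on_atom[OF adapted_prop w0 that] by (auto simp: atom_def)
    have "noise b n w = (\<Sum>j\<in>UNIV. b j * (\<Sum>i=1..\<sigma> (Suc n). real (X (Suc n) i w $ j) - p j))"
      unfolding noise_def th using w by (simp add: U_Suc p_def sum_subtractf)
    also have "\<dots> = (\<Sum>i=1..\<sigma> (Suc n). Z i w)"
      unfolding sum_distrib_left Z_def \<Phi>_def by (rule sum.swap)
    finally show ?thesis .
  qed
  have Zm: "(\<lambda>w. \<Sum>i=1..\<sigma> (Suc n). Z i w) \<in> borel_measurable M"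
    unfolding Z_def by (intro borel_measurable_sum measurable_compose[OF X_measurable]) auto
  have conv: "(\<integral>w. indicator (atom n w0) w * (noise b n w)^k \<partial>M) =
      prob (atom n w0) * Q.expectation (\<lambda>w. (\<Sum>i=1..\<sigma> (Suc n). Z i w)^k)" for k
  proof -
    have "(\<integral>w. indicator (atom n w0) w * (noise b n w)^k \<partial>M) =
      (\<integral>w. indicator (atom n w0) w * (\<Sum>i=1..\<sigma> (Suc n). Z i w)^k \<partial>M)"
      by (rule Bochner_Integration.integral_cong) (auto simp: noise_eq indicator_def)
    then show ?thesis
      using integral_Q[OF w0 pos, of "\<lambda>w. (\<Sum>i=1..\<sigma> (Suc n). Z i w)^k"] Zm pos by simp
  qed
  show "(\<integral>w. indicator (atom n w0) w * noise b n w \<partial>M) = 0"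
    using conv[of 1] mom by simp
  show "(\<integral>w. indicator (atom n w0) w * (noise b n w)\<^sup>2 \<partial>M) =
      prob (atom n w0) * (real (\<sigma> (Suc n)) * spread b (\<theta> n w0))"
    using conv[of 2] mom by (simp add: v_def)
  show "(\<integral>w. indicator (atom n w0) w * (noise b n w)^4 \<partial>M) \<le> prob (atom n w0) * (48 * (real (\<sigma> (Suc n)))\<^sup>2)"
    unfolding conv[of 4] using mom by (intro mult_left_mono) auto
qed

section \<open>Moments of the noise against weights known at time \<open>n\<close>\<close>

lemma adapted_noise:
  assumes "adapted n b" shows "adapted (Suc n) (\<lambda>w. noise (b w) n w)"
proof (rule adaptedI)
  fix w w' assume w: "w \<in> space M" "w' \<in> space M" and eq: "\<And>k. k \<le> Suc n \<Longrightarrow> U k w = U k w'"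
  have "b w = b w'" "\<theta> n w = \<theta> n w'"
    using adaptedD[OF assms w] adaptedD[OF adapted_prop w, of n n] eq by auto
  then show "noise (b w) n w = noise (b w') n w'"
    using eq[of n] eq[of "Suc n"] by (simp add: noise_def)
qed

context
  fixes n :: nat and b :: "'w \<Rightarrow> 'd \<Rightarrow> real" and \<phi> :: "'w \<Rightarrow> real"
  assumes b: "adapted n b" and b1: "\<And>w j. \<bar>b w j\<bar> \<le> 1" and \<phi>: "adapted n \<phi>"
begin

lemma integrable_noise_power: "integrable M (\<lambda>w. \<phi> w * (noise (b w) n w)^k)"
  by (rule adapted_integrable[of "Suc n"], rule adapted_comp2)
    (auto intro: adapted_noise[OF b] adapted_comp[where F="\<lambda>x. x^k"] adapted_mono[OF \<phi>])

lemma integral_noise_atom: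
  assumes "w0 \<in> space M"
  shows "(\<integral>w. indicator (atom n w0) w * (\<phi> w * (noise (b w) n w)^k) \<partial>M)
    = \<phi> w0 * (\<integral>w. indicator (atom n w0) w * (noise (b w0) n w)^k \<partial>M)"
proof -
  have "(\<integral>w. indicator (atom n w0) w * (\<phi> w * (noise (b w) n w)^k) \<partial>M)
    = (\<integral>w. \<phi> w0 * (indicator (atom n w0) w * (noise (b w0) n w)^k) \<partial>M)"
    by (rule Bochner_Integration.integral_cong)
      (auto simp: indicator_def adapted_on_atom[OF b assms] adapted_on_atom[OF \<phi> assms])
  then show ?thesis by simp
qed

lemma integral_adapted_atom:
  fixes \<psi> :: "'w \<Rightarrow> real"
  assumes "w0 \<in> space M" "adapted n \<psi>"
  shows "(\<integral>w. indicator (atom n w0) w * \<psi> w \<partial>M) = \<psi> w0 * prob (atom n w0)"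
proof -
  have "(\<integral>w. indicator (atom n w0) w * \<psi> w \<partial>M) = (\<integral>w. indicator (atom n w0) w * \<psi> w0 \<partial>M)"
    by (rule Bochner_Integration.integral_cong)
      (auto simp: indicator_def adapted_on_atom[OF assms(2,1)])
  then show ?thesis by (simp add: Int_absorb2 Int_absorb1 sets.sets_into_space)
qed

text \<open>Orthogonality to every adapted weight \<phi> is the martingale property in integrated
  form. The direction \<open>b\<close> may depend on the history too, since it is constant on each
  atom.\<close>

lemma noise_mean: "(\<integral>w. \<phi> w * noise (b w) n w \<partial>M) = 0"
proof -
  note i = integrable_noise_power[of 1, simplified]
  have a: "(\<integral>w. indicator (atom n w0) w * (\<phi> w * noise (b w) n w) \<partial>M) = 0"
    if "w0 \<in> space M" "prob (atom n w0) > 0" for w0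
    using integral_noise_atom[OF that(1), of 1] noise_moments_atom(1)[OF that b1] by simp
  have "(\<integral>w. \<phi> w * noise (b w) n w \<partial>M) \<le> (\<integral>w. 0 \<partial>M)" "(\<integral>w. 0 \<partial>M) \<le> (\<integral>w. \<phi> w * noise (b w) n w \<partial>M)"
    by (rule integral_le_by_atoms[where n=n]; use i a in simp)+
  then show ?thesis by simp
qed

lemma adapted_spread: "adapted n (\<lambda>w. \<phi> w * (real (\<sigma> (Suc n)) * spread (b w) (\<theta> n w)))"
  by (intro adapted_comp2[where F="\<lambda>x y. x * (real (\<sigma> (Suc n)) * y)"] adapted_comp2[where F=spread] \<phi> b adapted_prop) simp

lemma noise_second_moment:
  "(\<integral>w. \<phi> w * (noise (b w) n w)\<^sup>2 \<partial>M) = (\<integral>w. \<phi> w * (real (\<sigma> (Suc n)) * spread (b w) (\<theta> n w)) \<partial>M)"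
proof (rule antisym; rule integral_le_by_atoms[where n=n])
  fix w0 assume w0: "w0 \<in> space M" "prob (atom n w0) > 0"
  have "(\<integral>w. indicator (atom n w0) w * (\<phi> w * (noise (b w) n w)\<^sup>2) \<partial>M) =
    (\<integral>w. indicator (atom n w0) w * (\<phi> w * (real (\<sigma> (Suc n)) * spread (b w) (\<theta> n w))) \<partial>M)"
    unfolding integral_noise_atom[OF w0(1)] noise_moments_atom(2)[OF w0 b1] integral_adapted_atom[OF w0(1) adapted_spread]
    by simp
  then show "(\<integral>w. indicator (atom n w0) w * (\<phi> w * (noise (b w) n w)\<^sup>2) \<partial>M) \<le>
    (\<integral>w. indicator (atom n w0) w * (\<phi> w * (real (\<sigma> (Suc n)) * spread (b w) (\<theta> n w))) \<partial>M)"
   "(\<integral>w. indicator (atom n w0) w * (\<phi> w * (real (\<sigma> (Suc n)) * spread (b w) (\<theta> n w))) \<partial>M) \<le>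
    (\<integral>w. indicator (atom n w0) w * (\<phi> w * (noise (b w) n w)\<^sup>2) \<partial>M)" by auto
qed (use integrable_noise_power[of 2] adapted_integrable[OF adapted_spread] in auto)

lemma noise_fourth_moment:
  assumes nn: "\<And>w. \<phi> w \<ge> 0"
  shows "(\<integral>w. \<phi> w * (noise (b w) n w)^4 \<partial>M) \<le> (\<integral>w. \<phi> w * (48 * (real (\<sigma> (Suc n)))\<^sup>2) \<partial>M)"
proof (rule integral_le_by_atoms[where n=n])
  have ad: "adapted n (\<lambda>w. \<phi> w * (48 * (real (\<sigma> (Suc n)))\<^sup>2))" by (rule adapted_comp[OF \<phi>])
  then show "integrable M (\<lambda>w. \<phi> w * (48 * (real (\<sigma> (Suc n)))\<^sup>2))" by (rule adapted_integrable)
  fix w0 assume w0: "w0 \<in> space M" "prob (atom n w0) > 0"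
  have "\<phi> w0 * (\<integral>w. indicator (atom n w0) w * (noise (b w0) n w)^4 \<partial>M)
    \<le> \<phi> w0 * (prob (atom n w0) * (48 * (real (\<sigma> (Suc n)))\<^sup>2))"
    by (intro mult_left_mono noise_moments_atom(3)[OF w0 b1] nn)
  then show "(\<integral>w. indicator (atom n w0) w * (\<phi> w * (noise (b w) n w)^4) \<partial>M) \<le>
    (\<integral>w. indicator (atom n w0) w * (\<phi> w * (48 * (real (\<sigma> (Suc n)))\<^sup>2)) \<partial>M)"
    unfolding integral_noise_atom[OF w0(1)] integral_adapted_atom[OF w0(1) ad] by (simp add: mult_ac)
qed (rule integrable_noise_power)

end

section \<open>Martingale increments\<close>

lemma tau_ge: "\<tau> n \<ge> real n"
proof (induction n)
  case (Suc n)
  then show ?case using sigma_pos[of "Suc n"] by (simp add: tau_Suc)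
qed simp

lemma tau_mono: "m \<le> n \<Longrightarrow> \<tau> m \<le> \<tau> n"
  by (induction n rule: dec_induct) (auto simp: tau_Suc simp del: of_nat_add)

text \<open>One factor \<tau>(n+1) of the denominator is replaced by the smaller \<tau>(n), and
  \<sigma>(n+1) is the difference of the two. The right side telescopes, so the variances from time
  m on add up to at most 1/\<tau>(m).\<close>

lemma sigma_div_tau_sq: "real (\<sigma> (Suc n)) / (\<tau> (Suc n))\<^sup>2 \<le> 1 / \<tau> n - 1 / \<tau> (Suc n)"
proof -
  have "real (\<sigma> (Suc n)) / (\<tau> (Suc n))\<^sup>2 \<le> real (\<sigma> (Suc n)) / (\<tau> n * \<tau> (Suc n))"
    unfolding power2_eq_square using tau_pos[of n] tau_pos[of "Suc n"] tau_mono[of n "Suc n"]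
    by (intro divide_left_mono mult_right_mono) auto
  also have "\<dots> = (\<tau> (Suc n) - \<tau> n) / (\<tau> n * \<tau> (Suc n))"
    by (simp add: tau_Suc)
  also have "\<dots> = 1 / \<tau> n - 1 / \<tau> (Suc n)"
    using tau_pos[of n] tau_pos[of "Suc n"] by (simp add: diff_divide_distrib)
  finally show ?thesis .
qed

lemma spread_le_1:
  assumes "\<And>j. x $ j \<ge> 0" "(\<Sum>j\<in>UNIV. x $ j) = (1::real)" and b: "\<And>j. \<bar>b j\<bar> \<le> 1"
  shows "spread b x \<le> 1"
proof -
  have "spread b x \<le> (\<Sum>j\<in>UNIV. draw x j * (b j)\<^sup>2)" by (simp add: spread_def)
  also have "\<dots> \<le> (\<Sum>j\<in>UNIV. draw x j)"
    using draw_sum(3)[OF assms(1,2)] b by (intro sum_mono mult_left_le) (auto simp: abs_square_le_1)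
  finally show ?thesis using draw_sum(2)[OF assms(1,2)] by simp
qed

definition incr :: "(nat \<Rightarrow> 'w \<Rightarrow> 'd \<Rightarrow> real) \<Rightarrow> nat \<Rightarrow> 'w \<Rightarrow> real" where
  "incr b n w = noise (b n w) n w / \<tau> (Suc n)"

context
  fixes b :: "nat \<Rightarrow> 'w \<Rightarrow> 'd \<Rightarrow> real"
  assumes b: "\<And>n. adapted n (b n)" and b1: "\<And>n w j. \<bar>b n w j\<bar> \<le> 1"
begin

lemma adapted_incr: "adapted (Suc n) (incr b n)"
  unfolding incr_def by (rule adapted_comp[OF adapted_noise[OF b]])

lemma adapted_partial_sum: "l \<le> k \<Longrightarrow> adapted k (\<lambda>w. \<Sum>r\<in>{m..<l}. incr b r w)"
  by (intro adapted_sum adapted_mono[OF adapted_incr]) auto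

lemma incr_borel [measurable]: "incr b n \<in> borel_measurable M"
  by (rule adapted_borel[OF adapted_incr])

lemma incr_mean: "adapted n \<phi> \<Longrightarrow> (\<integral>w. \<phi> w * incr b n w \<partial>M) = 0"
  using noise_mean[OF b b1, of n \<phi>] by (simp add: incr_def)

lemma incr_second_moment:
  assumes \<phi>: "adapted n \<phi>" and nn: "\<And>w. \<phi> w \<ge> 0"
  shows "(\<integral>w. \<phi> w * (incr b n w)\<^sup>2 \<partial>M) \<le> (\<integral>w. \<phi> w \<partial>M) * (1 / \<tau> n - 1 / \<tau> (Suc n))"
proof -
  have "(\<integral>w. \<phi> w * (incr b n w)\<^sup>2 \<partial>M) = (\<integral>w. \<phi> w * (noise (b n w) n w)\<^sup>2 \<partial>M) / (\<tau> (Suc n))\<^sup>2"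
    by (simp add: incr_def power_divide)
  also have "(\<integral>w. \<phi> w * (noise (b n w) n w)\<^sup>2 \<partial>M) =
      (\<integral>w. \<phi> w * (real (\<sigma> (Suc n)) * spread (b n w) (\<theta> n w)) \<partial>M)"
    by (rule noise_second_moment[OF b b1 \<phi>])
  also have "\<dots> \<le> (\<integral>w. \<phi> w * real (\<sigma> (Suc n)) \<partial>M)"
  proof (rule integral_mono_AE)
    show "integrable M (\<lambda>w. \<phi> w * real (\<sigma> (Suc n)))" using adapted_integrable[OF \<phi>] by simp
    show "integrable M (\<lambda>w. \<phi> w * (real (\<sigma> (Suc n)) * spread (b n w) (\<theta> n w)))"
      by (rule adapted_integrable[OF adapted_spread[OF b b1 \<phi>]])
    show "AE w in M. \<phi> w * (real (\<sigma> (Suc n)) * spread (b n w) (\<theta> n w)) \<le> \<phi> w * real (\<sigma> (Suc n))"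
      using AE_simplex
    proof eventually_elim
      case (elim w)
      have "spread (b n w) (\<theta> n w) \<le> 1" using elim b1 by (intro spread_le_1) auto
      then show ?case using nn by (intro mult_left_mono mult_left_le) auto
    qed
  qed
  also have "\<dots> / (\<tau> (Suc n))\<^sup>2 = (\<integral>w. \<phi> w \<partial>M) * (real (\<sigma> (Suc n)) / (\<tau> (Suc n))\<^sup>2)"
    by simp
  also have "\<dots> \<le> (\<integral>w. \<phi> w \<partial>M) * (1 / \<tau> n - 1 / \<tau> (Suc n))"
    using nn by (intro mult_left_mono sigma_div_tau_sq) auto
  finally show ?thesis by (simp add: divide_right_mono)
qed

text \<open>A martingale transform with coefficients known in advance: cross terms vanish by
  \<open>incr_mean\<close>, and the bounds on the squares telescope. Keeping the factor
  \<open>prob A\<close> makes the estimate usable conditionally on \<open>A\<close>.\<close>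

lemma stopped_second_moment:
  assumes \<xi>: "\<And>r. m \<le> r \<Longrightarrow> adapted r (\<xi> r)" and \<xi>_le: "\<And>r w. \<bar>\<xi> r w\<bar> \<le> indicator A w"
    and A: "A \<in> events" and "m \<le> N"
  shows "(\<integral>w. (\<Sum>r\<in>{m..<N}. \<xi> r w * incr b r w)\<^sup>2 \<partial>M) \<le> prob A * (1 / \<tau> m - 1 / \<tau> N)"
  using \<open>m \<le> N\<close>
proof (induction N rule: dec_induct)
  case (step N)
  define S where "S w = (\<Sum>r\<in>{m..<N}. \<xi> r w * incr b r w)" for w
  have S: "adapted N S" unfolding S_def
    by (intro adapted_sum adapted_comp2[where F="(*)"]) (auto intro: adapted_mono[OF \<xi>] adapted_mono[OF adapted_incr])
  have \<xi>N: "adapted N (\<xi> N)" using \<xi> step by auto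
  have S\<xi>: "adapted N (\<lambda>w. 2 * S w * \<xi> N w)"
    by (rule adapted_comp2[OF S \<xi>N, of "\<lambda>x y. 2 * x * y"])
  have \<xi>2: "adapted N (\<lambda>w. (\<xi> N w)\<^sup>2)" by (rule adapted_comp[OF \<xi>N])
  have i1: "integrable M (\<lambda>w. (S w)\<^sup>2)" by (rule adapted_integrable, rule adapted_comp, rule S)
  have i2: "integrable M (\<lambda>w. 2 * S w * \<xi> N w * incr b N w)"
    by (rule adapted_integrable[of "Suc N"], rule adapted_comp2[where F="(*)"])
      (auto intro: adapted_mono[OF S\<xi>] adapted_incr)
  have i3: "integrable M (\<lambda>w. (\<xi> N w)\<^sup>2 * (incr b N w)\<^sup>2)"
    by (rule adapted_integrable[of "Suc N"], rule adapted_comp2[where F="\<lambda>x y. x\<^sup>2 * y\<^sup>2"])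
      (auto intro: adapted_mono[OF \<xi>N] adapted_incr)
  have "(\<integral>w. (\<Sum>r\<in>{m..<Suc N}. \<xi> r w * incr b r w)\<^sup>2 \<partial>M)
    = (\<integral>w. (S w)\<^sup>2 + 2 * S w * \<xi> N w * incr b N w + (\<xi> N w)\<^sup>2 * (incr b N w)\<^sup>2 \<partial>M)"
    using step(1) by (simp add: S_def[symmetric] power2_sum power_mult_distrib algebra_simps)
  also have "\<dots> = (\<integral>w. (S w)\<^sup>2 \<partial>M) + (\<integral>w. 2 * S w * \<xi> N w * incr b N w \<partial>M)
      + (\<integral>w. (\<xi> N w)\<^sup>2 * (incr b N w)\<^sup>2 \<partial>M)"
    using i1 i2 i3 by (simp del: integral_mult_right_zero integral_mult_left_zero)
  also have "(\<integral>w. 2 * S w * \<xi> N w * incr b N w \<partial>M) = 0"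
    by (rule incr_mean[OF S\<xi>])
  also have "(\<integral>w. (\<xi> N w)\<^sup>2 * (incr b N w)\<^sup>2 \<partial>M) \<le> (\<integral>w. (\<xi> N w)\<^sup>2 \<partial>M) * (1 / \<tau> N - 1 / \<tau> (Suc N))"
    by (rule incr_second_moment[OF \<xi>2]) simp
  also have "\<dots> \<le> prob A * (1 / \<tau> N - 1 / \<tau> (Suc N))"
  proof (rule mult_right_mono)
    have "(\<xi> N w)\<^sup>2 \<le> indicator A w" for w
      using \<xi>_le[of N w] by (auto simp: indicator_def abs_square_le_1 split: if_splits)
    then have "(\<integral>w. (\<xi> N w)\<^sup>2 \<partial>M) \<le> (\<integral>w. indicator A w \<partial>M)"
      using adapted_integrable[OF \<xi>2] integrable_event_indicator[OF A] by (intro integral_mono) auto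
    also have "\<dots> = prob A" using A by (simp add: Int_absorb2 Int_absorb1 sets.sets_into_space)
    finally show "(\<integral>w. (\<xi> N w)\<^sup>2 \<partial>M) \<le> prob A" .
    show "0 \<le> 1 / \<tau> N - 1 / \<tau> (Suc N)"
      using tau_pos[of N] tau_mono[of N "Suc N"] by (simp add: frac_le)
  qed
  finally show ?case using step.IH by (simp add: S_def algebra_simps)
qed simp

text \<open>Kolmogorov's inequality. On the event in question, the sum stopped when it first reaches
  \<open>a\<close> still has size at least \<open>a\<close> at time \<open>N\<close>, and
  Chebyshev's inequality applies to this single variable.\<close>

lemma maximal_inequality_finite:
  assumes A: "A \<in> sets (history M U m)" and a: "a > 0"
  shows "prob {w \<in> A. \<exists>l\<in>{m..N}. \<bar>\<Sum>r\<in>{m..<l}. incr b r w\<bar> \<ge> a} \<le> prob A / (a\<^sup>2 * \<tau> m)"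
proof (cases "m \<le> N")
  case True
  define S where "S l w = (\<Sum>r\<in>{m..<l}. incr b r w)" for l w
  \<comment> \<open>The coefficient of increment \<open>r\<close> looks at partial sums up to
    \<open>S r\<close>, which involve only increments before \<open>r\<close>. So it is adapted, and
    the increment that causes the first exceedance is still counted.\<close>
  define \<xi> :: "nat \<Rightarrow> 'w \<Rightarrow> real" where
    "\<xi> r w = (if w \<in> A \<and> (\<forall>l. m \<le> l \<and> l \<le> r \<longrightarrow> \<bar>S l w\<bar> < a) then 1 else 0)" for r w
  define Y where "Y w = (\<Sum>r\<in>{m..<N}. \<xi> r w * incr b r w)" for w
  define E where "E = {w \<in> A. \<exists>l\<in>{m..N}. \<bar>S l w\<bar> \<ge> a}"
  have Aev: "A \<in> events" and Aad: "adapted m (\<lambda>w. w \<in> A)"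
    using A history_event by (auto simp: sets_history)
  have [measurable]: "A \<in> events" "S l \<in> borel_measurable M" for l
    using Aev unfolding S_def by auto
  have \<xi>_ad: "adapted r (\<xi> r)" if "m \<le> r" for r
  proof -
    have "adapted r (\<lambda>w. m \<le> l \<and> l \<le> r \<longrightarrow> \<bar>S l w\<bar> < a)" for l
      by (cases "l \<le> r") (auto simp: S_def intro: adapted_comp[OF adapted_partial_sum])
    from adapted_comp2[OF adapted_mono[OF Aad that] adapted_All[OF this],
        of "\<lambda>x y. if x \<and> y then 1 else 0 :: real"]
    show ?thesis by (simp add: \<xi>_def[abs_def])
  qed
  have "adapted N Y" unfolding Y_def
    by (intro adapted_sum adapted_comp2[where F="(*)"]) (auto intro: adapted_mono[OF \<xi>_ad] adapted_mono[OF adapted_incr])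
  then have intY: "integrable M (\<lambda>w. (Y w)\<^sup>2)" by (rule adapted_integrable[OF adapted_comp[where F="\<lambda>x. x\<^sup>2"]])
  have YE: "\<bar>Y w\<bar> \<ge> a" if "w \<in> E" for w
  proof -
    from that obtain l0 where "l0 \<in> {m..N} \<and> \<bar>S l0 w\<bar> \<ge> a" and wA: "w \<in> A" by (auto simp: E_def)
    define l where "l = (LEAST l. l \<in> {m..N} \<and> \<bar>S l w\<bar> \<ge> a)"
    have l: "l \<in> {m..N}" "\<bar>S l w\<bar> \<ge> a"
      using LeastI[of "\<lambda>l. l \<in> {m..N} \<and> \<bar>S l w\<bar> \<ge> a", OF \<open>l0 \<in> {m..N} \<and> \<bar>S l0 w\<bar> \<ge> a\<close>] by (auto simp: l_def)
    have less: "\<bar>S k w\<bar> < a" if "m \<le> k" "k < l" for k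
      using not_less_Least[of k "\<lambda>l. l \<in> {m..N} \<and> \<bar>S l w\<bar> \<ge> a"] that l by (auto simp: l_def)
    have "Y w = (\<Sum>r\<in>{m..<N}. if r < l then incr b r w else 0)"
      unfolding Y_def
    proof (rule sum.cong)
      fix r assume r: "r \<in> {m..<N}"
      show "\<xi> r w * incr b r w = (if r < l then incr b r w else 0)"
      proof (cases "r < l")
        case True
        then show ?thesis using wA less by (auto simp: \<xi>_def)
      next
        case False
        then have "\<not> (\<forall>k. m \<le> k \<and> k \<le> r \<longrightarrow> \<bar>S k w\<bar> < a)" using l by force
        then have "\<xi> r w = 0" by (simp add: \<xi>_def del: not_all)
        with False show ?thesis by simp
      qed
    qed simp
    also have "\<dots> = S l w"
      unfolding S_def using l by (intro sum.mono_neutral_cong_right) auto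
    finally show ?thesis using l by simp
  qed
  have Eev: "E \<in> events" unfolding E_def using sets.sets_into_space[OF Aev] by measurable
  have "prob E = (\<integral>w. indicator E w \<partial>M)" using Eev by (simp add: Int_absorb2 Int_absorb1 sets.sets_into_space)
  also have "\<dots> \<le> (\<integral>w. (Y w)\<^sup>2 / a\<^sup>2 \<partial>M)"
  proof (rule integral_mono)
    fix w show "indicator E w \<le> (Y w)\<^sup>2 / a\<^sup>2"
      using YE[of w] a abs_le_square_iff[of a "Y w"] by (auto simp: indicator_def)
  qed (use intY integrable_event_indicator[OF Eev] in auto)
  also have "\<dots> = (\<integral>w. (Y w)\<^sup>2 \<partial>M) / a\<^sup>2" by simp
  also have "\<dots> \<le> (prob A * (1 / \<tau> m - 1 / \<tau> N)) / a\<^sup>2"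
    unfolding Y_def
    by (intro divide_right_mono stopped_second_moment[OF \<xi>_ad _ Aev True]) (auto simp: \<xi>_def indicator_def)
  also have "\<dots> \<le> (prob A * (1 / \<tau> m)) / a\<^sup>2"
    using tau_pos[of N] by (intro divide_right_mono mult_left_mono) auto
  finally show ?thesis by (simp add: E_def S_def mult.commute)
next
  case False
  then show ?thesis using tau_pos[of m] by simp
qed

lemma maximal_inequality:
  assumes A: "A \<in> sets (history M U m)" and a: "a > 0"
  shows "prob {w \<in> A. \<exists>l\<ge>m. \<bar>\<Sum>r\<in>{m..<l}. incr b r w\<bar> \<ge> a} \<le> prob A / (a\<^sup>2 * \<tau> m)"
proof -
  define E where "E N = {w \<in> A. \<exists>l\<in>{m..N}. \<bar>\<Sum>r\<in>{m..<l}. incr b r w\<bar> \<ge> a}" for N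
  have Aev [measurable]: "A \<in> events" using A by (rule history_event)
  have "E N \<in> events" for N unfolding E_def using sets.sets_into_space[OF Aev] by measurable
  moreover have "incseq E" by (auto simp: incseq_def E_def)
  ultimately have "(\<lambda>N. prob (E N)) \<longlonglongrightarrow> prob (\<Union>N. E N)"
    by (intro finite_Lim_measure_incseq) auto
  then have "prob (\<Union>N. E N) \<le> prob A / (a\<^sup>2 * \<tau> m)"
    by (rule LIMSEQ_le_const2) (use maximal_inequality_finite[OF assms] in \<open>auto simp: E_def\<close>)
  also have "(\<Union>N. E N) = {w \<in> A. \<exists>l\<ge>m. \<bar>\<Sum>r\<in>{m..<l}. incr b r w\<bar> \<ge> a}"
    unfolding E_def by (auto; metis atLeastAtMost_iff order_refl)
  finally show ?thesis .
qed

text \<open>By the maximal inequality, the chance that the sums started at m ever deviate by e is at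
  most 1 / (e^2 \<tau>(m)), and \<tau>(m) \<ge> m makes this tend to 0. Letting e run through
  1/(k+1) yields the Cauchy property.\<close>

lemma AE_summable_incr: "AE w in M. summable (\<lambda>n. incr b n w)"
proof -
  have null: "AE w in M. \<exists>m. \<forall>l\<ge>m. \<bar>\<Sum>r\<in>{m..<l}. incr b r w\<bar> < e" if e: "e > 0" for e :: real
  proof -
    define B where "B = {w \<in> space M. \<forall>m. \<exists>l\<ge>m. \<bar>\<Sum>r\<in>{m..<l}. incr b r w\<bar> \<ge> e}"
    have B: "B \<in> events" unfolding B_def by measurable
    have le: "prob B * (e\<^sup>2 * real m) \<le> 1" for m
    proof -
      have "prob B \<le> prob {w \<in> space M. \<exists>l\<ge>m. \<bar>\<Sum>r\<in>{m..<l}. incr b r w\<bar> \<ge> e}"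
        by (rule finite_measure_mono) (auto simp: B_def)
      also have "\<dots> \<le> 1 / (e\<^sup>2 * \<tau> m)"
        using maximal_inequality[OF sets.top e, of m] by (simp add: prob_space)
      finally have "prob B * (e\<^sup>2 * \<tau> m) \<le> 1"
        using e tau_pos[of m] by (simp add: pos_le_divide_eq)
      moreover have "prob B * (e\<^sup>2 * real m) \<le> prob B * (e\<^sup>2 * \<tau> m)"
        by (intro mult_left_mono tau_ge) auto
      ultimately show ?thesis by linarith
    qed
    have "prob B = 0"
    proof (rule ccontr)
      assume "prob B \<noteq> 0"
      then have "prob B * e\<^sup>2 > 0" using e by (simp add: zero_less_measure_iff)
      then obtain m :: nat where "1 < real m * (prob B * e\<^sup>2)" using reals_Archimedean3 by blast
      with le[of m] show False by (simp add: mult_ac)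
    qed
    then have "AE w in M. w \<notin> B" using prob_eq_0[OF B] by blast
    with AE_space show ?thesis by eventually_elim (fastforce simp: B_def)
  qed
  have "AE w in M. \<forall>k. \<exists>m. \<forall>l\<ge>m. \<bar>\<Sum>r\<in>{m..<l}. incr b r w\<bar> < inverse (real (Suc k))"
    by (subst AE_all_countable) (auto intro: null)
  then show ?thesis
  proof eventually_elim
    case (elim w)
    show ?case unfolding summable_Cauchy
    proof (intro allI impI)
      fix e :: real assume "e > 0"
      then obtain k where k: "inverse (real (Suc k)) < e / 2" using reals_Archimedean[of "e/2"] by auto
      from elim obtain m where m: "\<And>l. l \<ge> m \<Longrightarrow> \<bar>\<Sum>r\<in>{m..<l}. incr b r w\<bar> < inverse (real (Suc k))" by blast
      have "norm (sum (\<lambda>n. incr b n w) {m'..<l}) < e" if "m' \<ge> m" for m' l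
      proof (cases "m' \<le> l")
        case True
        have "sum (\<lambda>n. incr b n w) {m'..<l} = sum (\<lambda>n. incr b n w) {m..<l} - sum (\<lambda>n. incr b n w) {m..<m'}"
          using sum.atLeastLessThan_concat[OF that True, of "\<lambda>n. incr b n w"] by simp
        then show ?thesis using m[of l] m[of m'] that True k by simp
      qed (use \<open>e > 0\<close> in simp)
      then show "\<exists>N. \<forall>m\<ge>N. \<forall>n. norm (sum (\<lambda>n. incr b n w) {m..<n}) < e" by blast
    qed
  qed
qed

end

end

section \<open>No convergence to a tie\<close>

locale time_dependent_urn = reinforced_urn M f \<sigma> u0 U X
  for M :: "'w measure" and f :: "real \<Rightarrow> real" and \<sigma> :: "nat \<Rightarrow> nat" and u0 :: "nat ^ 'd"
    and U :: "nat \<Rightarrow> 'w \<Rightarrow> nat ^ 'd" and X :: "nat \<Rightarrow> nat \<Rightarrow> 'w \<Rightarrow> nat ^ 'd" +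
  assumes step_divergent: "filterlim (\<lambda>N. \<Sum>n=1..N. real (\<sigma> n) / real (urn_total u0 \<sigma> n)) at_top sequentially"
    and step_square_summable: "summable (\<lambda>n. (real (\<sigma> (Suc n)) / real (urn_total u0 \<sigma> (Suc n)))\<^sup>2)"
begin

section \<open>Step sizes and the recursion for the proportions\<close>

abbreviation \<gamma> :: "nat \<Rightarrow> real" where
  "\<gamma> n \<equiv> real (\<sigma> (Suc n)) / \<tau> (Suc n)"

lemma gamma_bounds: "0 \<le> \<gamma> n" "\<gamma> n \<le> 1"
  using tau_pos[of n] tau_pos[of "Suc n"] tau_Suc[of n] by (auto simp: divide_le_eq_1)

lemma gamma_LIMSEQ: "\<gamma> \<longlonglongrightarrow> 0"
  using summable_LIMSEQ_zero[OF step_square_summable] by (simp add: power_tendsto_0_iff)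

lemma gamma_sum_unbounded:
  obtains N where "m \<le> N" "(\<Sum>r\<in>{m..<N}. \<gamma> r) > K"
proof -
  have "\<forall>\<^sub>F N in sequentially. (\<Sum>n=1..N. real (\<sigma> n) / \<tau> n) > K + (\<Sum>r<m. \<gamma> r)"
    using step_divergent unfolding filterlim_at_top_dense by blast
  with eventually_ge_at_top[of m] obtain N where N: "m \<le> N" "(\<Sum>n=1..N. real (\<sigma> n) / \<tau> n) > K + (\<Sum>r<m. \<gamma> r)"
    by (metis (no_types, lifting) eventually_conj eventually_sequentially order_refl)
  have "(\<Sum>n=1..N. real (\<sigma> n) / \<tau> n) = (\<Sum>r<N. \<gamma> r)"
    by (simp add: sum.atLeast1_atMost_eq)
  also have "\<dots> = (\<Sum>r<m. \<gamma> r) + (\<Sum>r\<in>{m..<N}. \<gamma> r)"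
    using sum.atLeastLessThan_concat[of 0 m N \<gamma>] N(1) by (simp add: atLeast0LessThan)
  finally show thesis using N that by simp
qed

text \<open>Purely algebraic and valid for every outcome, on or off the simplex: counts are
  rewritten as totals times proportions, with \<tau>(n) = \<tau>(n+1) - \<sigma>(n+1).\<close>

lemma prop_step:
  "(\<Sum>k\<in>UNIV. b k * \<theta> (Suc n) w $ k) = (\<Sum>k\<in>UNIV. b k * \<theta> n w $ k)
     + \<gamma> n * (\<Sum>k\<in>UNIV. b k * (draw (\<theta> n w) k - \<theta> n w $ k)) + noise b n w / \<tau> (Suc n)"
proof -
  have "b k * \<theta> (Suc n) w $ k = b k * \<theta> n w $ k + \<gamma> n * (b k * (draw (\<theta> n w) k - \<theta> n w $ k))
     + b k * (real (U (Suc n) w $ k) - real (U n w $ k) - real (\<sigma> (Suc n)) * draw (\<theta> n w) k) / \<tau> (Suc n)" for k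
  proof -
    have step: "c * y = c * x + s / T * (c * (p - x)) + c * (T * y - (T - s) * x - s * p) / T"
      if "T > 0" for c x y s T p :: real
      using that by (simp add: field_simps)
    have "real (U n w $ k) = (\<tau> (Suc n) - real (\<sigma> (Suc n))) * \<theta> n w $ k"
      using tau_pos[of n] by (simp add: urn_prop_def tau_Suc)
    moreover have "real (U (Suc n) w $ k) = \<tau> (Suc n) * \<theta> (Suc n) w $ k"
      using tau_pos[of "Suc n"] by (simp add: urn_prop_def)
    ultimately show ?thesis using step[OF tau_pos[of "Suc n"]] by (simp only:)
  qed
  then show ?thesis by (simp add: sum.distrib noise_def sum_distrib_left sum_divide_distrib)
qed

text \<open>With \<open>x\<^sub>i - x\<^sub>j\<close> as the gap: its drift points away from 0, the variance of a single draw in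
  direction \<open>e\<^sub>i - e\<^sub>j\<close> is bounded below, and the drift is at most linear in the gap.\<close>

definition repelling :: "'d \<Rightarrow> 'd \<Rightarrow> real \<Rightarrow> real ^ 'd \<Rightarrow> bool" where
  "repelling i j K x \<longleftrightarrow>
     (draw x i - draw x j - (x $ i - x $ j)) * (x $ i - x $ j) \<ge> 0 \<and>
     draw x i + draw x j - (draw x i - draw x j)\<^sup>2 \<ge> 1 / K \<and>
     \<bar>draw x i - draw x j\<bar> \<le> K * \<bar>x $ i - x $ j\<bar>"

section \<open>Excluding a tie between two given colours\<close>

context
  fixes i j :: 'd and K :: real and n0 :: nat
  assumes ij: "i \<noteq> j" and K: "K > 0" and n0: "\<And>n. n \<ge> n0 \<Longrightarrow> \<tau> (Suc n) \<le> 2 * \<tau> n"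
begin

definition gap :: "nat \<Rightarrow> 'w \<Rightarrow> real" where
  "gap n w = \<theta> n w $ i - \<theta> n w $ j"

definition pair :: "nat \<Rightarrow> 'w \<Rightarrow> 'd \<Rightarrow> real" where
  "pair n w k = (if k = i then 1 else if k = j then -1 else 0)"

definition drift :: "nat \<Rightarrow> 'w \<Rightarrow> real" where
  "drift n w = \<gamma> n * (draw (\<theta> n w) i - draw (\<theta> n w) j - gap n w)"

text \<open>The repelling property is included so that the drift is outward from \<open>n0\<close>
  on along every path of the event.\<close>

definition tied :: "'w set" where
  "tied = {w \<in> space M. (\<forall>l\<ge>n0. repelling i j K (\<theta> l w)) \<and> (\<lambda>l. gap l w) \<longlonglongrightarrow> 0}"

text \<open>At a live time the gap is still too small for the escape argument. Repulsion is included
  so that it can be used before an exit; losing it also ends the live period, but this cannot happen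
  on \<open>tied\<close> after \<open>n0\<close>.\<close>

definition live :: "nat \<Rightarrow> 'w \<Rightarrow> bool" where
  "live l w \<longleftrightarrow> repelling i j K (\<theta> l w) \<and> \<tau> l * (gap l w)\<^sup>2 < 8"

lemma adapted_pair: "adapted n (pair n)"
  by (simp add: adapted_def pair_def[abs_def])

lemma pair_le_1: "\<bar>pair n w k\<bar> \<le> 1"
  by (simp add: pair_def)

lemma pair_sum: "(\<Sum>k\<in>UNIV. pair n w k * g k) = g i - g j"
proof -
  have "(\<Sum>k\<in>UNIV. pair n w k * g k) = (\<Sum>k\<in>UNIV. (if k = i then g k else 0) - (if k = j then g k else 0))"
    by (rule sum.cong) (use ij in \<open>auto simp: pair_def\<close>)
  then show ?thesis by (simp add: sum_subtractf)
qed

lemma gap_Suc: "gap (Suc n) w = gap n w + drift n w + incr pair n w"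
  using prop_step[of "pair n w" n w] unfolding pair_sum by (simp add: gap_def drift_def incr_def algebra_simps)

lemma spread_pair: "spread (pair n w) x = draw x i + draw x j - (draw x i - draw x j)\<^sup>2"
proof -
  have "(\<Sum>k\<in>UNIV. draw x k * (pair n w k)\<^sup>2) = (\<Sum>k\<in>UNIV. (if k = i then draw x k else 0) + (if k = j then draw x k else 0))"
    by (rule sum.cong) (use ij in \<open>auto simp: pair_def\<close>)
  moreover have "(\<Sum>k\<in>UNIV. draw x k * pair n w k) = draw x i - draw x j"
    using pair_sum[of n w "draw x"] by (simp add: mult.commute)
  ultimately show ?thesis by (simp add: spread_def sum.distrib)
qed

lemma adapted_gap: "k \<le> n \<Longrightarrow> adapted n (gap k)"
  unfolding gap_def[abs_def] by (rule adapted_comp[OF adapted_prop])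

lemma adapted_drift: "k \<le> n \<Longrightarrow> adapted n (drift k)"
  unfolding drift_def[abs_def]
  by (rule adapted_comp2[OF adapted_prop adapted_gap, of k n k "\<lambda>x y. \<gamma> k * (draw x i - draw x j - y)"])

lemma adapted_repelling: "k \<le> n \<Longrightarrow> adapted n (\<lambda>w. repelling i j K (\<theta> k w))"
  by (rule adapted_comp[OF adapted_prop])

lemma adapted_live: "k \<le> n \<Longrightarrow> adapted n (live k)"
  unfolding live_def[abs_def] by (rule adapted_comp2[OF adapted_prop adapted_gap])

lemma drift_outward: "repelling i j K (\<theta> n w) \<Longrightarrow> drift n w * gap n w \<ge> 0"
  using gamma_bounds[of n] by (simp add: drift_def repelling_def gap_def mult.assoc)

text \<open>Countable quantifiers, supplied for the limit by \<open>LIMSEQ_iff_Suc\<close>, range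
  over conditions that each depend on a finite history. This places the event within the reach of
  \<open>sigma_sets_approx\<close>.\<close>

lemma tied_tail:
  "tied \<in> sigma_sets (space M) (\<Union>n. sets (history M U n))"
proof -
  let ?G = "sigma (space M) (\<Union>n. sets (history M U n))"
  have sub: "(\<Union>n. sets (history M U n)) \<subseteq> Pow (space M)" by (auto simp: sets_history)
  have spG[simp]: "space ?G = space M" using sub by (rule space_measure_of)
  have ev: "Measurable.pred ?G P" if "adapted n P" for P n
    using adapted_event[OF that] sub by (auto simp: pred_def intro!: sigma_sets.Basic)
  have [measurable]: "Measurable.pred ?G (\<lambda>w. repelling i j K (\<theta> l w))"
    "Measurable.pred ?G (\<lambda>w. dist (gap l w) 0 < inverse (real (Suc k)))" for l k
    by (rule ev[OF adapted_repelling[OF order_refl]], rule ev[OF adapted_comp[OF adapted_gap[OF order_refl]]])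
  have "tied = {w \<in> space ?G. (\<forall>l\<ge>n0. repelling i j K (\<theta> l w)) \<and>
      (\<forall>k. \<exists>N. \<forall>n\<ge>N. dist (gap n w) 0 < inverse (real (Suc k)))}"
    unfolding tied_def LIMSEQ_iff_Suc spG ..
  also have "\<dots> \<in> sets ?G" by measurable
  finally show ?thesis using sub by simp
qed

lemma tied_event [measurable]: "tied \<in> events"
proof -
  have "sigma_sets (space M) (\<Union>n. sets (history M U n)) \<subseteq> events"
    using history_event by (intro sets.sigma_sets_subset) blast
  then show ?thesis using tied_tail by blast
qed

text \<open>On \<open>tied\<close> the drift is outward from \<open>m\<close> on, so the gap can
  return to 0 only if the accumulated noise reaches \<open>a\<close> at some time.\<close>

lemma tied_prob_if_separated:
  assumes A: "A \<in> sets (history M U m)" and m: "m \<ge> n0" and sep: "\<And>w. w \<in> A \<Longrightarrow> \<tau> m * (gap m w)\<^sup>2 \<ge> 8"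
  shows "prob (A \<inter> tied) \<le> prob A / 2"
proof -
  \<comment> \<open>This choice gives 1 / (a^2 \<tau>(m)) = 1/2 in the maximal inequality, while 2 a
    = sqrt (8 / \<tau>(m)) is the gap guaranteed by \<open>sep\<close>. Here the number 8
    originates.\<close>
  define a where "a = sqrt (2 / \<tau> m)"
  have a: "a > 0" "a\<^sup>2 = 2 / \<tau> m" using tau_pos[of m] by (auto simp: a_def)
  have "A \<in> events" using A by (rule history_event)
  have "A \<inter> tied \<subseteq> {w \<in> A. \<exists>l\<ge>m. \<bar>\<Sum>r\<in>{m..<l}. incr pair r w\<bar> \<ge> a}"
  proof (rule ccontr)
    assume "\<not> ?thesis"
    then obtain w where w: "w \<in> A" "w \<in> tied" "\<And>l. l \<ge> m \<Longrightarrow> \<bar>\<Sum>r\<in>{m..<l}. incr pair r w\<bar> < a"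
      by (force simp: not_le)
    have "8 / \<tau> m \<le> (gap m w)\<^sup>2"
      using sep[OF w(1)] tau_pos[of m] by (simp add: pos_divide_le_eq mult.commute)
    then have "(2 * a)\<^sup>2 \<le> (gap m w)\<^sup>2" by (simp add: power_mult_distrib a(2))
    then have start: "\<bar>gap m w\<bar> \<ge> 2 * a" using a(1) by (metis abs_le_square_iff abs_of_nonneg less_imp_le mult_nonneg_nonneg zero_le_numeral)
    have "\<bar>gap l w\<bar> \<ge> a" if "l \<ge> m" for l
    proof (rule outward_drift_persists[where m=m and g="\<lambda>l. gap l w" and d="\<lambda>l. drift l w" and \<nu>="\<lambda>l. incr pair l w"])
      show "drift l w * gap l w \<ge> 0" if "l \<ge> m" for l
        using w(2) m that by (intro drift_outward) (auto simp: tied_def)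
    qed (rule gap_Suc w(3) start that | assumption)+
    moreover have "\<forall>\<^sub>F l in sequentially. \<bar>gap l w\<bar> < a"
      using w(2) a(1) tendstoD[of "\<lambda>l. gap l w" 0 sequentially a] by (auto simp: tied_def)
    ultimately show False
      by (metis (mono_tags, lifting) eventually_sequentially linorder_not_le nle_le)
  qed
  moreover have "{w \<in> A. \<exists>l\<ge>m. \<bar>\<Sum>r\<in>{m..<l}. incr pair r w\<bar> \<ge> a} \<in> events"
  proof -
    have [measurable]: "incr pair r \<in> borel_measurable M" for r by (rule incr_borel[OF adapted_pair pair_le_1])
    have [measurable]: "A \<in> events" by fact
    have "{w \<in> A. \<exists>l\<ge>m. \<bar>\<Sum>r\<in>{m..<l}. incr pair r w\<bar> \<ge> a} =
        {w \<in> space M. w \<in> A \<and> (\<exists>l\<ge>m. \<bar>\<Sum>r\<in>{m..<l}. incr pair r w\<bar> \<ge> a)}"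
      using sets.sets_into_space[OF \<open>A \<in> events\<close>] by auto
    also have "\<dots> \<in> events" by measurable
    finally show ?thesis .
  qed
  ultimately have "prob (A \<inter> tied) \<le> prob {w \<in> A. \<exists>l\<ge>m. \<bar>\<Sum>r\<in>{m..<l}. incr pair r w\<bar> \<ge> a}"
    by (rule finite_measure_mono)
  also have "\<dots> \<le> prob A / (a\<^sup>2 * \<tau> m)"
    by (rule maximal_inequality[OF adapted_pair pair_le_1 A a(1)])
  also have "\<dots> = prob A / 2" using a(2) tau_pos[of m] by simp
  finally show ?thesis .
qed

text \<open>One step after a live time the normalised squared gap may exceed 8. Its deterministic
  part \<open>h\<close> is at most 2 + K times the old gap and \<tau> at most doubles, which gives
  16 (2 + K)^2; the inequality (h + z)^2 \<le> 2 h^2 + 2 z^2 doubles this. The noise part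
  \<open>2 * y\<close> is traded for \<open>1 + y\<^sup>2\<close>, because the mean of
  \<open>y\<close> is only of order \<gamma> and that of its square is of order \<gamma>^2.\<close>

lemma live_exit_bound:
  assumes "r \<ge> n0" "live r w"
  shows "\<tau> (Suc r) * (gap (Suc r) w)\<^sup>2 \<le> 32 * (2 + K)\<^sup>2 + 1 + (\<tau> (Suc r) * (incr pair r w)\<^sup>2)\<^sup>2"
proof -
  define h where "h = gap r w + drift r w"
  define y where "y = \<tau> (Suc r) * (incr pair r w)\<^sup>2"
  have rep: "repelling i j K (\<theta> r w)" and lt: "\<tau> r * (gap r w)\<^sup>2 < 8" using assms by (auto simp: live_def)
  have "\<bar>drift r w\<bar> \<le> 1 * \<bar>draw (\<theta> r w) i - draw (\<theta> r w) j - gap r w\<bar>"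
    unfolding drift_def abs_mult using gamma_bounds[of r] by (intro mult_right_mono) auto
  also have "\<dots> \<le> K * \<bar>gap r w\<bar> + \<bar>gap r w\<bar>" using rep by (auto simp: repelling_def gap_def)
  finally have "\<bar>h\<bar> \<le> (2 + K) * \<bar>gap r w\<bar>" by (auto simp: h_def algebra_simps)
  then have "h\<^sup>2 \<le> ((2 + K) * \<bar>gap r w\<bar>)\<^sup>2" by (metis abs_ge_zero power2_abs power_mono)
  then have "\<tau> (Suc r) * h\<^sup>2 \<le> (2 * \<tau> r) * ((2 + K) * \<bar>gap r w\<bar>)\<^sup>2"
    using n0[OF assms(1)] tau_pos[of r] by (intro mult_mono) auto
  also have "\<dots> = 2 * (2 + K)\<^sup>2 * (\<tau> r * (gap r w)\<^sup>2)" by (simp add: power_mult_distrib)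
  also have "\<dots> \<le> 2 * (2 + K)\<^sup>2 * 8" using lt by (intro mult_left_mono) auto
  finally have h: "\<tau> (Suc r) * h\<^sup>2 \<le> 16 * (2 + K)\<^sup>2" by simp
  have sq: "(h + z)\<^sup>2 \<le> 2 * h\<^sup>2 + 2 * z\<^sup>2" for z
    using zero_le_power2[of "h - z"] by (simp add: power2_sum power2_diff)
  have "\<tau> (Suc r) * (gap (Suc r) w)\<^sup>2 \<le> \<tau> (Suc r) * (2 * h\<^sup>2 + 2 * (incr pair r w)\<^sup>2)"
    unfolding gap_Suc h_def[symmetric] using tau_pos[of "Suc r"] sq by (intro mult_left_mono) auto
  also have "\<dots> = 2 * (\<tau> (Suc r) * h\<^sup>2) + 2 * y" by (simp add: y_def algebra_simps)
  also have "2 * y \<le> 1 + y\<^sup>2" using zero_le_power2[of "y - 1"] by (simp add: power2_diff)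
  finally show ?thesis using h by (simp add: y_def)
qed

text \<open>Until the first exit, \<open>\<tau> l * (gap l)\<^sup>2\<close> gains at least \<open>\<gamma> l / K\<close> in mean at each step; as
  \<open>\<Sum>\<gamma>\<close> diverges, the exit has to happen. The fourth moment of the noise and
  \<open>\<Sum>\<gamma>\<^sup>2 < \<infinity>\<close> control the overshoot.\<close>

lemma live_forever_null:
  assumes A: "A \<in> sets (history M U m)" and m: "m \<ge> n0"
  shows "prob {w \<in> A. \<forall>r\<ge>m. live r w} = 0"
proof (rule ccontr)
  define L where "L = {w \<in> A. \<forall>r\<ge>m. live r w}"
  define \<xi> where "\<xi> r w = (if w \<in> A \<and> (\<forall>k. m \<le> k \<and> k \<le> r \<longrightarrow> live k w) then 1 else 0 :: real)" for r w
  define q where "q r w = \<tau> r * (gap r w)\<^sup>2" for r w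
  define x where "x r w = (\<tau> (Suc r) * (incr pair r w)\<^sup>2)\<^sup>2" for r w
  define K' where "K' = 32 * (2 + K)\<^sup>2 + 1"
  assume "prob {w \<in> A. \<forall>r\<ge>m. live r w} \<noteq> 0"
  then have L_pos: "prob L > 0" by (simp add: L_def zero_less_measure_iff)
  have Aev[measurable]: "A \<in> events" and Aad: "adapted m (\<lambda>w. w \<in> A)"
    using A history_event by (auto simp: sets_history)
  have [measurable]: "Measurable.pred M (live k)" for k
    using history_event[OF adapted_event[OF adapted_live[OF order_refl]]] by (simp add: pred_def)
  have L_eq: "L = {w \<in> space M. w \<in> A \<and> (\<forall>r\<ge>m. live r w)}"
    using sets.sets_into_space[OF Aev] by (auto simp: L_def)
  have Lev: "L \<in> events" unfolding L_eq by measurable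
  have \<xi>_ad: "adapted r (\<xi> r)" if "m \<le> r" for r
  proof -
    have "adapted r (\<lambda>w. m \<le> k \<and> k \<le> r \<longrightarrow> live k w)" for k
      by (cases "k \<le> r") (auto intro: adapted_comp[OF adapted_live])
    from adapted_comp2[OF adapted_mono[OF Aad that] adapted_All[OF this],
        of "\<lambda>x y. if x \<and> y then 1 else 0 :: real"]
    show ?thesis by (simp add: \<xi>_def[abs_def])
  qed
  have q_ad: "adapted n (q r)" if "r \<le> n" for r n
    unfolding q_def[abs_def] by (rule adapted_comp[OF adapted_gap[OF that], of "\<lambda>x. \<tau> r * x\<^sup>2"])
  have incr_ad: "adapted (Suc r) (incr pair r)" for r by (rule adapted_incr[OF adapted_pair pair_le_1])
  have x_ad: "adapted (Suc r) (x r)" for r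
    unfolding x_def[abs_def] by (rule adapted_comp[OF incr_ad, where F="\<lambda>x. (\<tau> (Suc r) * x\<^sup>2)\<^sup>2"])
  have \<xi>_ad': "adapted (Suc r) (\<xi> r)" if "m \<le> r" for r
    using \<xi>_ad[OF that] by (rule adapted_mono) simp
  have int_\<xi>: "integrable M (\<xi> r)" if "m \<le> r" for r by (rule adapted_integrable[OF \<xi>_ad[OF that]])
  have int_q: "integrable M (\<lambda>w. \<xi> r w * (q (Suc r) w - q r w))" if "m \<le> r" for r
    by (rule adapted_integrable[OF adapted_comp2[OF \<xi>_ad'[OF that]
          adapted_comp2[OF q_ad q_ad, where F="\<lambda>x y. x - y"], where F="(*)"]]) auto
  have int_x: "integrable M (\<lambda>w. \<xi> r w * x r w)" if "m \<le> r" for r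
    by (rule adapted_integrable[OF adapted_comp2[OF \<xi>_ad'[OF that] x_ad, where F="(*)"]])
  \<comment> \<open>In the expansion of the new value with h = gap + drift, the term in h^2 is at
    least the old value because the drift is outward, the mixed term has mean 0, and the squared
    noise has conditional mean at least \<gamma>/K while live. Passing from \<xi> to the smaller
    indicator of \<open>L\<close> gives a factor independent of \<open>r\<close>.\<close>
  have gain: "\<gamma> r / K * prob L \<le> (\<integral>w. \<xi> r w * (q (Suc r) w - q r w) \<partial>M)" if r: "m \<le> r" for r
  proof -
    define \<phi> where "\<phi> w = \<xi> r w * (2 * \<tau> (Suc r) * (gap r w + drift r w))" for w
    have \<phi>: "adapted r \<phi>" unfolding \<phi>_def[abs_def]
      by (rule adapted_comp2[OF \<xi>_ad[OF r] adapted_comp2[OF adapted_gap adapted_drift, where F="\<lambda>x y. 2 * \<tau> (Suc r) * (x + y)"], where F="(*)"]) auto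
    have i1: "integrable M (\<lambda>w. \<phi> w * incr pair r w)"
      by (rule adapted_integrable[OF adapted_comp2[OF adapted_mono[OF \<phi>] incr_ad, where F="(*)"]]) auto
    have i2: "integrable M (\<lambda>w. \<xi> r w * (noise (pair r w) r w)\<^sup>2)"
      by (rule integrable_noise_power[OF adapted_pair pair_le_1 \<xi>_ad[OF r]])
    have sp: "integrable M (\<lambda>w. \<xi> r w * (real (\<sigma> (Suc r)) * spread (pair r w) (\<theta> r w)))"
      by (rule adapted_integrable[OF adapted_spread[OF adapted_pair pair_le_1 \<xi>_ad[OF r]]])
    have "real (\<sigma> (Suc r)) / K * prob L = (\<integral>w. indicator L w * (real (\<sigma> (Suc r)) / K) \<partial>M)"
      using Lev by (simp add: Int_absorb2 Int_absorb1 sets.sets_into_space)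
    also have "\<dots> \<le> (\<integral>w. \<xi> r w * (real (\<sigma> (Suc r)) * spread (pair r w) (\<theta> r w)) \<partial>M)"
    proof (rule integral_mono)
      fix w
      have "\<xi> r w = 0 \<or> \<xi> r w = 1 \<and> repelling i j K (\<theta> r w)" using r by (auto simp: \<xi>_def live_def)
      moreover have "w \<in> L \<Longrightarrow> \<xi> r w = 1" by (auto simp: \<xi>_def L_def)
      moreover have "real (\<sigma> (Suc r)) * (1 / K) \<le> real (\<sigma> (Suc r)) * spread (pair r w) (\<theta> r w)"
        if "repelling i j K (\<theta> r w)"
        using that unfolding spread_pair by (intro mult_left_mono) (auto simp: repelling_def)
      moreover have "real (\<sigma> (Suc r)) * (1 / K) \<ge> 0" using K by simp
      ultimately show "indicator L w * (real (\<sigma> (Suc r)) / K) \<le> \<xi> r w * (real (\<sigma> (Suc r)) * spread (pair r w) (\<theta> r w))"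
        by (auto simp: indicator_def)
    qed (use sp Lev in \<open>auto intro!: integrable_mult_left integrable_event_indicator\<close>)
    also have "\<dots> = (\<integral>w. \<xi> r w * (noise (pair r w) r w)\<^sup>2 \<partial>M)"
      by (rule noise_second_moment[OF adapted_pair pair_le_1 \<xi>_ad[OF r], symmetric])
    finally have "\<gamma> r / K * prob L \<le> (\<integral>w. \<xi> r w * (noise (pair r w) r w)\<^sup>2 \<partial>M) / \<tau> (Suc r)"
      using tau_pos[of "Suc r"] by (simp add: field_simps)
    also have "\<dots> = (\<integral>w. \<phi> w * incr pair r w + \<xi> r w * (noise (pair r w) r w)\<^sup>2 / \<tau> (Suc r) \<partial>M)"
      using i1 i2 incr_mean[OF adapted_pair pair_le_1 \<phi>] by simp
    also have "\<dots> \<le> (\<integral>w. \<xi> r w * (q (Suc r) w - q r w) \<partial>M)"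
    proof (rule integral_mono[OF _ int_q[OF r]])
      show "integrable M (\<lambda>w. \<phi> w * incr pair r w + \<xi> r w * (noise (pair r w) r w)\<^sup>2 / \<tau> (Suc r))"
        using i1 i2 by simp
      fix w
      show "\<phi> w * incr pair r w + \<xi> r w * (noise (pair r w) r w)\<^sup>2 / \<tau> (Suc r) \<le> \<xi> r w * (q (Suc r) w - q r w)"
      proof (cases "\<xi> r w = 0")
        case False
        then have \<xi>1: "\<xi> r w = 1" and rep: "repelling i j K (\<theta> r w)"
          using r by (auto simp: \<xi>_def live_def split: if_splits)
        define h where "h = gap r w + drift r w"
        have "h\<^sup>2 = (gap r w)\<^sup>2 + 2 * (drift r w * gap r w) + (drift r w)\<^sup>2"
          by (simp add: h_def power2_sum)
        then have "(gap r w)\<^sup>2 \<le> h\<^sup>2" using drift_outward[OF rep] by simp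
        then have "q r w \<le> \<tau> (Suc r) * h\<^sup>2"
          unfolding q_def using tau_mono[of r "Suc r"] tau_pos[of r] by (intro mult_mono) auto
        moreover have "(noise (pair r w) r w)\<^sup>2 / \<tau> (Suc r) = \<tau> (Suc r) * (incr pair r w)\<^sup>2"
          using tau_pos[of "Suc r"] by (simp add: incr_def power2_eq_square)
        moreover have "q (Suc r) w = \<tau> (Suc r) * h\<^sup>2 + 2 * \<tau> (Suc r) * h * incr pair r w + \<tau> (Suc r) * (incr pair r w)\<^sup>2"
          unfolding q_def gap_Suc h_def[symmetric] power2_sum by (simp add: algebra_simps)
        ultimately show ?thesis by (simp add: \<xi>1 \<phi>_def h_def[symmetric])
      qed (simp add: \<phi>_def)
    qed
    finally show ?thesis .
  qed
  \<comment> \<open>\<open>x r\<close> is the fourth power of the noise divided by \<tau>^2, so the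
    fourth moment bound applies.\<close>
  have cost: "(\<integral>w. \<xi> r w * x r w \<partial>M) \<le> 48 * (\<gamma> r)\<^sup>2" if r: "m \<le> r" for r
  proof -
    have eq: "x r w = (noise (pair r w) r w)^4 / (\<tau> (Suc r))\<^sup>2" for w
      using tau_pos[of "Suc r"] by (simp add: x_def incr_def power2_eq_square power4_eq_xxxx)
    have "(\<integral>w. \<xi> r w * x r w \<partial>M) = (\<integral>w. \<xi> r w * (noise (pair r w) r w)^4 \<partial>M) / (\<tau> (Suc r))\<^sup>2"
      unfolding eq by simp
    also have "\<dots> \<le> (\<integral>w. \<xi> r w * (48 * (real (\<sigma> (Suc r)))\<^sup>2) \<partial>M) / (\<tau> (Suc r))\<^sup>2"
      by (intro divide_right_mono noise_fourth_moment[OF adapted_pair pair_le_1 \<xi>_ad[OF r]]) (auto simp: \<xi>_def)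
    also have "(\<integral>w. \<xi> r w * (48 * (real (\<sigma> (Suc r)))\<^sup>2) \<partial>M) \<le> (\<integral>w. 48 * (real (\<sigma> (Suc r)))\<^sup>2 \<partial>M)"
      by (rule integral_mono) (auto simp: \<xi>_def int_\<xi>[OF r, unfolded \<xi>_def[abs_def]])
    also have "\<dots> = 48 * (real (\<sigma> (Suc r)))\<^sup>2" by (simp add: prob_space)
    finally show ?thesis by (simp add: power_divide divide_right_mono)
  qed
  have bound: "prob L / K * (\<Sum>r\<in>{m..<N}. \<gamma> r) \<le> K' + 48 * (\<Sum>r. (\<gamma> r)\<^sup>2)" if "m \<le> N" for N
  proof -
    have "prob L / K * (\<Sum>r\<in>{m..<N}. \<gamma> r) = (\<Sum>r\<in>{m..<N}. \<gamma> r / K * prob L)"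
      by (simp add: sum_distrib_left sum_distrib_right mult_ac)
    also have "\<dots> \<le> (\<Sum>r\<in>{m..<N}. \<integral>w. \<xi> r w * (q (Suc r) w - q r w) \<partial>M)"
      by (intro sum_mono gain) auto
    also have "\<dots> = (\<integral>w. (\<Sum>r\<in>{m..<N}. \<xi> r w * (q (Suc r) w - q r w)) \<partial>M)"
      using int_q by (intro Bochner_Integration.integral_sum[symmetric]) auto
    also have "\<dots> \<le> (\<integral>w. K' + (\<Sum>r\<in>{m..<N}. \<xi> r w * x r w) \<partial>M)"
    proof (rule integral_mono)
      fix w
      show "(\<Sum>r\<in>{m..<N}. \<xi> r w * (q (Suc r) w - q r w)) \<le> K' + (\<Sum>r\<in>{m..<N}. \<xi> r w * x r w)"
        unfolding \<xi>_def
      proof (rule stopped_telescope_bound[OF _ _ _ _ that])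
        show "q r w \<ge> 0" for r using tau_pos[of r] by (simp add: q_def)
        show "q (Suc r) w \<le> K' + x r w" if "m \<le> r" "live r w" for r
          using live_exit_bound[of r w] that m by (simp add: q_def x_def K'_def)
      qed (auto simp: x_def K'_def)
    qed (use int_q int_x in \<open>auto intro!: Bochner_Integration.integrable_sum Bochner_Integration.integrable_add\<close>)
    also have "\<dots> = K' + (\<Sum>r\<in>{m..<N}. \<integral>w. \<xi> r w * x r w \<partial>M)"
      using int_x by (subst Bochner_Integration.integral_add) (auto intro!: Bochner_Integration.integrable_sum simp: prob_space)
    also have "(\<Sum>r\<in>{m..<N}. \<integral>w. \<xi> r w * x r w \<partial>M) \<le> (\<Sum>r\<in>{m..<N}. 48 * (\<gamma> r)\<^sup>2)"
      by (intro sum_mono cost) auto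
    also have "\<dots> = 48 * (\<Sum>r\<in>{m..<N}. (\<gamma> r)\<^sup>2)" by (simp add: sum_distrib_left)
    also have "(\<Sum>r\<in>{m..<N}. (\<gamma> r)\<^sup>2) \<le> (\<Sum>r. (\<gamma> r)\<^sup>2)"
      by (rule sum_le_suminf[OF step_square_summable]) auto
    finally show ?thesis by simp
  qed
  \<comment> \<open>With \<open>prob L\<close> positive, \<open>bound\<close> would keep all partial
    sums of \<gamma> below a fixed number.\<close>
  obtain N where N: "m \<le> N" "(\<Sum>r\<in>{m..<N}. \<gamma> r) > (K' + 48 * (\<Sum>r. (\<gamma> r)\<^sup>2)) / (prob L / K)"
    using gamma_sum_unbounded .
  have "prob L / K > 0" using L_pos K by simp
  from iffD1[OF pos_divide_less_eq[OF this] N(2)]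
  have "K' + 48 * (\<Sum>r. (\<gamma> r)\<^sup>2) < (\<Sum>r\<in>{m..<N}. \<gamma> r) * (prob L / K)" .
  also have "\<dots> = prob L / K * (\<Sum>r\<in>{m..<N}. \<gamma> r)" by (rule mult.commute)
  also note bound[OF N(1)]
  finally show False by simp
qed

text \<open>\<open>A\<close> is split at the first time that is not live. Never reaching one has
  probability 0. On \<open>tied\<close> repulsion persists, so the exit is due to a gap of the
  critical size; this part is known at the exit time, \<open>tied_prob_if_separated\<close> halves
  it, and the pieces are added up.\<close>

lemma tied_prob_half:
  assumes A: "A \<in> sets (history M U m)" and m: "m \<ge> n0"
  shows "prob (A \<inter> tied) \<le> prob A / 2"
proof -
  define C where "C t = {w \<in> A. (\<forall>k. m \<le> k \<and> k < m + t \<longrightarrow> live k w) \<and> repelling i j K (\<theta> (m + t) w) \<and> \<not> live (m + t) w}" for t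
  define L where "L = {w \<in> A. \<forall>r\<ge>m. live r w}"
  have Aev[measurable]: "A \<in> events" and Aad: "adapted m (\<lambda>w. w \<in> A)"
    using A history_event by (auto simp: sets_history)
  have A_sub: "A \<subseteq> space M" using sets.sets_into_space[OF Aev] .
  have [measurable]: "Measurable.pred M (live k)" for k
    using history_event[OF adapted_event[OF adapted_live[OF order_refl]]] by (simp add: pred_def)
  have L_eq: "L = {w \<in> space M. w \<in> A \<and> (\<forall>r\<ge>m. live r w)}"
    using A_sub by (auto simp: L_def)
  have Lev[measurable]: "L \<in> events" unfolding L_eq by measurable
  have C_hist: "C t \<in> sets (history M U (m + t))" for t
  proof -
    have a1: "adapted (m + t) (\<lambda>w. m \<le> k \<and> k < m + t \<longrightarrow> live k w)" for k
      by (cases "k < m + t") (auto intro: adapted_comp[OF adapted_live])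
    have a2: "adapted (m + t) (\<lambda>w. repelling i j K (\<theta> (m + t) w) \<and> \<not> live (m + t) w)"
      by (rule adapted_comp2[OF adapted_repelling adapted_live]) auto
    have "adapted (m + t) (\<lambda>w. w \<in> A \<and> (\<forall>k. m \<le> k \<and> k < m + t \<longrightarrow> live k w) \<and> repelling i j K (\<theta> (m + t) w) \<and> \<not> live (m + t) w)"
      using adapted_comp2[OF adapted_mono[OF Aad le_add1] adapted_comp2[OF adapted_All[OF a1] a2, where F="(\<and>)"], where F="(\<and>)"] .
    then have "{w \<in> space M. w \<in> A \<and> (\<forall>k. m \<le> k \<and> k < m + t \<longrightarrow> live k w) \<and> repelling i j K (\<theta> (m + t) w) \<and> \<not> live (m + t) w}
      \<in> sets (history M U (m + t))" by (rule adapted_event)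
    also have "{w \<in> space M. w \<in> A \<and> (\<forall>k. m \<le> k \<and> k < m + t \<longrightarrow> live k w) \<and> repelling i j K (\<theta> (m + t) w) \<and> \<not> live (m + t) w} = C t"
      using A_sub unfolding C_def by blast
    finally show ?thesis .
  qed
  then have C_ev[measurable]: "C t \<in> events" for t using history_event by blast
  have disj: "disjoint_family C"
    unfolding disjoint_family_on_def
  proof (intro ballI impI)
    fix s t :: nat assume "s \<noteq> t"
    then show "C s \<inter> C t = {}"
      by (cases s t rule: linorder_cases) (auto simp: C_def)
  qed
  have sums: "(\<lambda>t. prob (C t)) sums prob (\<Union>t. C t)"
    by (rule finite_measure_UNION) (use disj in auto)
  have le: "prob (C t \<inter> tied) \<le> prob (C t) / 2" for t
    by (rule tied_prob_if_separated[OF C_hist]) (use m in \<open>auto simp: C_def live_def\<close>)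
  have sub: "A \<inter> tied \<subseteq> L \<union> (\<Union>t. C t \<inter> tied)"
  proof
    fix w assume w: "w \<in> A \<inter> tied"
    show "w \<in> L \<union> (\<Union>t. C t \<inter> tied)"
    proof (cases "w \<in> L")
      case False
      then have "\<exists>t. \<not> live (m + t) w" using w by (auto simp: L_def le_iff_add)
      then obtain t where t: "\<not> live (m + t) w" "\<And>s. s < t \<Longrightarrow> live (m + s) w"
        using exists_least_iff[of "\<lambda>t. \<not> live (m + t) w"] by auto
      have "live k w" if "m \<le> k \<and> k < m + t" for k
        using t(2)[of "k - m"] that by auto
      moreover have "repelling i j K (\<theta> (m + t) w)" using w m by (simp add: tied_def)
      ultimately have "w \<in> C t" using w t(1) unfolding C_def by blast
      then show ?thesis using w by blast
    qed simp
  qed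
  have summ: "summable (\<lambda>t. prob (C t \<inter> tied))"
    by (rule summable_comparison_test'[OF sums_summable[OF sums], of 0]) (auto intro: finite_measure_mono)
  have "prob (A \<inter> tied) \<le> prob (L \<union> (\<Union>t. C t \<inter> tied))"
    by (rule finite_measure_mono[OF sub]) auto
  also have "\<dots> \<le> prob L + prob (\<Union>t. C t \<inter> tied)"
    by (rule measure_Un_le) auto
  also have "prob L = 0" unfolding L_def by (rule live_forever_null[OF A m])
  also have "prob (\<Union>t. C t \<inter> tied) \<le> (\<Sum>t. prob (C t \<inter> tied))"
    by (rule finite_measure_subadditive_countably[OF _ summ]) auto
  also have "\<dots> \<le> (\<Sum>t. prob (C t) / 2)"
    by (rule suminf_le[OF le summ]) (use sums in \<open>auto dest: sums_summable\<close>)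
  also have "\<dots> = prob (\<Union>t. C t) / 2"
    using sums_divide[OF sums, of 2] by (simp add: sums_iff)
  also have "\<dots> \<le> prob A / 2"
    by (intro divide_right_mono finite_measure_mono) (auto simp: C_def)
  finally show ?thesis by simp
qed

text \<open>This replaces Levy's zero-one law: \<open>tied\<close> is approximated by an event \<open>A\<close> of a finite
  history, and \<open>P(A \<inter> tied) \<le> P(A) / 2\<close>.\<close>

lemma tied_null: "prob tied = 0"
proof -
  have mono: "sets (history M U m) \<subseteq> sets (history M U n)" if "m \<le> n" for m n
    using adapted_mono[OF _ that] by (auto simp: sets_history)
  have alg: "algebra (space M) (sets (history M U n))" for n
    using sets.algebra_axioms[of "history M U n"] by simp
  have small: "prob tied \<le> 3 * e" if e: "e > 0" for e :: real
  proof -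
    obtain n A where A: "A \<in> sets (history M U n)" "prob ((A - tied) \<union> (tied - A)) < e"
      using sigma_sets_approx[of "\<lambda>n. sets (history M U n)", OF _ mono alg tied_tail e] history_event by blast
    have [measurable]: "A \<in> events" using A(1) by (rule history_event)
    have le1: "prob tied \<le> prob (A \<inter> tied) + prob ((A - tied) \<union> (tied - A))"
      by (rule order_trans[OF finite_measure_mono measure_Un_le]) auto
    \<comment> \<open>The halving needs a time past \<open>n0\<close>, so \<open>A\<close> is
      regarded as an event of a longer history.\<close>
    have le2: "prob (A \<inter> tied) \<le> prob A / 2"
      by (rule tied_prob_half[of A "max n n0"]) (use A(1) mono[of n "max n n0"] in auto)
    have le3: "prob A \<le> prob tied + prob ((A - tied) \<union> (tied - A))"
      by (rule order_trans[OF finite_measure_mono measure_Un_le]) auto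
    \<comment> \<open>P(tied) \<le> P(A)/2 + e and P(A) \<le> P(tied) + e, hence P(tied)/2 \<le> 3 e
      / 2.\<close>
    show ?thesis using A(2) le1 le2 le3 by linarith
  qed
  have "prob tied \<le> 0"
  proof (rule field_le_epsilon)
    fix e :: real assume "e > 0"
    then show "prob tied \<le> 0 + e" using small[of "e / 3"] by simp
  qed
  then show ?thesis by (simp add: measure_le_0_iff)
qed

lemma AE_not_tied:
  "AE w in M. (\<forall>l\<ge>n0. repelling i j K (\<theta> l w)) \<longrightarrow> \<not> (\<lambda>l. \<theta> l w $ i - \<theta> l w $ j) \<longlonglongrightarrow> 0"
proof -
  have "AE w in M. w \<notin> tied" using tied_null prob_eq_0[OF tied_event] by blast
  with AE_space show ?thesis by eventually_elim (auto simp: tied_def gap_def[abs_def])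
qed

end

section \<open>Convergence of the proportions\<close>

definition prob_vectors :: "(real ^ 'd) set" where
  "prob_vectors = {x. (\<forall>j. x $ j \<ge> 0) \<and> (\<Sum>j\<in>UNIV. x $ j) = 1}"

text \<open>An arbitrary choice among the largest coordinates. The choice may jump, but the value
  \<open>x $ leader x\<close> depends continuously on \<open>x\<close>
  (\<open>leader_tendsto\<close>).\<close>

definition leader :: "real ^ 'd \<Rightarrow> 'd" where
  "leader x = (SOME i. \<forall>k. x $ k \<le> x $ i)"

text \<open>Half the derivative of the sum of squares along the vector field
  \<open>draw x - x\<close>.\<close>

definition covar :: "real ^ 'd \<Rightarrow> real" where
  "covar x = (\<Sum>j\<in>UNIV. x $ j * (draw x j - x $ j))"

lemma simplex_draw:
  assumes "x \<in> prob_vectors"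
  shows "(\<Sum>j\<in>UNIV. f (x $ j)) > 0" "(\<Sum>j\<in>UNIV. draw x j) = 1" "draw x j \<ge> 0" "x $ j \<le> 1" "x $ j \<ge> 0"
  using draw_sum[of x] assms by (auto simp: prob_vectors_def)

lemma leader_max: "x $ k \<le> x $ leader x"
proof -
  have fin: "finite (range (\<lambda>k. x $ k))" by simp
  have "Max (range (\<lambda>k. x $ k)) \<in> range (\<lambda>k. x $ k)" by (rule Max_in[OF fin]) simp
  then obtain i where "Max (range (\<lambda>k. x $ k)) = x $ i" by blast
  then have "\<forall>k. x $ k \<le> x $ i" using Max_ge[OF fin] by auto
  then have "\<forall>k. x $ k \<le> x $ leader x" unfolding leader_def by (rule someI)
  then show ?thesis by blast
qed

text \<open>As f(x)/x increases, the largest coordinate x_i satisfies x_i f(x_k) \<le> f(x_i) x_k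
  for all k. Summing over k, where the x_k add up to 1, gives the claim.\<close>

lemma leader_gains:
  assumes x: "x \<in> prob_vectors"
  shows "draw x (leader x) \<ge> x $ leader x"
proof -
  define i where "i = leader x"
  note s = simplex_draw[OF x]
  have "x $ i * f (x $ k) \<le> f (x $ i) * x $ k" for k
  proof (cases "x $ k = x $ i")
    case False
    then have "x $ k < x $ i" using leader_max[of x k] by (simp add: i_def)
    then show ?thesis using reinforcement_pair_nonneg(1)[OF f_class s(5) s(4) s(5) s(4), of i k]
      by (simp add: zero_le_mult_iff mult.commute)
  qed simp
  then have "(\<Sum>k\<in>UNIV. x $ i * f (x $ k)) \<le> (\<Sum>k\<in>UNIV. f (x $ i) * x $ k)" by (rule sum_mono)
  then have "x $ i * (\<Sum>k\<in>UNIV. f (x $ k)) \<le> f (x $ i)"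
    using x by (simp add: sum_distrib_left[symmetric] prob_vectors_def)
  then show ?thesis using s(1) by (simp add: draw_def i_def[symmetric] pos_le_divide_eq)
qed

text \<open>The symmetrisation behind Chebyshev's sum inequality: exchanging the two indices turns
  the difference into a double sum of products, each nonnegative by
  \<open>reinforcement_pair_nonneg\<close>.\<close>

lemma covar_eq:
  assumes x: "x \<in> prob_vectors"
  shows "2 * (\<Sum>j\<in>UNIV. f (x $ j)) * covar x =
    (\<Sum>j\<in>UNIV. \<Sum>k\<in>UNIV. (x $ j - x $ k) * (f (x $ j) * x $ k - f (x $ k) * x $ j))"
proof -
  define F where "F = (\<Sum>j\<in>UNIV. f (x $ j))"
  define A where "A = (\<Sum>j\<in>UNIV. x $ j * f (x $ j))"
  define V where "V = (\<Sum>j\<in>UNIV. (x $ j)\<^sup>2)"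
  have s1: "(\<Sum>j\<in>UNIV. x $ j) = 1" using x by (simp add: prob_vectors_def)
  have F: "F > 0" using simplex_draw(1)[OF x] by (simp add: F_def)
  have "F * covar x = (\<Sum>j\<in>UNIV. x $ j * f (x $ j) - F * (x $ j)\<^sup>2)"
    unfolding covar_def sum_distrib_left
    by (rule sum.cong) (use F in \<open>auto simp: draw_def F_def[symmetric] power2_eq_square right_diff_distrib\<close>)
  also have "\<dots> = A - F * V" by (simp add: sum_subtractf A_def V_def sum_distrib_left)
  finally have c: "F * covar x = A - F * V" .
  have "(\<Sum>j\<in>UNIV. \<Sum>k\<in>UNIV. (x $ j - x $ k) * (f (x $ j) * x $ k - f (x $ k) * x $ j))
    = (\<Sum>j\<in>UNIV. \<Sum>k\<in>UNIV. (x $ j * f (x $ j)) * x $ k - (x $ j)\<^sup>2 * f (x $ k)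
         - f (x $ j) * (x $ k)\<^sup>2 + x $ j * (x $ k * f (x $ k)))"
    by (intro sum.cong refl) (simp add: power2_eq_square algebra_simps)
  also have "\<dots> = A * 1 - V * F - F * V + 1 * A"
    unfolding sum.distrib sum_subtractf sum_product[symmetric] s1 A_def V_def F_def ..
  finally show ?thesis using c by (simp add: F_def[symmetric] algebra_simps)
qed

lemma covar_nonneg: "x \<in> prob_vectors \<Longrightarrow> covar x \<ge> 0"
proof -
  assume x: "x \<in> prob_vectors"
  note s = simplex_draw[OF x]
  have "2 * (\<Sum>j\<in>UNIV. f (x $ j)) * covar x \<ge> 0"
    unfolding covar_eq[OF x] by (intro sum_nonneg reinforcement_pair_nonneg(1)[OF f_class s(5) s(4) s(5) s(4)])
  then show ?thesis using s(1) by (simp add: zero_le_mult_iff)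
qed

lemma covar_zero:
  assumes x: "x \<in> prob_vectors" and "covar x = 0"
  shows "x $ j = 0 \<or> x $ k = 0 \<or> x $ j = x $ k"
proof -
  note s = simplex_draw[OF x]
  note nn = reinforcement_pair_nonneg(1)[OF f_class s(5) s(4) s(5) s(4)]
  have "(\<Sum>j\<in>UNIV. \<Sum>k\<in>UNIV. (x $ j - x $ k) * (f (x $ j) * x $ k - f (x $ k) * x $ j)) = 0"
    unfolding covar_eq[OF x, symmetric] using assms(2) by simp
  then have "(\<Sum>k\<in>UNIV. (x $ j - x $ k) * (f (x $ j) * x $ k - f (x $ k) * x $ j)) = 0"
    by (subst (asm) sum_nonneg_eq_0_iff) (auto intro!: sum_nonneg nn)
  then have "(x $ j - x $ k) * (f (x $ j) * x $ k - f (x $ k) * x $ j) = 0"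
    by (subst (asm) sum_nonneg_eq_0_iff) (auto intro!: nn)
  then show ?thesis by (rule reinforcement_pair_nonneg(2)[OF f_class s(5) s(4) s(5) s(4)])
qed

lemma tendsto_total_weight:
  assumes lim: "Y \<longlonglongrightarrow> x" and Y: "\<And>n. Y n \<in> prob_vectors" and x: "x \<in> prob_vectors"
  shows "(\<lambda>n. f (Y n $ j)) \<longlonglongrightarrow> f (x $ j)"
    and "(\<lambda>n. \<Sum>j\<in>UNIV. f (Y n $ j)) \<longlonglongrightarrow> (\<Sum>j\<in>UNIV. f (x $ j))"
    and "(\<lambda>n. draw (Y n) j) \<longlonglongrightarrow> draw x j"
proof -
  have cf: "continuous_on {0..1} f" using f_class by (simp add: reinforcement_class_def)
  show fj: "(\<lambda>n. f (Y n $ j)) \<longlonglongrightarrow> f (x $ j)" for j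
    by (rule continuous_on_tendsto_compose[OF cf tendsto_vec_nth[OF lim]])
      (use simplex_draw(4,5) Y x in auto)
  then show F: "(\<lambda>n. \<Sum>j\<in>UNIV. f (Y n $ j)) \<longlonglongrightarrow> (\<Sum>j\<in>UNIV. f (x $ j))"
    by (intro tendsto_sum)
  show "(\<lambda>n. draw (Y n) j) \<longlonglongrightarrow> draw x j"
    unfolding draw_def using simplex_draw(1)[OF x] by (intro tendsto_divide fj F) auto
qed

lemma simplex_limit:
  assumes "Y \<longlonglongrightarrow> x" and Y: "\<And>n. Y n \<in> prob_vectors"
  shows "x \<in> prob_vectors"
proof -
  have c: "(\<lambda>n. Y n $ j) \<longlonglongrightarrow> x $ j" for j using assms(1) by (rule tendsto_vec_nth)
  have "x $ j \<ge> 0" for j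
    by (rule LIMSEQ_le_const[OF c]) (use Y in \<open>auto simp: prob_vectors_def\<close>)
  moreover have "(\<lambda>n. \<Sum>j\<in>UNIV. Y n $ j) \<longlonglongrightarrow> (\<Sum>j\<in>UNIV. x $ j)" by (intro tendsto_sum c)
  then have "(\<lambda>n. 1) \<longlonglongrightarrow> (\<Sum>j\<in>UNIV. x $ j)" using Y by (simp add: prob_vectors_def)
  then have "(\<Sum>j\<in>UNIV. x $ j) = 1" by (simp add: LIMSEQ_const_iff)
  ultimately show ?thesis by (simp add: prob_vectors_def)
qed

text \<open>The maximum is 1-Lipschitz: each leading value is compared with the other vector at the
  same coordinate.\<close>

lemma leader_tendsto:
  assumes "Y \<longlonglongrightarrow> x" shows "(\<lambda>n. Y n $ leader (Y n)) \<longlonglongrightarrow> x $ leader x"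
proof (rule Lim_null[THEN iffD2], rule Lim_null_comparison)
  have "\<bar>y $ leader y - z $ leader z\<bar> \<le> norm (y - z)" for y z :: "real ^ 'd"
  proof -
    have "y $ leader y - z $ leader z \<le> norm (y - z)"
      using component_le_norm_cart[of "y - z" "leader y"] leader_max[of z "leader y"] by simp
    moreover have "z $ leader z - y $ leader y \<le> norm (y - z)"
      using component_le_norm_cart[of "y - z" "leader z"] leader_max[of y "leader z"] by simp
    ultimately show ?thesis by linarith
  qed
  then show "\<forall>\<^sub>F n in sequentially. norm (Y n $ leader (Y n) - x $ leader x) \<le> norm (Y n - x)" by simp
  show "(\<lambda>n. norm (Y n - x)) \<longlonglongrightarrow> 0" using assms by (simp add: LIM_zero tendsto_norm_zero)
qed

section \<open>Two functions that increase up to noise\<close>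

definition leader_ind :: "nat \<Rightarrow> 'w \<Rightarrow> 'd \<Rightarrow> real" where
  "leader_ind n w k = (if k = leader (\<theta> n w) then 1 else 0)"

text \<open>The truncation is void on the simplex; it makes the bound by 1 hold everywhere, not only
  almost surely.\<close>

definition prop_weights :: "nat \<Rightarrow> 'w \<Rightarrow> 'd \<Rightarrow> real" where
  "prop_weights n w k = min 1 (\<theta> n w $ k)"

lemma adapted_leader_ind: "adapted n (leader_ind n)"
  unfolding leader_ind_def[abs_def] by (rule adapted_comp[OF adapted_prop]) simp

lemma leader_ind_le_1: "\<bar>leader_ind n w k\<bar> \<le> 1"
  by (simp add: leader_ind_def)

lemma adapted_prop_weights: "adapted n (prop_weights n)"
  unfolding prop_weights_def[abs_def] by (rule adapted_comp[OF adapted_prop]) simp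

lemma prop_weights_le_1: "\<bar>prop_weights n w k\<bar> \<le> 1"
  by (simp add: prop_weights_def urn_prop_def)

text \<open>The colour leading at time \<open>n\<close> has nonnegative drift, and its new share is
  at most the new maximum, whoever leads then. The summand 0 fills the place of \<open>h\<close> in
  \<open>bounded_perturbed_increase\<close>.\<close>

lemma leader_step:
  assumes "\<theta> n w \<in> prob_vectors"
  shows "\<theta> (Suc n) w $ leader (\<theta> (Suc n) w) \<ge> \<theta> n w $ leader (\<theta> n w) + 0 + incr leader_ind n w"
proof -
  define i where "i = leader (\<theta> n w)"
  have s: "(\<Sum>k\<in>UNIV. leader_ind n w k * g k) = g i" for g
  proof -
    have "(\<Sum>k\<in>UNIV. leader_ind n w k * g k) = (\<Sum>k\<in>UNIV. if k = i then g k else 0)"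
      by (rule sum.cong) (auto simp: leader_ind_def i_def)
    then show ?thesis by simp
  qed
  have "\<theta> (Suc n) w $ i = \<theta> n w $ i + \<gamma> n * (draw (\<theta> n w) i - \<theta> n w $ i) + incr leader_ind n w"
    using prop_step[of "leader_ind n w" n w] unfolding s by (simp add: incr_def)
  moreover have "\<gamma> n * (draw (\<theta> n w) i - \<theta> n w $ i) \<ge> 0"
    using leader_gains[OF assms] gamma_bounds[of n] by (simp add: i_def)
  moreover have "\<theta> (Suc n) w $ i \<le> \<theta> (Suc n) w $ leader (\<theta> (Suc n) w)" by (rule leader_max)
  ultimately show ?thesis by (simp add: i_def[symmetric])
qed

text \<open>The convexity bound |y|^2 \<ge> 2 <x, y> - |x|^2 makes the estimate linear in the new
  proportions, so the noise enters only to first order.\<close>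

lemma square_step:
  assumes "\<theta> n w \<in> prob_vectors"
  shows "(\<Sum>j\<in>UNIV. (\<theta> (Suc n) w $ j)\<^sup>2) \<ge>
    (\<Sum>j\<in>UNIV. (\<theta> n w $ j)\<^sup>2) + 2 * \<gamma> n * covar (\<theta> n w) + 2 * incr prop_weights n w"
proof -
  have pw: "prop_weights n w = (\<lambda>k. \<theta> n w $ k)"
    using simplex_draw(4)[OF assms] by (auto simp: prop_weights_def)
  have "(\<Sum>j\<in>UNIV. 2 * (\<theta> n w $ j * \<theta> (Suc n) w $ j) - (\<theta> n w $ j)\<^sup>2) \<le> (\<Sum>j\<in>UNIV. (\<theta> (Suc n) w $ j)\<^sup>2)"
  proof (rule sum_mono)
    fix j show "2 * (\<theta> n w $ j * \<theta> (Suc n) w $ j) - (\<theta> n w $ j)\<^sup>2 \<le> (\<theta> (Suc n) w $ j)\<^sup>2"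
      using zero_le_power2[of "\<theta> n w $ j - \<theta> (Suc n) w $ j"] by (simp add: power2_diff)
  qed
  moreover have "(\<Sum>j\<in>UNIV. \<theta> n w $ j * \<theta> (Suc n) w $ j) =
      (\<Sum>j\<in>UNIV. (\<theta> n w $ j)\<^sup>2) + \<gamma> n * covar (\<theta> n w) + incr prop_weights n w"
    using prop_step[of "\<lambda>k. \<theta> n w $ k" n w] by (simp add: covar_def incr_def pw power2_eq_square)
  ultimately show ?thesis by (simp add: sum_subtractf sum_distrib_left[symmetric])
qed

text \<open>Counts never decrease, so no share drops by more than \<open>\<gamma> n\<close>. Since
  the shares always add up to 1, none can rise by more than \<open>\<gamma> n\<close> times the
  number of colours.\<close>

lemma prop_increment_LIMSEQ:
  assumes w: "w \<in> space M" and simp: "\<And>n. \<theta> n w \<in> prob_vectors"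
  shows "(\<lambda>n. \<theta> (Suc n) w $ j - \<theta> n w $ j) \<longlonglongrightarrow> 0"
proof (rule Lim_null_comparison)
  have low: "\<theta> (Suc n) w $ k - \<theta> n w $ k + \<gamma> n \<ge> 0" for n k
  proof -
    have "real (U n w $ k) \<le> real (U (Suc n) w $ k)" using w by (simp add: U_Suc sum_nonneg)
    moreover have "real (U n w $ k) = (\<tau> (Suc n) - real (\<sigma> (Suc n))) * \<theta> n w $ k"
      using tau_pos[of n] by (simp add: urn_prop_def tau_Suc)
    ultimately have "(\<tau> (Suc n) - real (\<sigma> (Suc n))) * \<theta> n w $ k / \<tau> (Suc n) \<le> \<theta> (Suc n) w $ k"
      unfolding urn_prop_def[of u0 \<sigma> U "Suc n"] by (simp add: divide_right_mono)
    then have "\<theta> n w $ k - \<gamma> n * \<theta> n w $ k \<le> \<theta> (Suc n) w $ k"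
      using tau_pos[of "Suc n"] by (simp add: diff_divide_distrib left_diff_distrib)
    moreover have "\<gamma> n * \<theta> n w $ k \<le> \<gamma> n"
      using gamma_bounds[of n] simplex_draw(4,5)[OF simp] by (intro mult_left_le) auto
    ultimately show ?thesis by linarith
  qed
  show "\<forall>\<^sub>F n in sequentially. norm (\<theta> (Suc n) w $ j - \<theta> n w $ j) \<le> \<gamma> n * real (CARD('d))"
  proof (rule always_eventually, rule allI)
    fix n
    have "\<theta> (Suc n) w $ j - \<theta> n w $ j + \<gamma> n \<le> (\<Sum>k\<in>UNIV. \<theta> (Suc n) w $ k - \<theta> n w $ k + \<gamma> n)"
      using low by (intro member_le_sum) auto
    also have "\<dots> = \<gamma> n * real (CARD('d))"
      using simp[of n] simp[of "Suc n"] by (simp add: sum.distrib sum_subtractf prob_vectors_def)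
    finally have "\<theta> (Suc n) w $ j - \<theta> n w $ j \<le> \<gamma> n * real (CARD('d))" using gamma_bounds(1)[of n] by linarith
    moreover have "\<gamma> n * 1 \<le> \<gamma> n * real (CARD('d))"
      using gamma_bounds(1)[of n] by (intro mult_left_mono) (auto simp: Suc_le_eq)
    ultimately show "norm (\<theta> (Suc n) w $ j - \<theta> n w $ j) \<le> \<gamma> n * real (CARD('d))"
      using low[of n j] by simp
  qed
  show "(\<lambda>n. \<gamma> n * real (CARD('d))) \<longlonglongrightarrow> 0" using gamma_LIMSEQ by (rule tendsto_mult_left_zero)
qed

lemma covar_small_infinitely_often:
  assumes summ: "summable (\<lambda>n. 2 * \<gamma> n * covar (\<theta> n w))" and simp: "\<And>n. \<theta> n w \<in> prob_vectors" and "e > 0"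
  obtains n where "n \<ge> m" "covar (\<theta> n w) < e"
proof (rule ccontr)
  assume "\<not> thesis"
  with that have large: "covar (\<theta> n w) \<ge> e" if "n \<ge> m" for n using that not_less by blast
  have nn: "2 * \<gamma> n * covar (\<theta> n w) \<ge> 0" for n using gamma_bounds(1)[of n] covar_nonneg[OF simp] by simp
  obtain N where N: "m \<le> N" "(\<Sum>r\<in>{m..<N}. \<gamma> r) > (\<Sum>n. 2 * \<gamma> n * covar (\<theta> n w)) / (2 * e)"
    using gamma_sum_unbounded .
  have "(\<Sum>n. 2 * \<gamma> n * covar (\<theta> n w)) < 2 * e * (\<Sum>r\<in>{m..<N}. \<gamma> r)"
    using N(2) \<open>e > 0\<close> by (simp add: pos_divide_less_eq mult.commute)
  also have "\<dots> = (\<Sum>r\<in>{m..<N}. 2 * \<gamma> r * e)" by (simp add: sum_distrib_left mult_ac)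
  also have "\<dots> \<le> (\<Sum>r\<in>{m..<N}. 2 * \<gamma> r * covar (\<theta> r w))"
    using large gamma_bounds(1) by (intro sum_mono mult_left_mono) auto
  also have "\<dots> \<le> (\<Sum>n. 2 * \<gamma> n * covar (\<theta> n w))"
    using nn by (intro sum_le_suminf summ) auto
  finally show False by simp
qed

text \<open>The maximum \<open>L\<close> and the sum of squares \<open>V\<close> converge along the
  whole sequence, while the proportions are not yet known to. The subsequence with vanishing
  \<open>covar\<close> serves only to evaluate these two limits; as they agree,
  \<open>L n - V n\<close> tends to 0 without passing to a subsequence.\<close>

lemma limit_points:
  assumes w: "w \<in> space M" and simp: "\<And>n. \<theta> n w \<in> prob_vectors"
    and s1: "summable (\<lambda>n. incr leader_ind n w)" and s2: "summable (\<lambda>n. incr prop_weights n w)"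
  obtains y m where "(\<lambda>n. \<theta> n w) \<longlonglongrightarrow> y" "m > 0" "\<And>j. y $ j = 0 \<or> y $ j = m" "y \<in> prob_vectors"
proof -
  define L where "L n = \<theta> n w $ leader (\<theta> n w)" for n
  define V where "V n = (\<Sum>j\<in>UNIV. (\<theta> n w $ j)\<^sup>2)" for n
  have bnd: "0 \<le> \<theta> n w $ j" "\<theta> n w $ j \<le> 1" for n j using simplex_draw(4,5)[OF simp] by auto
  have "convergent L"
    by (rule bounded_perturbed_increase(1)[where B=1 and h="\<lambda>n. 0" and \<mu>="\<lambda>n. incr leader_ind n w"])
      (use bnd leader_step[OF simp] s1 in \<open>auto simp: L_def\<close>)
  then obtain l where l: "L \<longlonglongrightarrow> l" by (auto simp: convergent_def)
  have V_le: "V n \<le> real (CARD('d))" for n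
    unfolding V_def using bnd by (intro sum_bounded_above[where K=1, simplified] power_le_one)
  have V_inc: "V (Suc n) \<ge> V n + 2 * \<gamma> n * covar (\<theta> n w) + 2 * incr prop_weights n w" for n
    unfolding V_def by (rule square_step[OF simp])
  have nn: "2 * \<gamma> n * covar (\<theta> n w) \<ge> 0" for n using gamma_bounds(1)[of n] covar_nonneg[OF simp] by simp
  note pert = bounded_perturbed_increase[OF V_le V_inc nn summable_mult[OF s2]]
  obtain v where v: "V \<longlonglongrightarrow> v" using pert(1) by (auto simp: convergent_def)
  have "\<exists>n\<ge>r. covar (\<theta> n w) < inverse (real (Suc r))" for r
    using covar_small_infinitely_often[OF pert(2) simp, of "inverse (real (Suc r))" r] by auto
  then obtain s where s: "\<And>r. s r \<ge> r" "\<And>r. covar (\<theta> (s r) w) < inverse (real (Suc r))" by metis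
  have "bounded (range (\<lambda>r. \<theta> (s r) w))"
  proof (rule bounded_subset[OF bounded_cbox])
    show "range (\<lambda>r. \<theta> (s r) w) \<subseteq> cbox 0 1" using bnd by (auto simp: mem_box_cart)
  qed
  then obtain x \<phi> where \<phi>: "strict_mono \<phi>" "((\<lambda>r. \<theta> (s r) w) \<circ> \<phi>) \<longlonglongrightarrow> x"
    using bounded_imp_convergent_subsequence by blast
  define Y where "Y r = \<theta> (s (\<phi> r)) w" for r
  have Xx: "Y \<longlonglongrightarrow> x" using \<phi>(2) by (simp add: Y_def[abs_def] comp_def)
  have Xs: "Y r \<in> prob_vectors" for r by (simp add: Y_def simp)
  have x: "x \<in> prob_vectors" by (rule simplex_limit[OF Xx Xs])
  have sub: "filterlim (\<lambda>r. s (\<phi> r)) sequentially sequentially"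
  proof (rule filterlim_at_top_mono[OF filterlim_ident always_eventually], rule allI)
    fix r show "r \<le> s (\<phi> r)" using s(1)[of "\<phi> r"] seq_suble[OF \<phi>(1), of r] by simp
  qed
  have "(\<lambda>r. covar (Y r)) \<longlonglongrightarrow> covar x"
    unfolding covar_def by (intro tendsto_intros tendsto_vec_nth[OF Xx] tendsto_total_weight(3)[OF Xx Xs x])
  moreover have "(\<lambda>r. covar (Y r)) \<longlonglongrightarrow> 0"
  proof (rule tendsto_sandwich[OF always_eventually always_eventually tendsto_const LIMSEQ_inverse_real_of_nat])
    show "\<forall>r. 0 \<le> covar (Y r)" using covar_nonneg[OF Xs] by simp
    show "\<forall>r. covar (Y r) \<le> inverse (real (Suc r))"
    proof
      fix r
      have "covar (Y r) \<le> inverse (real (Suc (\<phi> r)))" using s(2)[of "\<phi> r"] by (simp add: Y_def)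
      also have "\<dots> \<le> inverse (real (Suc r))" using seq_suble[OF \<phi>(1), of r] by (intro le_imp_inverse_le) auto
      finally show "covar (Y r) \<le> inverse (real (Suc r))" .
    qed
  qed
  ultimately have "covar x = 0" by (rule LIMSEQ_unique)
  note xz = covar_zero[OF x this]
  define m where "m = x $ leader x"
  have m_pos: "m > 0"
  proof -
    obtain k where "x $ k \<noteq> 0" using x unfolding prob_vectors_def by (metis (mono_tags, lifting) mem_Collect_eq sum.neutral zero_neq_one)
    then show ?thesis using leader_max[of x k] simplex_draw(5)[OF x, of k] by (simp add: m_def)
  qed
  have xm: "x $ j = 0 \<or> x $ j = m" for j using xz[of j "leader x"] m_pos by (auto simp: m_def)
  have "(\<lambda>r. L (s (\<phi> r))) \<longlonglongrightarrow> m" unfolding L_def m_def using leader_tendsto[OF Xx] by (simp add: Y_def)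
  then have "l = m" using LIMSEQ_unique filterlim_compose[OF l sub] by blast
  have "(\<lambda>r. V (s (\<phi> r))) \<longlonglongrightarrow> (\<Sum>j\<in>UNIV. (x $ j)\<^sup>2)"
    unfolding V_def Y_def[symmetric] by (intro tendsto_intros tendsto_vec_nth[OF Xx])
  then have "v = (\<Sum>j\<in>UNIV. (x $ j)\<^sup>2)" using LIMSEQ_unique filterlim_compose[OF v sub] by blast
  \<comment> \<open>Each coordinate is 0 or \<open>m\<close>, so its square is \<open>m\<close>
    times itself.\<close>
  also have "\<dots> = (\<Sum>j\<in>UNIV. m * x $ j)" by (rule sum.cong) (use xm in \<open>auto simp: power2_eq_square\<close>)
  also have "\<dots> = m" using x by (simp add: sum_distrib_left[symmetric] prob_vectors_def)
  finally have "v = m" .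
  have LV: "(\<lambda>n. L n - V n) \<longlonglongrightarrow> 0" using tendsto_diff[OF l v] \<open>l = m\<close> \<open>v = m\<close> by simp
  have conv: "(\<lambda>n. \<theta> n w $ j) \<longlonglongrightarrow> 0 \<or> (\<lambda>n. \<theta> n w $ j) \<longlonglongrightarrow> m" for j
  proof (rule slow_sequence_limit_zero_or_m[OF m_pos _ prop_increment_LIMSEQ[OF w simp]])
    \<comment> \<open>The shares sum to 1, so \<open>L n\<close> can be distributed over them. All
      terms are nonnegative, hence each tends to 0 with the sum.\<close>
    have LVs: "L n - V n = (\<Sum>k\<in>UNIV. \<theta> n w $ k * (L n - \<theta> n w $ k))" for n
      using simp[of n] by (simp add: V_def right_diff_distrib sum_subtractf power2_eq_square
          sum_distrib_right[symmetric] prob_vectors_def)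
    have pos: "\<theta> n w $ k * (L n - \<theta> n w $ k) \<ge> 0" for n k
      using bnd leader_max by (simp add: L_def)
    have a: "(\<lambda>n. \<theta> n w $ j * (L n - \<theta> n w $ j)) \<longlonglongrightarrow> 0"
    proof (rule tendsto_sandwich[OF always_eventually always_eventually tendsto_const LV])
      show "\<forall>n. 0 \<le> \<theta> n w $ j * (L n - \<theta> n w $ j)" using pos by blast
      show "\<forall>n. \<theta> n w $ j * (L n - \<theta> n w $ j) \<le> L n - V n"
        unfolding LVs using pos by (intro allI member_le_sum) auto
    qed
    have b: "(\<lambda>n. \<theta> n w $ j * (m - L n)) \<longlonglongrightarrow> 0"
    proof (rule Lim_null_comparison)
      show "\<forall>\<^sub>F n in sequentially. norm (\<theta> n w $ j * (m - L n)) \<le> \<bar>m - L n\<bar>"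
        using bnd by (intro always_eventually allI) (auto simp: abs_mult intro: mult_left_le_one_le)
      show "(\<lambda>n. \<bar>m - L n\<bar>) \<longlonglongrightarrow> 0" using tendsto_rabs[OF tendsto_diff[OF tendsto_const[of m] l]] \<open>l = m\<close> by simp
    qed
    show "(\<lambda>n. \<theta> n w $ j * (m - \<theta> n w $ j)) \<longlonglongrightarrow> 0"
      using tendsto_add[OF a b] by (simp add: algebra_simps)
  qed
  define y where "y = (\<chi> j. if (\<lambda>n. \<theta> n w $ j) \<longlonglongrightarrow> 0 then 0 else m)"
  have "(\<lambda>n. \<theta> n w $ j) \<longlonglongrightarrow> y $ j" for j using conv[of j] by (auto simp: y_def)
  then have lim: "(\<lambda>n. \<theta> n w) \<longlonglongrightarrow> y" by (rule vec_tendstoI)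
  show thesis
    by (rule that[OF lim m_pos _ simplex_limit[OF lim simp]]) (auto simp: y_def)
qed

text \<open>At the tie every nonzero coordinate equals \<open>m\<close>, so the total weight is
  f(m)/m. Nearby it stays below the slope \<beta>, so the draw probabilities of the two colours
  differ by at least as much as their proportions, in the same direction. A natural number as
  constant leaves countably many cases.\<close>

lemma repelling_near_tie:
  assumes lim: "Y \<longlonglongrightarrow> y" and Xs: "\<And>n. Y n \<in> prob_vectors" and ys: "y \<in> prob_vectors"
    and y: "\<And>j. y $ j = 0 \<or> y $ j = m" and m: "m > 0" and ij: "i \<noteq> j" "y $ i = m" "y $ j = m"
  obtains k where "\<forall>\<^sub>F n in sequentially. repelling i j (real (Suc k)) (Y n)"
proof -
  define F where "F x = (\<Sum>k\<in>UNIV. f (x $ k))" for x :: "real ^ 'd"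
  have f0: "f 0 = 0" using f_class by (simp add: reinforcement_class_def)
  have "(\<Sum>k\<in>{i, j}. y $ k) \<le> (\<Sum>k\<in>UNIV. y $ k)"
    using simplex_draw(5)[OF ys] by (intro sum_mono2) auto
  then have m1: "m < 1" using ij m ys by (simp add: prob_vectors_def)
  have fm: "f m > 0" using reinforcement_pos[OF f_class m] m1 by simp
  have "F y = (\<Sum>k\<in>UNIV. f m / m * y $ k)"
    unfolding F_def
  proof (rule sum.cong)
    fix k show "f (y $ k) = f m / m * y $ k" using y[of k] m f0 by auto
  qed simp
  also have "\<dots> = f m / m * (\<Sum>k\<in>UNIV. y $ k)" by (rule sum_distrib_left[symmetric])
  finally have Fy: "F y = f m / m" using ys by (simp add: prob_vectors_def)
  have Fy_pos: "F y > 0" using fm m by (simp add: Fy)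
  obtain \<epsilon> \<beta> C where sl: "\<epsilon> > 0" "\<beta> > f m / m" "C > 0"
    "\<And>x y. \<bar>x - m\<bar> < \<epsilon> \<Longrightarrow> \<bar>y - m\<bar> < \<epsilon> \<Longrightarrow> y \<le> x \<Longrightarrow> \<beta> * (x - y) \<le> f x - f y \<and> f x - f y \<le> C * (x - y)"
    using reinforcement_local_slopes[OF f_class m m1] by blast
  note tw = tendsto_total_weight[OF lim Xs ys]
  have Flim: "(\<lambda>n. F (Y n)) \<longlonglongrightarrow> F y" unfolding F_def by (rule tw(2))
  have "draw y i = m" "draw y j = m"
    using ij fm m Fy by (simp_all add: draw_def F_def[symmetric])
  then have "(\<lambda>n. draw (Y n) i + draw (Y n) j - (draw (Y n) i - draw (Y n) j)\<^sup>2) \<longlonglongrightarrow> m + m - (m - m)\<^sup>2"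
    by (intro tendsto_intros) (use tw(3)[of i] tw(3)[of j] in auto)
  then have e1: "\<forall>\<^sub>F n in sequentially. draw (Y n) i + draw (Y n) j - (draw (Y n) i - draw (Y n) j)\<^sup>2 > m"
    by (rule order_tendstoD) (use m in simp)
  have near: "\<forall>\<^sub>F n in sequentially. \<bar>Y n $ k - m\<bar> < \<epsilon>" if "y $ k = m" for k
    using tendstoD[OF tendsto_vec_nth[OF lim, of k] sl(1)] that by (simp add: dist_real_def)
  have e2: "\<forall>\<^sub>F n in sequentially. F (Y n) < \<beta>" by (rule order_tendstoD[OF Flim]) (use sl(2) Fy in simp)
  have e3: "\<forall>\<^sub>F n in sequentially. F (Y n) > F y / 2" by (rule order_tendstoD[OF Flim]) (use Fy_pos in simp)
  \<comment> \<open>One integer dominates two numbers: 1/m, for the variance, whose limit 2 m is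
    above m; and the Lipschitz constant of \<open>f\<close> divided by a lower bound of the total
    weight.\<close>
  obtain k where k: "real k > max (1 / m) (C / (F y / 2))" using reals_Archimedean2 by blast
  have k1: "1 / real (Suc k) \<le> m" using k m by (simp add: field_simps)
  have k2: "C / (F y / 2) \<le> real (Suc k)" using k by simp
  have "\<forall>\<^sub>F n in sequentially. repelling i j (real (Suc k)) (Y n)"
    using e1 e2 e3 near[OF ij(2)] near[OF ij(3)]
  proof eventually_elim
    case (elim n)
    define u v where "u = Y n $ i" and "v = Y n $ j"
    define \<Phi> where "\<Phi> = F (Y n)"
    have \<Phi>: "\<Phi> < \<beta>" "\<Phi> > F y / 2" "\<Phi> > 0" using elim Fy_pos by (auto simp: \<Phi>_def)
    have uv: "(f u - f v - \<Phi> * (u - v)) * (u - v) \<ge> 0 \<and> \<bar>f u - f v\<bar> \<le> C * \<bar>u - v\<bar>"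
    proof (cases "v \<le> u")
      case True
      have "\<Phi> * (u - v) \<le> \<beta> * (u - v)" using \<Phi>(1) True by (intro mult_right_mono) auto
      moreover have "0 \<le> \<Phi> * (u - v)" using \<Phi>(3) True by simp
      ultimately show ?thesis using sl(4)[of u v] elim True
        by (auto simp: u_def v_def intro!: mult_nonneg_nonneg)
    next
      case False
      then have le: "u \<le> v" by simp
      have "\<Phi> * (v - u) \<le> \<beta> * (v - u)" using \<Phi>(1) le by (intro mult_right_mono) auto
      moreover have "0 \<le> \<Phi> * (v - u)" using \<Phi>(3) le by simp
      moreover have sl': "\<beta> * (v - u) \<le> f v - f u" "f v - f u \<le> C * (v - u)"
        using sl(4)[of v u] elim le by (auto simp: u_def v_def)
      ultimately have "f u - f v - \<Phi> * (u - v) \<le> 0" "\<bar>f u - f v\<bar> = f v - f u"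
        by (auto simp: algebra_simps)
      with le sl'(2) show ?thesis by (simp add: mult_nonpos_nonpos)
    qed
    have d: "draw (Y n) i - draw (Y n) j = (f u - f v) / \<Phi>"
      by (simp add: draw_def u_def v_def \<Phi>_def F_def diff_divide_distrib)
    have "((f u - f v) / \<Phi> - (u - v)) * (u - v) = (f u - f v - \<Phi> * (u - v)) * (u - v) / \<Phi>"
      using \<Phi>(3) by (simp add: field_simps)
    then have c1: "((f u - f v) / \<Phi> - (u - v)) * (u - v) \<ge> 0" using uv \<Phi>(3) by simp
    have "\<bar>(f u - f v) / \<Phi>\<bar> \<le> C * \<bar>u - v\<bar> / \<Phi>" using uv \<Phi>(3) by (simp add: abs_divide divide_right_mono)
    also have "\<dots> \<le> C * \<bar>u - v\<bar> / (F y / 2)"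
      using \<Phi> Fy_pos sl(3) by (intro divide_left_mono) auto
    also have "\<dots> = C / (F y / 2) * \<bar>u - v\<bar>" by simp
    also have "\<dots> \<le> real (Suc k) * \<bar>u - v\<bar>" using k2 by (intro mult_right_mono) auto
    finally have c3: "\<bar>(f u - f v) / \<Phi>\<bar> \<le> real (Suc k) * \<bar>u - v\<bar>" .
    show ?case unfolding repelling_def d u_def[symmetric] v_def[symmetric]
      using c1 c3 elim(1) k1 d by auto
  qed
  then show thesis by (rule that)
qed

section \<open>Almost sure dominance\<close>

lemma dominance_event: "dominance M u0 \<sigma> U \<in> events"
proof -
  have [measurable]: "Measurable.pred M (\<lambda>w. dist (\<theta> n w) x < e)" for n x e
    using history_event[OF adapted_event[OF adapted_comp[OF adapted_prop[OF order_refl]]]] by (simp add: pred_def)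
  have "dominance M u0 \<sigma> U =
    {w \<in> space M. \<exists>i. \<forall>k. \<exists>N. \<forall>n\<ge>N. dist (\<theta> n w) (axis i 1) < inverse (real (Suc k))}"
    unfolding dominance_def LIMSEQ_iff_Suc ..
  also have "\<dots> \<in> events" by measurable
  finally show ?thesis .
qed

text \<open>The tied pair, the constant and the time from which the pair repels all depend on the
  outcome. They range over countable sets, so the null sets are united in advance; off them the
  limit has exactly one nonzero coordinate.\<close>

lemma AE_dominance: "AE w in M. w \<in> dominance M u0 \<sigma> U"
proof -
  have "\<forall>\<^sub>F n in sequentially. \<gamma> n < 1 / 2" by (rule order_tendstoD[OF gamma_LIMSEQ]) simp
  then obtain n1 where n1: "\<And>n. n \<ge> n1 \<Longrightarrow> \<gamma> n < 1 / 2" by (auto simp: eventually_sequentially)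
  \<comment> \<open>\<gamma>(n) < 1/2 means that fewer than half of the balls at time n + 1 are
    new.\<close>
  have n0: "\<tau> (Suc n) \<le> 2 * \<tau> n" if "n \<ge> n1" for n
    using n1[OF that] tau_pos[of "Suc n"] tau_Suc[of n] by (simp add: pos_divide_less_eq)
  define tied where "tied i j k l w \<longleftrightarrow> (\<forall>n\<ge>n1 + l. repelling i j (real (Suc k)) (\<theta> n w)) \<and>
    (\<lambda>n. \<theta> n w $ i - \<theta> n w $ j) \<longlonglongrightarrow> 0" for i j k l w
  have null: "AE w in M. \<not> tied i j k l w" if "i \<noteq> j" for i j k l
    unfolding tied_def
    by (rule eventually_mono[OF AE_not_tied[of i j "real (Suc k)" "n1 + l"]]) (use that n0 in auto)
  have "AE w in M. \<forall>i\<in>UNIV. \<forall>j\<in>UNIV. \<forall>k l. i \<noteq> j \<longrightarrow> \<not> tied i j k l w"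
  proof (rule AE_finite_allI[OF finite], rule AE_finite_allI[OF finite])
    fix i j
    show "AE w in M. \<forall>k l. i \<noteq> j \<longrightarrow> \<not> tied i j k l w"
      unfolding AE_all_countable by (cases "i = j") (use null[of i j] in simp_all)
  qed
  moreover have "AE w in M. summable (\<lambda>n. incr leader_ind n w)"
    by (rule AE_summable_incr[OF adapted_leader_ind leader_ind_le_1])
  moreover have "AE w in M. summable (\<lambda>n. incr prop_weights n w)"
    by (rule AE_summable_incr[OF adapted_prop_weights prop_weights_le_1])
  ultimately show ?thesis using AE_simplex AE_space
  proof eventually_elim
    case (elim w)
    have simp: "\<theta> n w \<in> prob_vectors" for n using elim by (simp add: prob_vectors_def)
    obtain y m where y: "(\<lambda>n. \<theta> n w) \<longlonglongrightarrow> y" "m > 0" "\<And>j. y $ j = 0 \<or> y $ j = m" "y \<in> prob_vectors"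
      using limit_points[of w] elim simp by blast
    obtain i where i: "y $ i \<noteq> 0"
      using y(4) unfolding prob_vectors_def by (metis (mono_tags, lifting) mem_Collect_eq sum.neutral zero_neq_one)
    have others: "y $ j = 0" if "j \<noteq> i" for j
    proof (rule ccontr)
      assume "y $ j \<noteq> 0"
      then have ij: "i \<noteq> j" "y $ i = m" "y $ j = m" using that i y(3)[of i] y(3)[of j] by auto
      obtain k where "\<forall>\<^sub>F n in sequentially. repelling i j (real (Suc k)) (\<theta> n w)"
        using repelling_near_tie[OF y(1) simp y(4,3,2) ij] by blast
      then obtain l where "\<And>n. n \<ge> l \<Longrightarrow> repelling i j (real (Suc k)) (\<theta> n w)"
        by (auto simp: eventually_sequentially)
      moreover have "(\<lambda>n. \<theta> n w $ i - \<theta> n w $ j) \<longlonglongrightarrow> 0"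
        using tendsto_diff[OF tendsto_vec_nth[OF y(1), of i] tendsto_vec_nth[OF y(1), of j]] ij by simp
      ultimately have "tied i j k l w" by (simp add: tied_def)
      then show False using elim ij(1) by blast
    qed
    have "(\<Sum>j\<in>UNIV. y $ j) = (\<Sum>j\<in>UNIV. if j = i then y $ i else 0)" by (rule sum.cong) (auto simp: others)
    then have "y $ i = 1" using y(4) by (simp add: prob_vectors_def)
    then have "y = axis i 1" using others by (auto simp: vec_eq_iff axis_def)
    then show ?case using y(1) elim by (auto simp: dominance_def)
  qed
qed

end

theorem theorem1:
  fixes M :: "'w measure"
    and f :: "real \<Rightarrow> real"
    and \<sigma> :: "nat \<Rightarrow> nat"
    and u0 :: "nat ^ 'd"
    and U :: "nat \<Rightarrow> 'w \<Rightarrow> nat ^ 'd"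
    and X :: "nat \<Rightarrow> nat \<Rightarrow> 'w \<Rightarrow> nat ^ 'd"
  assumes "f \<in> reinforcement_class"
    and "\<And>n. n \<ge> 1 \<Longrightarrow> \<sigma> n > 0"
    and "u0 \<noteq> 0"
    and "polya_urn M f \<sigma> u0 U X"
    and "filterlim (\<lambda>N. \<Sum>n=1..N. real (\<sigma> n) / real (urn_total u0 \<sigma> n)) at_top sequentially"
    and "summable (\<lambda>n. (real (\<sigma> (Suc n)) / real (urn_total u0 \<sigma> (Suc n)))\<^sup>2)"
  shows "measure M (dominance M u0 \<sigma> U) = 1"
proof -
  interpret polya_urn M f \<sigma> u0 U X by fact
  interpret time_dependent_urn M f \<sigma> u0 U X
    by unfold_locales (use assms in auto)
  show ?thesis using prob_eq_1[OF dominance_event] AE_dominance by blast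
qed

end
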